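(* Let $\gamma\in\mathbb{R}$ and let $V:[0,\infty)\to\mathbb{R}$ be measurable with $\int_0^\infty |V(x)|\,dx<\infty$. Let $H_0=-\frac{d^2}{dx^2}$ in $L_2(0,\infty)$ with boundary condition $u'(0)=\gamma u(0)$, $R_0(z)=(H_0-z)^{-1}$, and let $$D(z)=\det\big(\mathbf{1}+\sqrt{V}\,R_0(z)\sqrt{|V|}\big),\qquad z\in\rho(H_0),$$ be the (modified) perturbation determinant, where $\sqrt V:=(\operatorname{sgn}V)\sqrt{|V|}$. Then, with $w$ the Jost function and $\sqrt z$ the square root with $\operatorname{Im}\sqrt z>0$, $$D(z)=\frac{w(\sqrt z)}{\gamma-i\sqrt z},\qquad z\in\rho(H_0).$$
   Context: The operator $H_0$ is defined through the quadratic form $\int_0^\infty|u'|^2\,dx+\gamma|u(0)|^2$ with form domain $H^1(0,\infty)$; $\rho(H_0)$ is its resolvent set. The operator $\sqrt V R_0(z)\sqrt{|V|}$ is trace class, and $\det$ denotes the Fredholm determinant. For $\operatorname{Im}\zeta>0$, the Jost solution $\theta(x,\zeta)$ is the unique solution of $-u''+Vu=\zeta^2u$ on $x>0$ with $\theta(x,\zeta)=e^{i\zeta x}(1+o(1))$, $\theta'(x,\zeta)=i\zeta e^{i\zeta x}(1+o(1))$ as $x\to\infty$ (prime $=d/dx$). The Jost function is $w(\zeta)=\gamma\theta(0,\zeta)-\theta'(0,\zeta)$. *)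

theory Defs
  imports "HOL-Analysis.Analysis" "HOL-Combinatorics.Permutations"
begin

section \<open>The Hilbert space \<open>L\<^sub>2(0,\<infinity>)\<close>\<close>

text \<open>
  Elements of \<open>L\<^sub>2(0,\<infinity>)\<close> are represented by functions; two functions represent the same
  element iff they agree almost everywhere on \<open>(0,\<infinity>)\<close>.  Values on the negative half-line are
  irrelevant.
\<close>

abbreviation half_line :: "real measure" where
  "half_line \<equiv> lebesgue_on {0<..}"

definition L2 :: "(real \<Rightarrow> complex) set" where
  "L2 = {f \<in> borel_measurable half_line. integrable half_line (\<lambda>x. (cmod (f x))\<^sup>2)}"

definition l2_inner :: "(real \<Rightarrow> complex) \<Rightarrow> (real \<Rightarrow> complex) \<Rightarrow> complex" where
  "l2_inner f g = (LINT x|half_line. f x * cnj (g x))"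

definition l2_norm :: "(real \<Rightarrow> complex) \<Rightarrow> real" where
  "l2_norm f = sqrt (LINT x|half_line. (cmod (f x))\<^sup>2)"

definition orthonormal_basis :: "(nat \<Rightarrow> real \<Rightarrow> complex) \<Rightarrow> bool" where
  "orthonormal_basis e \<longleftrightarrow>
     (\<forall>n. e n \<in> L2) \<and>
     (\<forall>m n. l2_inner (e m) (e n) = (if m = n then 1 else 0)) \<and>
     (\<forall>u\<in>L2. (\<forall>n. l2_inner u (e n) = 0) \<longrightarrow> (AE x in half_line. u x = 0))"

definition bounded_operator :: "((real \<Rightarrow> complex) \<Rightarrow> real \<Rightarrow> complex) \<Rightarrow> bool" where
  "bounded_operator K \<longleftrightarrow>
     (\<forall>f\<in>L2. K f \<in> L2) \<and>
     (\<forall>f\<in>L2. \<forall>g\<in>L2. \<forall>a b. AE x in half_line.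
        K (\<lambda>t. a * f t + b * g t) x = a * K f x + b * K g x) \<and>
     (\<exists>C. \<forall>f\<in>L2. l2_norm (K f) \<le> C * l2_norm f)"


section \<open>Trace class operators and the Fredholm determinant\<close>

text \<open>
  Trace class operators are the nuclear ones:
  \<open>K = \<Sum>\<^sub>n \<langle>\<cdot>, f\<^sub>n\<rangle> g\<^sub>n\<close> with \<open>\<Sum>\<^sub>n \<parallel>f\<^sub>n\<parallel> \<parallel>g\<^sub>n\<parallel> < \<infinity>\<close>.
\<close>

definition trace_class :: "((real \<Rightarrow> complex) \<Rightarrow> real \<Rightarrow> complex) \<Rightarrow> bool" where
  "trace_class K \<longleftrightarrow> bounded_operator K \<and>
     (\<exists>f g. (\<forall>n. f n \<in> L2 \<and> g n \<in> L2) \<and>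
        summable (\<lambda>n. l2_norm (f n) * l2_norm (g n)) \<and>
        (\<forall>u\<in>L2. (\<lambda>N. l2_norm (\<lambda>x. K u x - (\<Sum>n<N. l2_inner u (f n) * g n x))) \<longlonglongrightarrow> 0))"

text \<open>
  For an orthonormal basis \<open>e\<close>, the vectors \<open>e\<^sub>I = e\<^bsub>i\<^sub>1\<^esub> \<and> \<dots> \<and> e\<^bsub>i\<^sub>k\<^esub>\<close> with
  \<open>I = {i\<^sub>1 < \<dots> < i\<^sub>k}\<close> form an orthonormal basis of the \<open>k\<close>-th exterior power of the space, and
  \<open>\<langle>\<Lambda>\<^sup>k(K) e\<^sub>I, e\<^sub>I\<rangle>\<close> is the determinant of the matrix \<open>\<langle>K e\<^sub>j, e\<^sub>i\<rangle>\<close> with \<open>i, j \<in> I\<close>,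
  given here by the Leibniz formula.
\<close>

definition exterior_entry ::
    "(nat \<Rightarrow> real \<Rightarrow> complex) \<Rightarrow> ((real \<Rightarrow> complex) \<Rightarrow> real \<Rightarrow> complex) \<Rightarrow> nat set \<Rightarrow> complex" where
  "exterior_entry e K I =
     (\<Sum>p | p permutes I. of_int (sign p) * (\<Prod>i\<in>I. l2_inner (K (e (p i))) (e i)))"

definition exterior_trace ::
    "(nat \<Rightarrow> real \<Rightarrow> complex) \<Rightarrow> ((real \<Rightarrow> complex) \<Rightarrow> real \<Rightarrow> complex) \<Rightarrow> nat \<Rightarrow> complex" where
  "exterior_trace e K k = (\<Sum>\<^sub>\<infinity>I\<in>{I. finite I \<and> card I = k}. exterior_entry e K I)"

text \<open>
  \<open>det (1 + K) = \<Sum>\<^sub>k Tr \<Lambda>\<^sup>k(K)\<close>; the traces do not depend on the orthonormal basis when \<open>K\<close> is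
  trace class, and nothing is specified when it is not.
\<close>

definition fredholm_det :: "((real \<Rightarrow> complex) \<Rightarrow> real \<Rightarrow> complex) \<Rightarrow> complex" where
  "fredholm_det K = (THE d. trace_class K \<and>
     (\<forall>e. orthonormal_basis e \<longrightarrow> (\<lambda>k. exterior_trace e K k) sums d))"


section \<open>Operators, resolvent set and resolvent\<close>

text \<open>
  An (unbounded) operator \<open>A\<close> in \<open>L\<^sub>2(0,\<infinity>)\<close> is given by its graph, i.e. by the pairs \<open>(u, h)\<close>
  with \<open>u\<close> in the domain of \<open>A\<close> and \<open>A u = h\<close>.  The equation \<open>(A - z) u = f\<close> thus reads
  \<open>(u, f + z u) \<in> A\<close>.  The lower bound in \<open>resolvent_set\<close> expresses injectivity of \<open>A - z\<close>
  together with boundedness of the inverse.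
\<close>

type_synonym l2_graph = "((real \<Rightarrow> complex) \<times> (real \<Rightarrow> complex)) set"

definition resolvent_set :: "l2_graph \<Rightarrow> complex set" where
  "resolvent_set A = {z.
     (\<forall>f\<in>L2. \<exists>u. (u, \<lambda>x. f x + z * u x) \<in> A) \<and>
     (\<exists>C. \<forall>(u, h)\<in>A. l2_norm u \<le> C * l2_norm (\<lambda>x. h x - z * u x))}"

definition resolvent :: "l2_graph \<Rightarrow> complex \<Rightarrow> (real \<Rightarrow> complex) \<Rightarrow> real \<Rightarrow> complex" where
  "resolvent A z f = (SOME u. (u, \<lambda>x. f x + z * u x) \<in> A)"


section \<open>The operator \<open>H\<^sub>0\<close>\<close>

text \<open>
  Elements of \<open>H\<^sup>1(0,\<infinity>)\<close> are represented by their absolutely continuous representative on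
  \<open>[0,\<infinity>)\<close>, so that \<open>u 0\<close> is the boundary value; \<open>g\<close> is the weak derivative of \<open>u\<close>.
\<close>

definition has_weak_deriv :: "(real \<Rightarrow> complex) \<Rightarrow> (real \<Rightarrow> complex) \<Rightarrow> bool" where
  "has_weak_deriv u g \<longleftrightarrow> g \<in> L2 \<and> (\<forall>x\<ge>0. u x = u 0 + (LINT t|lebesgue_on {0..x}. g t))"

definition H1 :: "(real \<Rightarrow> complex) set" where
  "H1 = {u \<in> L2. \<exists>g. has_weak_deriv u g}"

definition weak_deriv :: "(real \<Rightarrow> complex) \<Rightarrow> real \<Rightarrow> complex" where
  "weak_deriv u = (SOME g. has_weak_deriv u g)"

text \<open>The sesquilinear form obtained by polarization from \<open>\<integral>\<bar>u'\<bar>\<^sup>2 + \<gamma> \<bar>u(0)\<bar>\<^sup>2\<close>.\<close>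

definition robin_form :: "real \<Rightarrow> (real \<Rightarrow> complex) \<Rightarrow> (real \<Rightarrow> complex) \<Rightarrow> complex" where
  "robin_form \<gamma> u v = l2_inner (weak_deriv u) (weak_deriv v) + of_real \<gamma> * u 0 * cnj (v 0)"

text \<open>The self-adjoint operator associated with this form on the form domain \<open>H1\<close>.\<close>

definition H0 :: "real \<Rightarrow> l2_graph" where
  "H0 \<gamma> = {(u, h). u \<in> H1 \<and> h \<in> L2 \<and> (\<forall>v\<in>H1. robin_form \<gamma> u v = l2_inner h v)}"


section \<open>The perturbation determinant\<close>

definition sqrt_abs :: "(real \<Rightarrow> real) \<Rightarrow> real \<Rightarrow> complex" where
  "sqrt_abs V x = of_real (sqrt \<bar>V x\<bar>)"

definition signed_sqrt :: "(real \<Rightarrow> real) \<Rightarrow> real \<Rightarrow> complex" where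
  "signed_sqrt V x = of_real (sgn (V x) * sqrt \<bar>V x\<bar>)"

text \<open>
  Multiplication by \<open>\<surd>\<bar>V\<bar>\<close> is in general unbounded, so the product \<open>\<surd>V R\<^sub>0(z) \<surd>\<bar>V\<bar>\<close> is a priori
  defined only on the dense set of \<open>f\<close> with \<open>\<surd>\<bar>V\<bar> f \<in> L\<^sub>2\<close>.  As usual, it stands for its
  bounded extension to the whole space, which is unique up to equality almost everywhere.
\<close>

definition birman_schwinger ::
    "real \<Rightarrow> (real \<Rightarrow> real) \<Rightarrow> complex \<Rightarrow> (real \<Rightarrow> complex) \<Rightarrow> real \<Rightarrow> complex" where
  "birman_schwinger \<gamma> V z = (SOME K. bounded_operator K \<and>
     (\<forall>f\<in>L2. (\<lambda>x. sqrt_abs V x * f x) \<in> L2 \<longrightarrow>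
        (AE x in half_line.
           K f x = signed_sqrt V x * resolvent (H0 \<gamma>) z (\<lambda>t. sqrt_abs V t * f t) x)))"

definition perturbation_det :: "real \<Rightarrow> (real \<Rightarrow> real) \<Rightarrow> complex \<Rightarrow> complex" where
  "perturbation_det \<gamma> V z = fredholm_det (birman_schwinger \<gamma> V z)"


section \<open>Jost solution and Jost function\<close>

text \<open>
  \<open>\<theta>\<close> solves \<open>-\<theta>'' + V \<theta> = \<zeta>\<^sup>2 \<theta>\<close> in the Caratheodory sense: \<open>\<theta>'\<close> exists and is absolutely
  continuous, and the equation holds almost everywhere (up to the endpoint \<open>0\<close>, where \<open>V\<close> is
  integrable).  Outside \<open>[0,\<infinity>)\<close> the value is fixed by \<open>extensional\<close>, for uniqueness.
\<close>

definition is_jost_solution :: "(real \<Rightarrow> real) \<Rightarrow> complex \<Rightarrow> (real \<Rightarrow> complex) \<Rightarrow> bool" where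
  "is_jost_solution V \<zeta> \<theta> \<longleftrightarrow> \<theta> \<in> extensional {0..} \<and>
     (\<exists>\<theta>'. (\<forall>x\<ge>0. (\<theta> has_vector_derivative \<theta>' x) (at x within {0..})) \<and>
        (\<forall>x\<ge>0. \<theta>' x = \<theta>' 0 + (LINT t|lebesgue_on {0..x}. (of_real (V t) - \<zeta>\<^sup>2) * \<theta> t)) \<and>
        ((\<lambda>x. \<theta> x / exp (\<i> * \<zeta> * of_real x)) \<longlongrightarrow> 1) at_top \<and>
        ((\<lambda>x. \<theta>' x / (\<i> * \<zeta> * exp (\<i> * \<zeta> * of_real x))) \<longlongrightarrow> 1) at_top)"

definition jost_solution :: "(real \<Rightarrow> real) \<Rightarrow> complex \<Rightarrow> real \<Rightarrow> complex" where
  "jost_solution V \<zeta> = (THE \<theta>. is_jost_solution V \<zeta> \<theta>)"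

definition jost_function :: "real \<Rightarrow> (real \<Rightarrow> real) \<Rightarrow> complex \<Rightarrow> complex" where
  "jost_function \<gamma> V \<zeta> = of_real \<gamma> * jost_solution V \<zeta> 0 -
     vector_derivative (jost_solution V \<zeta>) (at 0 within {0..})"

definition upper_sqrt :: "complex \<Rightarrow> complex" where
  "upper_sqrt z = (THE \<zeta>. \<zeta>\<^sup>2 = z \<and> Im \<zeta> > 0)"

end

(*
  Write G for the Green function of H_0 at z = zeta^2 and kappa = i zeta, so Re kappa < 0.

  Since G(x,y) = c exp(kappa(x+y)) + integral over t < min(x,y) of exp(kappa(x-t)) exp(kappa(y-t)),
  expanding the integrand in an orthonormal basis of L_2 writes the Birman-Schwinger operator K as
  a nuclear sum of rank-one operators. Summing the k x k principal minors of K over an orthonormal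
  basis then gives, by Parseval and whatever the basis,
    Tr Lambda^k K = 1/k! times the integral of det G(x_i,x_j) V(x_1) ... V(x_k).
  The integrand is symmetric, so the integral may be taken over x_1 < ... < x_k without the 1/k!.
  There the determinant telescopes, because G(x,y) is a function of min(x,y) times a function of
  max(x,y), into G(x_1,x_1) times the product of s(x_{i+1} - x_i), where s is the kernel of the
  Volterra equation for the Jost solution. Hence Tr Lambda^k K is the k-th term of the Neumann
  series of w(zeta) / (gamma - i zeta).
*)

theory Submission
  imports Defs
begin

section \<open>The space \<open>L\<^sub>2(0,\<infinity>)\<close>\<close>

text \<open>\<open>resolvent\<close>, \<open>birman_schwinger\<close> and
  \<open>fredholm_det\<close> are given by choice or description, so each must be pinned down before
  anything can be computed. Resolvent and operator are fixed only almost everywhere, so an operator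
  alone has no values on the diagonal; its traces are formed from inner products of a nuclear
  expansion, and dominated convergence leads back to the explicit kernel. The determinant asks for
  one value for all orthonormal bases: the trace is computed for an arbitrary basis, and some basis
  must be constructed, both for the expansion and because without one every number would fit the
  description. The lower bound for H_0 - z is used three times: it excludes [0,\<infinity>), so that
  the square root exists; it excludes the eigenvalue -\<gamma>^2 occurring for \<gamma> < 0, so that
  \<gamma> - i\<zeta> is nonzero; and it makes the resolvent unique. The last link is the identity
  w/(\<gamma> - i\<zeta>) - 1 = integral of V(y) G(y,y) M(y), where M(y) = exp(-i\<zeta>y)
  \<theta>(y), into which the Volterra series of M is inserted.\<close>

lemma integral_Cauchy_Schwarz:
  fixes f g :: "'a \<Rightarrow> real"
  assumes "integrable M (\<lambda>x. (f x)\<^sup>2)" "integrable M (\<lambda>x. (g x)\<^sup>2)" "integrable M (\<lambda>x. f x * g x)"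
  shows "(LINT x|M. f x * g x)\<^sup>2 \<le> (LINT x|M. (f x)\<^sup>2) * (LINT x|M. (g x)\<^sup>2)"
proof -
  let ?F = "LINT x|M. (f x)\<^sup>2" and ?G = "LINT x|M. (g x)\<^sup>2" and ?a = "LINT x|M. f x * g x"
  \<comment> \<open>The integral of (t f - g)^2 is a nonnegative quadratic in t. If F > 0 it is
    evaluated at its minimiser t = a/F; if F = 0 it is affine in t, and t = (G + 1)/a would make it
    negative.\<close>
  have *: "0 \<le> t\<^sup>2 * ?F - 2 * t * ?a + ?G" for t
  proof -
    have "0 \<le> (LINT x|M. (t * f x - g x)\<^sup>2)" by simp
    also have "\<dots> = (LINT x|M. t\<^sup>2 * (f x)\<^sup>2 - 2 * t * (f x * g x) + (g x)\<^sup>2)"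
      by (rule Bochner_Integration.integral_cong) (simp_all add: power2_eq_square algebra_simps)
    also have "\<dots> = t\<^sup>2 * ?F - 2 * t * ?a + ?G"
      using assms by simp
    finally show ?thesis .
  qed
  have F0: "?F \<ge> 0" by simp
  show ?thesis
  proof (cases "?F = 0")
    case True
    have "?a = 0"
    proof (rule ccontr)
      assume "?a \<noteq> 0"
      moreover have "?G \<ge> 0" by simp
      ultimately show False using *[of "(?G + 1) / ?a"] True by (simp del: Bochner_Integration.integral_nonneg)
    qed
    then show ?thesis by simp
  next
    case False
    then have "?F > 0" using F0 by linarith
    have eq: "(a / F)\<^sup>2 * F - 2 * (a / F) * a + G = (F * G - a\<^sup>2) / F" if "F > 0" for a F G :: real
      using that by (simp add: power2_eq_square field_simps)
    show ?thesis using *[of "?a / ?F"] unfolding eq[OF \<open>?F > 0\<close>]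
      using \<open>?F > 0\<close> by (simp add: zero_le_divide_iff)
  qed
qed

lemma L2D:
  assumes "f \<in> L2"
  shows "f \<in> borel_measurable half_line" "integrable half_line (\<lambda>x. (cmod (f x))\<^sup>2)"
  using assms by (auto simp: L2_def)

lemma L2_mult_integrable:
  assumes "f \<in> L2" "g \<in> L2"
  shows "integrable half_line (\<lambda>x. f x * g x)"
proof (rule Bochner_Integration.integrable_bound)
  note [measurable] = L2D(1)[OF assms(1)] L2D(1)[OF assms(2)]
  show "integrable half_line (\<lambda>x. (cmod (f x))\<^sup>2 + (cmod (g x))\<^sup>2)"
    using assms by (intro Bochner_Integration.integrable_add L2D)
  show "(\<lambda>x. f x * g x) \<in> borel_measurable half_line" by measurable
  have "a * b \<le> a\<^sup>2 + b\<^sup>2" if "a \<ge> 0" "b \<ge> 0" for a b :: real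
    using sum_squares_bound[of a b] mult_nonneg_nonneg[OF that] by linarith
  then show "AE x in half_line. norm (f x * g x) \<le> norm ((cmod (f x))\<^sup>2 + (cmod (g x))\<^sup>2)"
    by (auto simp: norm_mult)
qed

lemma L2_bound:
  assumes "f \<in> L2" "g \<in> borel_measurable half_line"
    "AE x in half_line. cmod (g x) \<le> C * cmod (f x)"
  shows "g \<in> L2"
  unfolding L2_def
proof (intro CollectI conjI assms(2), rule Bochner_Integration.integrable_bound)
  note [measurable] = assms(2)
  show "integrable half_line (\<lambda>x. C\<^sup>2 * (cmod (f x))\<^sup>2)"
    using L2D(2)[OF assms(1)] by simp
  show "(\<lambda>x. (cmod (g x))\<^sup>2) \<in> borel_measurable half_line" by measurable
  show "AE x in half_line. norm ((cmod (g x))\<^sup>2) \<le> norm (C\<^sup>2 * (cmod (f x))\<^sup>2)"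
    using assms(3)
  proof eventually_elim
    case (elim x)
    then have "(cmod (g x))\<^sup>2 \<le> (C * cmod (f x))\<^sup>2" by (intro power_mono) auto
    then show ?case by (simp add: power_mult_distrib)
  qed
qed

lemma L2_cong_AE:
  assumes "f \<in> L2" "g \<in> borel_measurable half_line" "AE x in half_line. g x = f x"
  shows "g \<in> L2"
  using assms(3) by (intro L2_bound[OF assms(1,2), of 1]) auto

lemma borel_measurable_cnj:
  assumes "f \<in> borel_measurable M"
  shows "(\<lambda>x. cnj (f x)) \<in> borel_measurable M"
  by (rule measurable_compose[OF assms borel_measurable_continuous_onI]) (intro continuous_intros)

lemma L2_cnj: "f \<in> L2 \<Longrightarrow> (\<lambda>x. cnj (f x)) \<in> L2"
  by (rule L2_bound[of f _ 1]) (simp_all add: L2_def borel_measurable_cnj)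

lemma L2_scale: "f \<in> L2 \<Longrightarrow> (\<lambda>x. c * f x) \<in> L2"
  by (rule L2_bound[of f _ "cmod c"]) (auto simp: L2_def norm_mult)

lemma L2_add:
  assumes "f \<in> L2" "g \<in> L2"
  shows "(\<lambda>x. f x + g x) \<in> L2"
proof -
  note [measurable] = L2D(1)[OF assms(1)] L2D(1)[OF assms(2)]
  have "integrable half_line (\<lambda>x. (cmod (f x + g x))\<^sup>2)"
  proof (rule Bochner_Integration.integrable_bound)
  show "(\<lambda>x. (cmod (f x + g x))\<^sup>2) \<in> borel_measurable half_line" by measurable
  show "integrable half_line (\<lambda>x. 2 * (cmod (f x))\<^sup>2 + 2 * (cmod (g x))\<^sup>2)"
    using assms by (intro Bochner_Integration.integrable_add integrable_mult_right L2D)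
  have "(cmod (a + b))\<^sup>2 \<le> 2 * (cmod a)\<^sup>2 + 2 * (cmod b)\<^sup>2" for a b
  proof -
    have "(cmod (a + b))\<^sup>2 \<le> (cmod a + cmod b)\<^sup>2" by (intro power_mono norm_triangle_ineq) auto
    also have "\<dots> \<le> 2 * (cmod a)\<^sup>2 + 2 * (cmod b)\<^sup>2"
      using sum_squares_bound[of "cmod a" "cmod b"] by (simp add: power2_sum)
    finally show ?thesis .
  qed
  then show "AE x in half_line. norm ((cmod (f x + g x))\<^sup>2) \<le> norm (2 * (cmod (f x))\<^sup>2 + 2 * (cmod (g x))\<^sup>2)"
    by auto
qed
  then show ?thesis by (simp add: L2_def)
qed

lemma L2_diff: "f \<in> L2 \<Longrightarrow> g \<in> L2 \<Longrightarrow> (\<lambda>x. f x - g x) \<in> L2"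
  using L2_add[of f "\<lambda>x. (-1) * g x"] L2_scale[of g "-1"] by simp

lemma L2_zero [simp]: "(\<lambda>x. 0) \<in> L2"
  by (simp add: L2_def)

lemma L2_sum: "(\<And>i. i \<in> I \<Longrightarrow> f i \<in> L2) \<Longrightarrow> (\<lambda>x. \<Sum>i\<in>I. f i x) \<in> L2"
  by (induction I rule: infinite_finite_induct) (auto intro: L2_add)

lemma l2_norm_nonneg [simp]: "l2_norm f \<ge> 0"
  by (simp add: l2_norm_def)

lemma l2_norm_power2: "(l2_norm f)\<^sup>2 = (LINT x|half_line. (cmod (f x))\<^sup>2)"
  by (simp add: l2_norm_def)

lemma l2_inner_self: "l2_inner f f = of_real ((l2_norm f)\<^sup>2)"
  by (simp add: l2_norm_power2 l2_inner_def flip: integral_complex_of_real complex_norm_square)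

lemma l2_norm_cong_AE:
  assumes "f \<in> borel_measurable half_line" "g \<in> borel_measurable half_line" "AE x in half_line. f x = g x"
  shows "l2_norm f = l2_norm g"
  unfolding l2_norm_def using assms by (auto intro!: integral_cong_AE arg_cong[where f=sqrt])

lemma l2_inner_cong_AE:
  assumes "f \<in> borel_measurable half_line" "f' \<in> borel_measurable half_line"
    "g \<in> borel_measurable half_line" "AE x in half_line. f x = f' x"
  shows "l2_inner f g = l2_inner f' g"
proof -
  have [measurable]: "(\<lambda>x. cnj (g x)) \<in> borel_measurable half_line"
    using assms(3) by (rule borel_measurable_cnj)
  note [measurable] = assms(1,2)
  show ?thesis
    unfolding l2_inner_def using assms(4) by (intro integral_cong_AE) auto
qed

lemma l2_inner_cnj: "cnj (l2_inner f g) = l2_inner g f"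
  by (simp add: l2_inner_def mult.commute flip: Bochner_Integration.integral_cnj)

lemma l2_inner_integrable:
  "f \<in> L2 \<Longrightarrow> g \<in> L2 \<Longrightarrow> integrable half_line (\<lambda>x. f x * cnj (g x))"
  by (intro L2_mult_integrable L2_cnj)

lemma l2_inner_add_left:
  "f \<in> L2 \<Longrightarrow> g \<in> L2 \<Longrightarrow> h \<in> L2 \<Longrightarrow> l2_inner (\<lambda>x. f x + g x) h = l2_inner f h + l2_inner g h"
  unfolding l2_inner_def
  by (subst Bochner_Integration.integral_add[symmetric]) (auto simp: algebra_simps l2_inner_integrable)

lemma l2_inner_diff_left:
  "f \<in> L2 \<Longrightarrow> g \<in> L2 \<Longrightarrow> h \<in> L2 \<Longrightarrow> l2_inner (\<lambda>x. f x - g x) h = l2_inner f h - l2_inner g h"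
  unfolding l2_inner_def
  by (subst Bochner_Integration.integral_diff[symmetric]) (auto simp: algebra_simps l2_inner_integrable)

lemma l2_inner_scale_left: "l2_inner (\<lambda>x. c * f x) h = c * l2_inner f h"
  unfolding l2_inner_def by (simp add: mult.assoc)

lemma l2_inner_sum_left:
  assumes "\<And>i. i \<in> I \<Longrightarrow> f i \<in> L2" "h \<in> L2"
  shows "l2_inner (\<lambda>x. \<Sum>i\<in>I. f i x) h = (\<Sum>i\<in>I. l2_inner (f i) h)"
  using assms(1)
proof (induction I rule: infinite_finite_induct)
  case (insert i I)
  then show ?case using assms(2) by (simp add: l2_inner_add_left L2_sum)
qed (simp_all add: l2_inner_def)

lemma l2_inner_diff_right:
  "f \<in> L2 \<Longrightarrow> g \<in> L2 \<Longrightarrow> h \<in> L2 \<Longrightarrow> l2_inner h (\<lambda>x. f x - g x) = l2_inner h f - l2_inner h g"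
  using l2_inner_diff_left[of f g h] by (metis complex_cnj_diff l2_inner_cnj)

lemma l2_inner_sum_right:
  assumes "\<And>i. i \<in> I \<Longrightarrow> f i \<in> L2" "h \<in> L2"
  shows "l2_inner h (\<lambda>x. \<Sum>i\<in>I. c i * f i x) = (\<Sum>i\<in>I. cnj (c i) * l2_inner h (f i))"
proof -
  have "l2_inner (\<lambda>x. \<Sum>i\<in>I. c i * f i x) h = (\<Sum>i\<in>I. c i * l2_inner (f i) h)"
    using assms by (subst l2_inner_sum_left) (auto simp: L2_scale l2_inner_scale_left)
  from arg_cong[OF this, of cnj] show ?thesis
    by (simp add: l2_inner_cnj)
qed

lemma L2_abs_mult_integrable:
  assumes "f \<in> L2" "g \<in> L2"
  shows "integrable half_line (\<lambda>x. cmod (f x) * cmod (g x))"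
  using integrable_norm[OF L2_mult_integrable[OF assms]] by (simp add: norm_mult)

lemma L2_abs_mult_integral_le:
  assumes "f \<in> L2" "g \<in> L2"
  shows "(LINT x|half_line. cmod (f x) * cmod (g x)) \<le> l2_norm f * l2_norm g"
proof (rule power2_le_imp_le)
  show "(LINT x|half_line. cmod (f x) * cmod (g x))\<^sup>2 \<le> (l2_norm f * l2_norm g)\<^sup>2"
    using integral_Cauchy_Schwarz[OF L2D(2)[OF assms(1)] L2D(2)[OF assms(2)] L2_abs_mult_integrable[OF assms]]
    by (simp add: power_mult_distrib l2_norm_power2)
qed simp

lemma l2_inner_abs_le:
  assumes "f \<in> L2" "g \<in> L2"
  shows "cmod (l2_inner f g) \<le> l2_norm f * l2_norm g"
proof -
  have "cmod (l2_inner f g) \<le> (LINT x|half_line. cmod (f x * cnj (g x)))"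
    unfolding l2_inner_def by (rule integral_norm_bound)
  then show ?thesis using L2_abs_mult_integral_le[OF assms] by (simp add: norm_mult)
qed

lemma l2_norm_triangle:
  assumes "f \<in> L2" "g \<in> L2"
  shows "l2_norm (\<lambda>x. f x + g x) \<le> l2_norm f + l2_norm g"
proof (rule power2_le_imp_le)
  have "(l2_norm (\<lambda>x. f x + g x))\<^sup>2 \<le>
      (LINT x|half_line. (cmod (f x))\<^sup>2 + 2 * (cmod (f x) * cmod (g x)) + (cmod (g x))\<^sup>2)"
    unfolding l2_norm_power2
  proof (rule integral_mono)
    show "integrable half_line (\<lambda>x. (cmod (f x + g x))\<^sup>2)"
      using L2_add[OF assms] by (rule L2D)
    show "integrable half_line (\<lambda>x. (cmod (f x))\<^sup>2 + 2 * (cmod (f x) * cmod (g x)) + (cmod (g x))\<^sup>2)"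
      using assms by (intro Bochner_Integration.integrable_add integrable_mult_right L2D L2_abs_mult_integrable)
    fix x
    have "(cmod (f x + g x))\<^sup>2 \<le> (cmod (f x) + cmod (g x))\<^sup>2"
      by (intro power_mono norm_triangle_ineq) auto
    then show "(cmod (f x + g x))\<^sup>2 \<le> (cmod (f x))\<^sup>2 + 2 * (cmod (f x) * cmod (g x)) + (cmod (g x))\<^sup>2"
      by (simp add: power2_eq_square algebra_simps)
  qed
  also have "\<dots> = (l2_norm f)\<^sup>2 + 2 * (LINT x|half_line. cmod (f x) * cmod (g x)) + (l2_norm g)\<^sup>2"
    using assms L2_abs_mult_integrable[OF assms] by (simp add: l2_norm_power2 L2D)
  also have "\<dots> \<le> (l2_norm f + l2_norm g)\<^sup>2"
    using L2_abs_mult_integral_le[OF assms] by (simp add: power2_eq_square algebra_simps)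
  finally show "(l2_norm (\<lambda>x. f x + g x))\<^sup>2 \<le> (l2_norm f + l2_norm g)\<^sup>2" .
qed simp

lemma l2_norm_scale: "l2_norm (\<lambda>x. c * f x) = cmod c * l2_norm f"
  by (simp add: l2_norm_def norm_mult power_mult_distrib real_sqrt_mult)

lemma l2_norm_minus_commute: "l2_norm (\<lambda>x. f x - g x) = l2_norm (\<lambda>x. g x - f x)"
  by (simp add: l2_norm_def norm_minus_commute)

lemma l2_norm_eq_0_iff:
  assumes "f \<in> L2"
  shows "l2_norm f = 0 \<longleftrightarrow> (AE x in half_line. f x = 0)"
proof -
  have "l2_norm f = 0 \<longleftrightarrow> (LINT x|half_line. (cmod (f x))\<^sup>2) = 0"
    by (simp add: l2_norm_def)
  also have "\<dots> \<longleftrightarrow> (AE x in half_line. (cmod (f x))\<^sup>2 = 0)"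
    by (rule integral_nonneg_eq_0_iff_AE[OF L2D(2)[OF assms]]) auto
  finally show ?thesis by simp
qed

section \<open>Convergence and completeness in L2\<close>

lemma l2_norm_dominated_convergence:
  assumes "\<And>n. s n \<in> borel_measurable half_line" "w \<in> L2"
    "\<And>n x. x > 0 \<Longrightarrow> cmod (s n x) \<le> cmod (w x)" "\<And>x. x > 0 \<Longrightarrow> (\<lambda>n. s n x) \<longlonglongrightarrow> 0"
  shows "(\<lambda>n. l2_norm (s n)) \<longlonglongrightarrow> 0"
proof -
  note [measurable] = assms(1)
  have "(\<lambda>n. LINT x|half_line. (cmod (s n x))\<^sup>2) \<longlonglongrightarrow> (LINT x|half_line. 0)"
  proof (rule integral_dominated_convergence)
    show "integrable half_line (\<lambda>x. (cmod (w x))\<^sup>2)" by (rule L2D(2)[OF assms(2)])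
    show "AE x in half_line. (\<lambda>n. (cmod (s n x))\<^sup>2) \<longlonglongrightarrow> 0"
      using assms(4) by (intro AE_I2) (auto intro!: tendsto_eq_intros tendsto_norm_zero)
    show "AE x in half_line. norm ((cmod (s n x))\<^sup>2) \<le> (cmod (w x))\<^sup>2" for n
      using assms(3) by (intro AE_I2) (auto intro!: power_mono)
  qed auto
  then show ?thesis unfolding l2_norm_def by (auto intro!: tendsto_eq_intros)
qed

text \<open>The squared increments have integral at most 4^-k, so even after weighting with 2^k
  their series is integrable, hence finite almost everywhere. Where it is finite its terms are
  bounded by some B, and the increments are at most sqrt B * 2^(-k/2), a geometric series.\<close>

lemma L2_fast_Cauchy_convergent_AE:
  assumes s: "\<And>k. s k \<in> L2" and le: "\<And>k. l2_norm (\<lambda>x. s (Suc k) x - s k x) \<le> (1/2)^k"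
  shows "AE x in half_line. convergent (\<lambda>k. s k x)"
proof -
  define d where "d k x = 2 ^ k * (cmod (s (Suc k) x - s k x))\<^sup>2" for k x
  have dL2: "(\<lambda>x. s (Suc k) x - s k x) \<in> L2" for k by (intro L2_diff s)
  have dint: "integrable half_line (d k)" for k
    unfolding d_def by (intro integrable_mult_right L2D(2) dL2)
  have [measurable]: "d k \<in> borel_measurable half_line" for k
    using dint by blast
  have d0: "d k x \<ge> 0" for k x by (simp add: d_def)
  have "(LINT x|half_line. d k x) \<le> (1/2)^k" for k
  proof -
    have "(LINT x|half_line. d k x) = 2 ^ k * (l2_norm (\<lambda>x. s (Suc k) x - s k x))\<^sup>2"
      by (simp add: d_def l2_norm_power2)
    also have "\<dots> \<le> 2 ^ k * ((1/2)^k)\<^sup>2"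
      using le by (intro mult_left_mono power_mono) auto
    also have "\<dots> = (1/2)^k"
      by (simp add: power2_eq_square power_divide)
    finally show ?thesis .
  qed
  then have "(\<integral>\<^sup>+x. ennreal (d k x) \<partial>half_line) \<le> ennreal ((1/2)^k)" for k
    using nn_integral_eq_integral[OF dint] d0 by (simp add: ennreal_leI)
  then have "(\<integral>\<^sup>+x. (\<Sum>k. ennreal (d k x)) \<partial>half_line) \<le> (\<Sum>k. ennreal ((1/2)^k))"
    by (subst nn_integral_suminf) (auto intro!: suminf_le)
  also have "(\<Sum>k. ennreal ((1/2)^k)) = ennreal (\<Sum>k. (1/2)^k)"
    by (rule suminf_ennreal2) (auto intro: summable_geometric zero_le_power)
  finally have "(\<integral>\<^sup>+x. (\<Sum>k. ennreal (d k x)) \<partial>half_line) \<noteq> \<infinity>"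
    unfolding infinity_ennreal_def by (rule neq_top_trans[OF ennreal_neq_top])
  then have "AE x in half_line. (\<Sum>k. ennreal (d k x)) \<noteq> \<infinity>"
    by (intro nn_integral_PInf_AE) auto
  then show ?thesis
  proof eventually_elim
    case (elim x)
    then have "summable (\<lambda>k. d k x)" using d0 by (intro summable_suminf_not_top) auto
    then have "Bseq (\<lambda>k. d k x)"
      by (intro convergent_imp_Bseq) (auto dest: summable_LIMSEQ_zero simp: convergent_def)
    then obtain B where B: "B > 0" "\<And>k. \<bar>d k x\<bar> \<le> B" by (auto simp: Bseq_def)
    have *: "cmod (s (Suc k) x - s k x) \<le> sqrt B * (1 / sqrt 2) ^ k" for k
    proof (rule power2_le_imp_le)
      have "2 ^ k * (cmod (s (Suc k) x - s k x))\<^sup>2 \<le> B"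
        using B(2)[of k] by (simp add: d_def)
      then have "(cmod (s (Suc k) x - s k x))\<^sup>2 \<le> B / 2 ^ k"
        by (simp add: field_simps)
      also have "\<dots> = (sqrt B * (1 / sqrt 2) ^ k)\<^sup>2"
      proof -
        have "((1 / sqrt 2) ^ k)\<^sup>2 = ((1 / sqrt 2)\<^sup>2) ^ k" by (simp flip: power_mult add: mult.commute)
        then show ?thesis using B by (simp add: power_mult_distrib power_divide)
      qed
      finally show "(cmod (s (Suc k) x - s k x))\<^sup>2 \<le> (sqrt B * (1 / sqrt 2) ^ k)\<^sup>2" .
    qed (use B in auto)
    have "summable (\<lambda>k. sqrt B * (1 / sqrt 2) ^ k)"
      by (intro summable_mult summable_geometric) auto
    then have "summable (\<lambda>k. s (Suc k) x - s k x)"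
      by (rule summable_comparison_test') (use * in auto)
    then have "convergent (\<lambda>k. s k x - s 0 x)"
      by (simp add: summable_iff_convergent sum_lessThan_telescope[of "\<lambda>k. s k x"])
    then have "convergent (\<lambda>k. (s k x - s 0 x) + s 0 x)"
      by (intro convergent_add) (auto simp: convergent_const)
    then show ?case by simp
  qed
qed

lemma L2_complete:
  assumes s: "\<And>n. s n \<in> L2"
    and Cauchy: "\<And>\<epsilon>. \<epsilon> > 0 \<Longrightarrow> \<exists>N. \<forall>m\<ge>N. \<forall>n\<ge>N. l2_norm (\<lambda>x. s m x - s n x) < \<epsilon>"
  shows "\<exists>f\<in>L2. (\<lambda>n. l2_norm (\<lambda>x. s n x - f x)) \<longlonglongrightarrow> 0"
proof -
  obtain N where N: "\<And>k m n. m \<ge> N k \<Longrightarrow> n \<ge> N k \<Longrightarrow> l2_norm (\<lambda>x. s m x - s n x) < (1/2)^k"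
    using Cauchy[of "(1/2)^k" for k] by (metis zero_less_divide_1_iff zero_less_numeral zero_less_power)
  \<comment> \<open>Summing the \<open>N j\<close> with j \<le> k gives \<open>r k\<close> \<ge>
    \<open>N k\<close> and \<open>r (Suc k)\<close> \<ge> \<open>N k\<close>, so consecutive members
    of the subsequence are within (1/2)^k. The extra summand k makes \<open>r\<close> tend to
    infinity.\<close>
  define r where "r k = k + (\<Sum>j\<le>k. N j)" for k
  have rN: "r k \<ge> N k" and r_ge: "r k \<ge> k" and r_Suc: "r (Suc k) \<ge> N k" for k
    unfolding r_def using member_le_sum[of k "{..k}" N] by simp_all
  have "AE x in half_line. convergent (\<lambda>k. s (r k) x)"
    using N[OF r_Suc rN] by (intro L2_fast_Cauchy_convergent_AE s) (auto intro: less_imp_le)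
  define f where "f x = lim (\<lambda>k. s (r k) x)" for x
  have lim: "AE x in half_line. (\<lambda>k. s (r k) x) \<longlonglongrightarrow> f x"
    using \<open>AE x in half_line. convergent (\<lambda>k. s (r k) x)\<close>
    by eventually_elim (simp add: f_def convergent_LIMSEQ_iff)
  note [measurable] = L2D(1)[OF s]
  have f_meas [measurable]: "f \<in> borel_measurable half_line"
    unfolding f_def by measurable
  \<comment> \<open>Fatou's lemma along the subsequence turns the Cauchy bound on
    \<open>s m - s n\<close> into the same bound on \<open>s m - f\<close>. It is stated for
    nonnegative integrals because \<open>f\<close> is not yet known to be in
    \<open>L2\<close>.\<close>
  have bound: "(\<integral>\<^sup>+x. ennreal ((cmod (s m x - f x))\<^sup>2) \<partial>half_line) \<le> ennreal (\<epsilon>\<^sup>2)"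
    if m: "\<And>n. n \<ge> m \<Longrightarrow> l2_norm (\<lambda>x. s m x - s n x) \<le> \<epsilon>" for m \<epsilon>
  proof -
    have "(\<integral>\<^sup>+x. ennreal ((cmod (s m x - f x))\<^sup>2) \<partial>half_line) =
        (\<integral>\<^sup>+x. liminf (\<lambda>k. ennreal ((cmod (s m x - s (r k) x))\<^sup>2)) \<partial>half_line)"
    proof (rule nn_integral_cong_AE)
      show "AE x in half_line. ennreal ((cmod (s m x - f x))\<^sup>2) =
          liminf (\<lambda>k. ennreal ((cmod (s m x - s (r k) x))\<^sup>2))"
        using lim
      proof eventually_elim
        case (elim x)
        then have "(\<lambda>k. ennreal ((cmod (s m x - s (r k) x))\<^sup>2)) \<longlonglongrightarrow> ennreal ((cmod (s m x - f x))\<^sup>2)"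
          by (intro tendsto_intros)
        then show ?case by (rule lim_imp_Liminf[OF trivial_limit_sequentially, symmetric])
      qed
    qed
    also have "\<dots> \<le> liminf (\<lambda>k. \<integral>\<^sup>+x. ennreal ((cmod (s m x - s (r k) x))\<^sup>2) \<partial>half_line)"
      by (rule nn_integral_liminf) measurable
    also have "\<dots> \<le> ennreal (\<epsilon>\<^sup>2)"
    proof (rule Liminf_le)
      show "\<forall>\<^sub>F k in sequentially. (\<integral>\<^sup>+x. ennreal ((cmod (s m x - s (r k) x))\<^sup>2) \<partial>half_line) \<le> ennreal (\<epsilon>\<^sup>2)"
        using eventually_ge_at_top[of m]
      proof eventually_elim
        case (elim k)
        then have "l2_norm (\<lambda>x. s m x - s (r k) x) \<le> \<epsilon>"
          using r_ge[of k] by (intro m) auto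
        then have "(LINT x|half_line. (cmod (s m x - s (r k) x))\<^sup>2) \<le> \<epsilon>\<^sup>2"
          unfolding l2_norm_power2[symmetric] by (intro power_mono) auto
        then show ?case
          by (subst nn_integral_eq_integral) (auto intro!: L2D L2_diff s ennreal_leI)
      qed
    qed simp
    finally show ?thesis .
  qed
  have diff_L2: "(\<lambda>x. s m x - f x) \<in> L2" and diff_le: "l2_norm (\<lambda>x. s m x - f x) \<le> \<epsilon>"
    if m: "\<And>n. n \<ge> m \<Longrightarrow> l2_norm (\<lambda>x. s m x - s n x) \<le> \<epsilon>" and "\<epsilon> > 0" for m \<epsilon>
  proof -
    note b = bound[OF m]
    have "integrable half_line (\<lambda>x. (cmod (s m x - f x))\<^sup>2)"
    proof (rule integrableI_bounded)
      show "(\<integral>\<^sup>+x. ennreal (norm ((cmod (s m x - f x))\<^sup>2)) \<partial>half_line) < \<infinity>"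
        using b by (simp add: le_less_trans[OF _ ennreal_less_top])
    qed measurable
    then show *: "(\<lambda>x. s m x - f x) \<in> L2" by (simp add: L2_def)
    have "(l2_norm (\<lambda>x. s m x - f x))\<^sup>2 \<le> \<epsilon>\<^sup>2"
      using b nn_integral_eq_integral[OF L2D(2)[OF *]] by (simp add: l2_norm_power2)
    then show "l2_norm (\<lambda>x. s m x - f x) \<le> \<epsilon>"
      by (rule power2_le_imp_le) (use \<open>\<epsilon> > 0\<close> in simp)
  qed
  have "(\<lambda>x. s (N 0) x - f x) \<in> L2"
    by (rule diff_L2[of _ 1]) (use N[of 0 "N 0"] in \<open>auto intro: less_imp_le\<close>)
  then have "(\<lambda>x. s (N 0) x - (s (N 0) x - f x)) \<in> L2" by (rule L2_diff[OF s])
  then have "f \<in> L2" by simp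
  moreover have "(\<lambda>n. l2_norm (\<lambda>x. s n x - f x)) \<longlonglongrightarrow> 0"
  proof (rule LIMSEQ_I)
    fix e :: real assume "e > 0"
    then obtain M where M: "\<forall>m\<ge>M. \<forall>n\<ge>M. l2_norm (\<lambda>x. s m x - s n x) < e / 2"
      using Cauchy[of "e/2"] by auto
    have "l2_norm (\<lambda>x. s m x - f x) \<le> e / 2" if "m \<ge> M" for m
      by (rule diff_le) (use M that \<open>e > 0\<close> in \<open>auto intro: less_imp_le\<close>)
    then show "\<exists>no. \<forall>n\<ge>no. norm (l2_norm (\<lambda>x. s n x - f x) - 0) < e"
      using \<open>e > 0\<close> by (intro exI[of _ M]) fastforce
  qed
  ultimately show ?thesis by blast
qed

subsection \<open>Orthonormal systems\<close>

definition orthonormal :: "(nat \<Rightarrow> real \<Rightarrow> complex) \<Rightarrow> bool" where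
  "orthonormal e \<longleftrightarrow> (\<forall>n. e n \<in> L2) \<and> (\<forall>m n. l2_inner (e m) (e n) = (if m = n then 1 else 0))"

lemma orthonormal_basis_orthonormal: "orthonormal_basis e \<Longrightarrow> orthonormal e"
  by (simp add: orthonormal_basis_def orthonormal_def)

context
  fixes e assumes e: "orthonormal e"
begin

lemma orthonormal_L2: "e n \<in> L2"
  using e by (simp add: orthonormal_def)

lemma orthonormal_inner: "l2_inner (e m) (e n) = (if m = n then 1 else 0)"
  using e by (simp add: orthonormal_def)

lemma orthonormal_combination_L2: "(\<lambda>x. \<Sum>i\<in>I. c i * e i x) \<in> L2"
  by (intro L2_sum L2_scale orthonormal_L2)

lemma orthonormal_inner_combination:
  assumes "finite I"
  shows "l2_inner (\<lambda>x. \<Sum>i\<in>I. c i * e i x) (e n) = (if n \<in> I then c n else 0)"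
  using assms by (subst l2_inner_sum_left)
    (auto intro!: L2_scale orthonormal_L2 simp: l2_inner_scale_left orthonormal_inner
      if_distrib[of "\<lambda>x. _ * x"] cong: if_cong)

lemma orthonormal_pythagoras:
  assumes "finite I"
  shows "(l2_norm (\<lambda>x. \<Sum>i\<in>I. c i * e i x))\<^sup>2 = (\<Sum>i\<in>I. (cmod (c i))\<^sup>2)"
proof -
  let ?S = "\<lambda>x. \<Sum>i\<in>I. c i * e i x"
  have "of_real ((l2_norm ?S)\<^sup>2) = l2_inner ?S ?S"
    by (rule l2_inner_self[symmetric])
  also have "\<dots> = (\<Sum>i\<in>I. cnj (c i) * l2_inner ?S (e i))"
    by (rule l2_inner_sum_right) (auto intro: orthonormal_L2 orthonormal_combination_L2)
  also have "\<dots> = (\<Sum>i\<in>I. of_real ((cmod (c i))\<^sup>2))"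
    using assms by (intro sum.cong) (simp_all add: orthonormal_inner_combination complex_norm_square mult.commute del: of_real_power)
  finally have "complex_of_real ((l2_norm ?S)\<^sup>2) = of_real (\<Sum>i\<in>I. (cmod (c i))\<^sup>2)"
    by (simp only: of_real_sum)
  then show ?thesis by (simp only: of_real_eq_iff)
qed

lemma orthonormal_projection_norm:
  assumes "u \<in> L2" "finite I"
  shows "(l2_norm (\<lambda>x. u x - (\<Sum>i\<in>I. l2_inner u (e i) * e i x)))\<^sup>2 =
    (l2_norm u)\<^sup>2 - (\<Sum>i\<in>I. (cmod (l2_inner u (e i)))\<^sup>2)"
proof -
  let ?c = "\<lambda>i. l2_inner u (e i)"
  let ?S = "\<lambda>x. \<Sum>i\<in>I. ?c i * e i x"
  have S: "?S \<in> L2" by (rule orthonormal_combination_L2)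
  have uS: "(\<lambda>x. u x - ?S x) \<in> L2" by (intro L2_diff assms S)
  have "l2_inner (\<lambda>x. u x - ?S x) ?S = (\<Sum>i\<in>I. cnj (?c i) * l2_inner (\<lambda>x. u x - ?S x) (e i))"
    by (rule l2_inner_sum_right) (auto intro: orthonormal_L2 uS)
  also have "\<dots> = 0"
    using assms
    by (intro sum.neutral ballI) (simp add: l2_inner_diff_left orthonormal_L2 S orthonormal_inner_combination)
  finally have 1: "l2_inner (\<lambda>x. u x - ?S x) ?S = 0" .
  have "of_real ((l2_norm (\<lambda>x. u x - ?S x))\<^sup>2) = l2_inner (\<lambda>x. u x - ?S x) (\<lambda>x. u x - ?S x)"
    by (rule l2_inner_self[symmetric])
  also have "\<dots> = l2_inner (\<lambda>x. u x - ?S x) u"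
    using l2_inner_diff_right[OF assms(1) S uS] 1 by simp
  also have "\<dots> = l2_inner u u - l2_inner ?S u"
    by (intro l2_inner_diff_left assms S)
  also have "l2_inner ?S u = cnj (l2_inner u ?S)"
    by (simp add: l2_inner_cnj)
  also have "l2_inner u ?S = (\<Sum>i\<in>I. cnj (?c i) * ?c i)"
    by (rule l2_inner_sum_right) (auto intro: orthonormal_L2 assms)
  also have "cnj \<dots> = of_real (\<Sum>i\<in>I. (cmod (?c i))\<^sup>2)"
    by (simp add: complex_norm_square mult.commute del: of_real_power)
  finally have "complex_of_real ((l2_norm (\<lambda>x. u x - ?S x))\<^sup>2) =
      of_real ((l2_norm u)\<^sup>2 - (\<Sum>i\<in>I. (cmod (?c i))\<^sup>2))"
    by (simp only: l2_inner_self of_real_diff)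
  then show ?thesis by (simp only: of_real_eq_iff)
qed

lemma Bessel:
  assumes "u \<in> L2" "finite I"
  shows "(\<Sum>i\<in>I. (cmod (l2_inner u (e i)))\<^sup>2) \<le> (l2_norm u)\<^sup>2"
  using orthonormal_projection_norm[OF assms]
    zero_le_power2[of "l2_norm (\<lambda>x. u x - (\<Sum>i\<in>I. l2_inner u (e i) * e i x))"]
  by linarith

text \<open>Cauchy-Schwarz for sums combined with \<open>Bessel\<close>. The bound is uniform over
  finite index sets, as unordered absolute summability requires; it later controls the row sums in
  \<open>cycle_sum\<close>.\<close>

lemma Bessel_mult:
  assumes "u \<in> L2" "v \<in> L2" "finite I"
  shows "(\<Sum>i\<in>I. cmod (l2_inner u (e i)) * cmod (l2_inner v (e i))) \<le> l2_norm u * l2_norm v"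
proof (rule power2_le_imp_le[of _ "l2_norm u * l2_norm v"])
  have "(\<Sum>i\<in>I. cmod (l2_inner u (e i)) * cmod (l2_inner v (e i)))\<^sup>2 \<le>
      (\<Sum>i\<in>I. (cmod (l2_inner u (e i)))\<^sup>2) * (\<Sum>i\<in>I. (cmod (l2_inner v (e i)))\<^sup>2)"
    by (rule Cauchy_Schwarz_ineq_sum)
  also have "\<dots> \<le> (l2_norm u)\<^sup>2 * (l2_norm v)\<^sup>2"
    using assms by (intro mult_mono Bessel sum_nonneg) auto
  finally show "(\<Sum>i\<in>I. cmod (l2_inner u (e i)) * cmod (l2_inner v (e i)))\<^sup>2 \<le> (l2_norm u * l2_norm v)\<^sup>2"
    by (simp add: power_mult_distrib)
qed simp

lemma Bessel_mult_summable:
  assumes "u \<in> L2" "v \<in> L2"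
  shows "(\<lambda>i. cmod (l2_inner u (e i)) * cmod (l2_inner v (e i))) summable_on A"
  using Bessel_mult[OF assms]
  by (intro nonneg_bdd_above_summable_on bdd_aboveI2[where M="l2_norm u * l2_norm v"]) auto

end

text \<open>By Pythagoras the partial sums are Cauchy, so they converge to some f. Inner products
  are continuous, hence f has the same coefficients as u; the difference u - f is orthogonal to
  every basis vector and vanishes almost everywhere by completeness of the basis.\<close>

lemma orthonormal_basis_expansion:
  assumes e: "orthonormal_basis e" and u: "u \<in> L2"
  shows "(\<lambda>N. l2_norm (\<lambda>x. u x - (\<Sum>n<N. l2_inner u (e n) * e n x))) \<longlonglongrightarrow> 0"
proof -
  note on = orthonormal_basis_orthonormal[OF e]
  let ?c = "\<lambda>n. l2_inner u (e n)"
  define S where "S N x = (\<Sum>n<N. ?c n * e n x)" for N x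
  have S: "S N \<in> L2" for N unfolding S_def by (rule orthonormal_combination_L2[OF on])
  have sm: "summable (\<lambda>n. (cmod (?c n))\<^sup>2)"
    using Bessel[OF on u] by (intro summableI_nonneg_bounded) auto
  have norm_diff: "(l2_norm (\<lambda>x. S m x - S n x))\<^sup>2 = (\<Sum>i\<in>{n..<m}. (cmod (?c i))\<^sup>2)" if "n \<le> m" for m n
  proof -
    have "S m x - S n x = (\<Sum>i\<in>{n..<m}. ?c i * e i x)" for x
      using that unfolding S_def by (simp add: lessThan_atLeast0 sum_diff_nat_ivl)
    then show ?thesis by (simp add: orthonormal_pythagoras[OF on])
  qed
  have "\<exists>f\<in>L2. (\<lambda>n. l2_norm (\<lambda>x. S n x - f x)) \<longlonglongrightarrow> 0"
  proof (rule L2_complete[OF S])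
    fix \<epsilon> :: real assume "\<epsilon> > 0"
    then have "\<epsilon>\<^sup>2 > 0" by simp
    then obtain N where N: "\<And>m n. m \<ge> N \<Longrightarrow> norm (\<Sum>i\<in>{m..<n}. (cmod (?c i))\<^sup>2) < \<epsilon>\<^sup>2"
      using sm unfolding summable_Cauchy by blast
    have *: "l2_norm (\<lambda>x. S m x - S n x) < \<epsilon>" if "n \<ge> N" "n \<le> m" for m n
      using N[OF that(1), of m] norm_diff[OF that(2)] \<open>\<epsilon> > 0\<close> by (intro power2_less_imp_less[of _ \<epsilon>]) simp_all
    show "\<exists>N. \<forall>m\<ge>N. \<forall>n\<ge>N. l2_norm (\<lambda>x. S m x - S n x) < \<epsilon>"
      using * l2_norm_minus_commute[of "S _" "S _"] by (metis nle_le)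
  qed
  then obtain f where f: "f \<in> L2" "(\<lambda>n. l2_norm (\<lambda>x. S n x - f x)) \<longlonglongrightarrow> 0" by blast
  have "l2_inner (\<lambda>x. u x - f x) (e n) = 0" for n
  proof -
    have "(\<lambda>N. l2_inner (\<lambda>x. S N x - f x) (e n)) \<longlonglongrightarrow> 0"
      by (rule Lim_null_comparison[OF _ tendsto_mult_left_zero[OF f(2), of "l2_norm (e n)"]])
        (intro always_eventually allI l2_inner_abs_le L2_diff S f orthonormal_L2[OF on])
    moreover have "\<forall>\<^sub>F N in sequentially. l2_inner (\<lambda>x. S N x - f x) (e n) = l2_inner (\<lambda>x. u x - f x) (e n)"
      using eventually_gt_at_top[of n]
    proof eventually_elim
      case (elim N)
      have "l2_inner (S N) (e n) = ?c n"
        unfolding S_def using elim by (subst orthonormal_inner_combination[OF on]) auto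
      then show ?case
        by (simp add: l2_inner_diff_left S f u orthonormal_L2[OF on])
    qed
    ultimately have "(\<lambda>N. l2_inner (\<lambda>x. u x - f x) (e n)) \<longlonglongrightarrow> 0"
      by (rule Lim_transform_eventually)
    then show ?thesis by (simp add: LIMSEQ_const_iff)
  qed
  then have AE: "AE x in half_line. u x - f x = 0"
    using e L2_diff[OF u f(1)] unfolding orthonormal_basis_def by blast
  have "l2_norm (\<lambda>x. u x - S N x) = l2_norm (\<lambda>x. S N x - f x)" for N
    unfolding l2_norm_minus_commute[of u "S N"]
    using AE by (intro l2_norm_cong_AE L2D(1)[OF L2_diff] S u f) auto
  then show ?thesis using f(2) by (simp add: S_def)
qed

lemma Parseval_sums:
  assumes e: "orthonormal_basis e" and u: "u \<in> L2" and v: "v \<in> L2"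
  shows "(\<lambda>n. l2_inner u (e n) * l2_inner (e n) v) sums l2_inner u v"
proof -
  note on = orthonormal_basis_orthonormal[OF e]
  let ?S = "\<lambda>N x. \<Sum>n<N. l2_inner u (e n) * e n x"
  have S: "?S N \<in> L2" for N by (rule orthonormal_combination_L2[OF on])
  have "(\<lambda>N. l2_inner (\<lambda>x. u x - ?S N x) v) \<longlonglongrightarrow> 0"
    by (rule Lim_null_comparison[OF _ tendsto_mult_left_zero[OF orthonormal_basis_expansion[OF e u], of "l2_norm v"]])
      (intro always_eventually allI l2_inner_abs_le L2_diff S u v)
  moreover have "l2_inner (\<lambda>x. u x - ?S N x) v = l2_inner u v - (\<Sum>n<N. l2_inner u (e n) * l2_inner (e n) v)" for N
    by (subst l2_inner_diff_left[OF u S v], subst l2_inner_sum_left)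
      (auto simp: l2_inner_scale_left v intro!: L2_scale orthonormal_L2[OF on])
  ultimately have "(\<lambda>N. l2_inner u v - (\<Sum>n<N. l2_inner u (e n) * l2_inner (e n) v)) \<longlonglongrightarrow> 0"
    by simp
  from tendsto_diff[OF tendsto_const[of "l2_inner u v"] this] show ?thesis
    by (simp add: sums_def)
qed

text \<open>The traces are unordered sums over index sets, so Parseval is wanted in the form
  \<open>has_sum\<close>. Absolute summability provides an unordered sum, and
  \<open>Parseval_sums\<close> identifies its value.\<close>

lemma Parseval_has_sum:
  assumes e: "orthonormal_basis e" and u: "u \<in> L2" and v: "v \<in> L2"
  shows "((\<lambda>n. l2_inner u (e n) * l2_inner (e n) v) has_sum l2_inner u v) UNIV"
proof -
  have "cmod (l2_inner (e n) v) = cmod (l2_inner v (e n))" for n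
    by (metis l2_inner_cnj complex_mod_cnj)
  then have "(\<lambda>n. norm (l2_inner u (e n) * l2_inner (e n) v)) summable_on UNIV"
    using Bessel_mult_summable[OF orthonormal_basis_orthonormal[OF e] u v, of UNIV]
    by (simp add: norm_mult)
  then have "(\<lambda>n. l2_inner u (e n) * l2_inner (e n) v) summable_on UNIV"
    by (rule abs_summable_summable)
  then have "((\<lambda>n. l2_inner u (e n) * l2_inner (e n) v) has_sum
      (\<Sum>\<^sub>\<infinity>n. l2_inner u (e n) * l2_inner (e n) v)) UNIV"
    by (rule has_sum_infsum)
  moreover from has_sum_imp_sums[OF this] Parseval_sums[OF assms]
  have "(\<Sum>\<^sub>\<infinity>n. l2_inner u (e n) * l2_inner (e n) v) = l2_inner u v"
    by (rule sums_unique2)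
  ultimately show ?thesis by simp
qed

section \<open>Calculus of indefinite Lebesgue integrals\<close>

lemma sigma_finite_lebesgue_on:
  assumes "S \<in> sets (lebesgue :: real measure)"
  shows "sigma_finite_measure (lebesgue_on S)"
proof (rule sigma_finite_measure_restrict_space[OF _ assms])
  obtain A :: "real set set" where A: "countable A" "A \<subseteq> sets lborel" "\<Union>A = space lborel"
      "\<forall>a\<in>A. emeasure lborel a \<noteq> \<infinity>"
    using lborel.sigma_finite_countable[where 'a=real] by (elim exE conjE)
  show "sigma_finite_measure (lebesgue :: real measure)"
  proof
    show "\<exists>A. countable A \<and> A \<subseteq> sets (lebesgue :: real measure) \<and> \<Union>A = space lebesgue \<and>
        (\<forall>a\<in>A. emeasure lebesgue a \<noteq> \<infinity>)"
    proof (intro exI[of _ A] conjI ballI)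
      fix a assume "a \<in> A"
      then have "a \<in> sets lborel" "emeasure lborel a \<noteq> \<infinity>"
        using A(2,4) by auto
      then show "emeasure lebesgue a \<noteq> \<infinity>" by simp
    next
      show "A \<subseteq> sets lebesgue" using A(2) by auto
    qed (use A in simp_all)
  qed
qed

lemma borel_measurable_ident_lebesgue_on [measurable]:
  "(\<lambda>x. x) \<in> borel_measurable (lebesgue_on (S :: real set))"
proof -
  have "(\<lambda>x::real. x) \<in> borel_measurable lborel" by simp
  then show ?thesis
    by (intro measurable_restrict_space1 measurable_completion)
qed

lemma AE_lebesgue_on_neq:
  assumes "S \<in> sets lebesgue"
  shows "AE x in lebesgue_on S. x \<noteq> (a::real)"
proof -
  have "AE x in lebesgue. x \<noteq> a"
    by (rule AE_I'[of "{a}"]) auto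
  then show ?thesis
    using assms by (simp add: AE_restrict_space_iff) (auto elim: eventually_mono)
qed

lemma integrable_lebesgue_on_subset:
  fixes f :: "real \<Rightarrow> 'b::{banach, second_countable_topology}"
  assumes "integrable (lebesgue_on S) f" "T \<subseteq> S" "S \<in> sets lebesgue" "T \<in> sets lebesgue"
  shows "integrable (lebesgue_on T) f"
proof -
  have "set_integrable lebesgue S f"
    using assms by (simp add: set_integrable_def integrable_restrict_space)
  then have "set_integrable lebesgue T f"
    by (rule set_integrable_subset) (use assms in auto)
  then show ?thesis
    using assms by (simp add: set_integrable_def integrable_restrict_space)
qed

lemma integrable_if:
  fixes f :: "'a \<Rightarrow> 'b::{banach, second_countable_topology}"
  assumes "integrable M f" "{x \<in> space M. P x} \<in> sets M"
  shows "integrable M (\<lambda>x. if P x then f x else 0)"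
proof (rule Bochner_Integration.integrable_bound[OF assms(1)])
  show "(\<lambda>x. if P x then f x else 0) \<in> borel_measurable M"
    using assms by (intro measurable_If) auto
qed auto

text \<open>Weak derivatives and the Jost equation integrate over [0,x], whereas \<open>L2\<close>
  lives on the open half-line. The two kinds of integral differ by the null set {0}.\<close>

lemma
  fixes f :: "real \<Rightarrow> 'b::euclidean_space"
  assumes f: "integrable half_line f" and x: "x \<ge> 0"
  shows integrable_half_line_imp_Icc: "integrable (lebesgue_on {0..x}) f"
    and integral_Icc_eq_half_line:
      "(LINT t|lebesgue_on {0..x}. f t) = (LINT t|half_line. (if t \<le> x then f t else 0))"
proof -
  let ?g = "\<lambda>t. if t \<in> {0<..x} then f t else 0"
  let ?h = "\<lambda>t. if t \<in> {0..x} then f t else 0"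
  have g: "integrable lebesgue ?g"
    by (rule iffD2[OF Lebesgue_Measure.integrable_restrict_UNIV integrable_lebesgue_on_subset[OF f]]) auto
  have ae: "AE t in lebesgue. ?g t = ?h t"
    by (rule AE_I'[of "{0}"]) auto
  have h: "?h \<in> borel_measurable lebesgue"
    by (rule borel_measurable_AE[OF borel_measurable_integrable[OF g] ae])
  have hi: "integrable lebesgue ?h"
    by (rule integrable_cong_AE_imp[OF g h]) (use ae in \<open>auto elim!: eventually_mono\<close>)
  then show "integrable (lebesgue_on {0..x}) f"
    by (rule iffD1[OF Lebesgue_Measure.integrable_restrict_UNIV, rotated]) auto
  have "(LINT t|lebesgue_on {0..x}. f t) = (LINT t|lebesgue. ?h t)"
    by (subst Lebesgue_Measure.integral_restrict_UNIV) auto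
  also have "\<dots> = (LINT t|lebesgue. ?g t)"
    by (rule integral_cong_AE) (use g h ae in \<open>auto elim!: eventually_mono\<close>)
  also have "\<dots> = (LINT t|lebesgue_on {0<..x}. f t)"
    by (subst Lebesgue_Measure.integral_restrict_UNIV) auto
  also have "\<dots> = (LINT t|half_line. (if t \<in> {0<..x} then f t else 0))"
    by (subst Lebesgue_Measure.integral_restrict) auto
  also have "\<dots> = (LINT t|half_line. (if t \<le> x then f t else 0))"
    by (rule Bochner_Integration.integral_cong) auto
  finally show "(LINT t|lebesgue_on {0..x}. f t) = (LINT t|half_line. (if t \<le> x then f t else 0))" .
qed

text \<open>Fubini on S x S, the square being cut along its diagonal. Read with \<open>f\<close> and
  \<open>g\<close> as densities of two absolutely continuous functions, this is integration by
  parts. \<open>strict\<close> exchanges < for \<le> in the inner integral at the cost of a null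
  set.\<close>

lemma integral_product_split_diagonal:
  fixes f g :: "real \<Rightarrow> complex" and S :: "real set"
  defines "M \<equiv> lebesgue_on S"
  assumes S: "S \<in> sets lebesgue" and f: "integrable M f" and g: "integrable M g"
  shows "integrable M (\<lambda>t. f t * (LINT s|M. (if s \<le> t then g s else 0)))" (is ?A)
    and "integrable M (\<lambda>t. (LINT s|M. (if s \<le> t then f s else 0)) * g t)" (is ?B)
    and "(LINT t|M. f t) * (LINT t|M. g t) =
      (LINT t|M. f t * (LINT s|M. (if s \<le> t then g s else 0))) +
      (LINT t|M. (LINT s|M. (if s \<le> t then f s else 0)) * g t)" (is ?C)
proof -
  interpret M: sigma_finite_measure M unfolding M_def by (rule sigma_finite_lebesgue_on[OF S])
  interpret P: pair_sigma_finite M M ..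
  have [measurable]: "f \<in> borel_measurable M" "g \<in> borel_measurable M" using f g by auto
  have [measurable]: "(\<lambda>x. x) \<in> borel_measurable M" unfolding M_def by measurable
  let ?h = "\<lambda>(s, t). f s * g t"
  let ?h1 = "\<lambda>(s, t). if t \<le> s then f s * g t else 0"
  let ?h2 = "\<lambda>(s, t). if s < t then f s * g t else 0"
  have h: "integrable (M \<Otimes>\<^sub>M M) ?h"
  proof (rule P.Fubini_integrable)
    show "integrable M (\<lambda>x. LINT y|M. norm (?h (x, y)))"
      using f g by (simp add: norm_mult)
    show "AE x in M. integrable M (\<lambda>y. ?h (x, y))"
      using g by simp
  qed measurable
  have h1: "integrable (M \<Otimes>\<^sub>M M) ?h1" and h2: "integrable (M \<Otimes>\<^sub>M M) ?h2"
    by (rule Bochner_Integration.integrable_bound[OF h], measurable, auto)+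
  have if_eq: "(LINT y|M. (if P y then c * g y else 0)) = c * (LINT y|M. (if P y then g y else 0))"
    "(LINT y|M. (if P y then f y * c else 0)) = (LINT y|M. (if P y then f y else 0)) * c" for c P
    by (simp_all flip: Bochner_Integration.integral_mult_right_zero Bochner_Integration.integral_mult_left_zero
        add: if_distrib if_distribR cong: if_cong)
  have strict: "(LINT s|M. (if s < t then f s else 0)) = (LINT s|M. (if s \<le> t then f s else 0))" for t
  proof (rule integral_cong_AE)
    show "AE s in M. (if s < t then f s else 0) = (if s \<le> t then f s else 0)"
      using AE_lebesgue_on_neq[OF S, of t] unfolding M_def[symmetric] by eventually_elim auto
  qed measurable
  have 1: "(LINT p|(M \<Otimes>\<^sub>M M). ?h1 p) = (LINT t|M. f t * (LINT s|M. (if s \<le> t then g s else 0)))"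
    using P.integral_fst'[OF h1] by (simp add: if_eq)
  show ?A using P.integrable_fst'[OF h1] by (simp add: if_eq)
  have 2: "(LINT p|(M \<Otimes>\<^sub>M M). ?h2 p) = (LINT t|M. (LINT s|M. (if s \<le> t then f s else 0)) * g t)"
    using P.integral_snd[of "\<lambda>s t. if s < t then f s * g t else 0"] h2 by (simp add: if_eq strict)
  show ?B using P.integrable_snd[of "\<lambda>s t. if s < t then f s * g t else 0"] h2
    by (simp add: if_eq strict)
  have "(LINT t|M. f t) * (LINT t|M. g t) = (LINT p|(M \<Otimes>\<^sub>M M). ?h p)"
    using P.integral_fst'[OF h] by simp
  also have "\<dots> = (LINT p|(M \<Otimes>\<^sub>M M). ?h1 p + ?h2 p)"
    by (rule Bochner_Integration.integral_cong) auto
  also have "\<dots> = (LINT p|(M \<Otimes>\<^sub>M M). ?h1 p) + (LINT p|(M \<Otimes>\<^sub>M M). ?h2 p)"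
    by (rule Bochner_Integration.integral_add[OF h1 h2])
  finally show ?C unfolding 1 2 .
qed

text \<open>Local absolute continuity of \<open>F\<close> on \<open>[0,\<infinity>)\<close>, with derivative \<open>f\<close>.\<close>

definition ac_deriv :: "(real \<Rightarrow> complex) \<Rightarrow> (real \<Rightarrow> complex) \<Rightarrow> bool" where
  "ac_deriv F f \<longleftrightarrow> (\<forall>x\<ge>0. integrable (lebesgue_on {0..x}) f \<and>
     F x = F 0 + (LINT t|lebesgue_on {0..x}. f t))"

lemma ac_derivD:
  assumes "ac_deriv F f" "x \<ge> 0"
  shows "integrable (lebesgue_on {0..x}) f" "F x = F 0 + (LINT t|lebesgue_on {0..x}. f t)"
  using assms unfolding ac_deriv_def by blast+

lemma ac_deriv_cong:
  assumes "ac_deriv F f" "\<And>x. x \<ge> 0 \<Longrightarrow> F x = G x" "\<And>x. x \<ge> 0 \<Longrightarrow> f x = g x"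
  shows "ac_deriv G g"
  unfolding ac_deriv_def
proof (intro allI impI)
  fix x :: real assume x: "x \<ge> 0"
  have "integrable (lebesgue_on {0..x}) f \<longleftrightarrow> integrable (lebesgue_on {0..x}) g"
    using assms(3) by (intro Bochner_Integration.integrable_cong) auto
  moreover have "(LINT t|lebesgue_on {0..x}. f t) = (LINT t|lebesgue_on {0..x}. g t)"
    using assms(3) by (intro Bochner_Integration.integral_cong) auto
  ultimately show "integrable (lebesgue_on {0..x}) g \<and> G x = G 0 + (LINT t|lebesgue_on {0..x}. g t)"
    using ac_derivD[OF assms(1) x] assms(2)[of 0] assms(2)[OF x] by auto
qed

lemma ac_deriv_add:
  assumes "ac_deriv F f" "ac_deriv G g"
  shows "ac_deriv (\<lambda>x. F x + G x) (\<lambda>x. f x + g x)"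
  unfolding ac_deriv_def
proof (intro allI impI)
  fix x :: real assume x: "x \<ge> 0"
  note F = ac_derivD[OF assms(1) x] and G = ac_derivD[OF assms(2) x]
  show "integrable (lebesgue_on {0..x}) (\<lambda>x. f x + g x) \<and>
    F x + G x = F 0 + G 0 + (LINT t|lebesgue_on {0..x}. f t + g t)"
    using F(1) G(1) by (simp add: F(2) G(2))
qed

lemma ac_deriv_scale: "ac_deriv F f \<Longrightarrow> ac_deriv (\<lambda>x. c * F x) (\<lambda>x. c * f x)"
  unfolding ac_deriv_def by (metis integrable_mult_right integral_mult_right_zero distrib_left)

lemma ac_deriv_cnj:
  assumes "ac_deriv F f"
  shows "ac_deriv (\<lambda>x. cnj (F x)) (\<lambda>x. cnj (f x))"
  unfolding ac_deriv_def
proof (intro allI impI)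
  fix x :: real assume x: "x \<ge> 0"
  note F = ac_derivD[OF assms x]
  show "integrable (lebesgue_on {0..x}) (\<lambda>x. cnj (f x)) \<and>
      cnj (F x) = cnj (F 0) + (LINT t|lebesgue_on {0..x}. cnj (f t))"
    using F(1) arg_cong[OF F(2), of cnj] by simp
qed

lemma ac_deriv_continuous_on:
  assumes "ac_deriv F f"
  shows "continuous_on {0..} F"
proof -
  have "continuous_on {0..x} F" for x
  proof (cases "x \<ge> 0")
    case True
    have "continuous_on {0..x} (\<lambda>y. F 0 + (LINT t|lebesgue_on {0..y}. f t))"
      by (intro continuous_on_add continuous_on_const indefinite_integral_continuous_real ac_derivD(1)[OF assms True])
    then show ?thesis
      by (rule continuous_on_eq) (rule ac_derivD(2)[OF assms, symmetric], simp)
  qed auto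
  note * = this
  show ?thesis
    unfolding continuous_on_eq_continuous_within
  proof
    fix x :: real assume "x \<in> {0..}"
    then have "continuous (at x within {0..x+1}) F"
      using *[of "x+1"] by (auto simp: continuous_on_eq_continuous_within)
    moreover have "at x within {0..} = at x within {0..x+1}"
      by (rule at_within_nhd[of _ "{..<x+1}"]) auto
    ultimately show "continuous (at x within {0..}) F" by simp
  qed
qed

text \<open>Both factors are written as initial value plus integral and multiplied out; the product
  of the two integrals is split by \<open>integral_product_split_diagonal\<close>. The argument
  stays with integrals throughout.\<close>

lemma ac_deriv_mult:
  assumes F: "ac_deriv F f" and G: "ac_deriv G g"
  shows "ac_deriv (\<lambda>x. F x * G x) (\<lambda>x. f x * G x + F x * g x)"
  unfolding ac_deriv_def
proof (intro allI impI)
  fix x :: real assume x: "x \<ge> 0"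
  define M where "M = lebesgue_on {0..x}"
  have f: "integrable M f" and g: "integrable M g"
    unfolding M_def using ac_derivD(1)[OF F x] ac_derivD(1)[OF G x] by auto
  note tri = integral_product_split_diagonal[of "{0..x}" f g, folded M_def, OF _ f g, simplified]
  have Ft: "F t = F 0 + (LINT s|M. (if s \<le> t then f s else 0))"
    and Gt: "G t = G 0 + (LINT s|M. (if s \<le> t then g s else 0))" if "t \<in> {0..x}" for t
  proof -
    have "(LINT s|M. (if s \<le> t then k s else 0)) = (LINT s|lebesgue_on {0..t}. k s)" for k :: "real \<Rightarrow> complex"
    proof -
      have "(LINT s|M. (if s \<le> t then k s else 0)) = (LINT s|M. (if s \<in> {0..t} then k s else 0))"
        unfolding M_def by (rule Bochner_Integration.integral_cong) auto
      also have "\<dots> = (LINT s|lebesgue_on {0..t}. k s)"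
        unfolding M_def by (rule Lebesgue_Measure.integral_restrict) (use that in auto)
      finally show ?thesis .
    qed
    then show "F t = F 0 + (LINT s|M. (if s \<le> t then f s else 0))"
      "G t = G 0 + (LINT s|M. (if s \<le> t then g s else 0))"
      using ac_derivD(2)[OF F, of t] ac_derivD(2)[OF G, of t] that by auto
  qed
  let ?D = "\<lambda>t. (G 0 * f t + f t * (LINT s|M. (if s \<le> t then g s else 0))) +
    (F 0 * g t + (LINT s|M. (if s \<le> t then f s else 0)) * g t)"
  have eq: "f t * G t + F t * g t = ?D t" if "t \<in> space M" for t
    using that Ft[of t] Gt[of t] by (simp add: M_def algebra_simps)
  have "integrable M (\<lambda>t. f t * G t + F t * g t) \<longleftrightarrow> integrable M ?D"
    by (intro Bochner_Integration.integrable_cong) (auto simp: eq)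
  moreover have "integrable M ?D"
    using f g tri(1,2) by (intro Bochner_Integration.integrable_add integrable_mult_right) auto
  moreover have "(LINT t|M. f t * G t + F t * g t) = (LINT t|M. ?D t)"
    by (intro Bochner_Integration.integral_cong) (auto simp: eq)
  moreover have "(LINT t|M. ?D t) = G 0 * (LINT t|M. f t) + F 0 * (LINT t|M. g t) +
      (LINT t|M. f t) * (LINT t|M. g t)"
    using f g tri by simp
  moreover have "F x = F 0 + (LINT t|M. f t)" "G x = G 0 + (LINT t|M. g t)"
    unfolding M_def using ac_derivD(2)[OF F x] ac_derivD(2)[OF G x] by auto
  ultimately show "integrable (lebesgue_on {0..x}) (\<lambda>t. f t * G t + F t * g t) \<and>
      F x * G x = F 0 * G 0 + (LINT t|lebesgue_on {0..x}. f t * G t + F t * g t)"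
    unfolding M_def[symmetric] by (simp add: algebra_simps)
qed

lemma ac_deriv_C1:
  assumes "\<And>x. x \<ge> 0 \<Longrightarrow> (F has_vector_derivative f x) (at x within {0..})" "continuous_on {0..} f"
  shows "ac_deriv F f"
  unfolding ac_deriv_def
proof (intro allI impI)
  fix x :: real assume x: "x \<ge> 0"
  have i: "integrable (lebesgue_on {0..x}) f"
    by (rule continuous_imp_integrable_real[OF continuous_on_subset[OF assms(2)]]) auto
  have "(LINT t|lebesgue_on {0..x}. f t) = integral {0..x} f"
    by (rule lebesgue_integral_eq_integral[OF i]) auto
  also have "\<dots> = F x - F 0"
    by (rule integral_unique, rule fundamental_theorem_of_calculus[OF x],
        rule has_vector_derivative_within_subset[OF assms(1)]) auto
  finally show "integrable (lebesgue_on {0..x}) f \<and> F x = F 0 + (LINT t|lebesgue_on {0..x}. f t)"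
    using i by simp
qed

lemma ac_deriv_exp: "ac_deriv (\<lambda>x. exp (\<mu> * of_real x)) (\<lambda>x. \<mu> * exp (\<mu> * of_real x))"
proof (rule ac_deriv_C1)
  fix x :: real
  have "((\<lambda>z. exp (\<mu> * z)) has_field_derivative \<mu> * exp (\<mu> * of_real x)) (at (of_real x))"
    by (auto intro!: derivative_eq_intros)
  from has_vector_derivative_real_field[OF this]
  show "((\<lambda>x. exp (\<mu> * of_real x)) has_vector_derivative \<mu> * exp (\<mu> * of_real x)) (at x within {0..})"
    by (rule has_vector_derivative_at_within)
qed (intro continuous_intros)

lemma ac_deriv_const: "ac_deriv (\<lambda>x. c) (\<lambda>x. 0)"
  unfolding ac_deriv_def by auto

lemma ac_deriv_has_vector_derivative:
  assumes F: "ac_deriv F f" and f: "continuous_on {0..} f" and x: "x \<ge> 0"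
  shows "(F has_vector_derivative f x) (at x within {0..})"
proof -
  have "((\<lambda>u. integral {0..u} f) has_vector_derivative f x) (at x within {0..x+1})"
    by (rule integral_has_vector_derivative) (use f x in \<open>auto intro: continuous_on_subset\<close>)
  then have "((\<lambda>u. F 0 + integral {0..u} f) has_vector_derivative f x) (at x within {0..x+1})"
    by (auto intro!: derivative_eq_intros)
  then have d: "((\<lambda>u. F 0 + integral {0..u} f) has_vector_derivative f x) (at x within {0..x+1})" .
  have eq: "F u = F 0 + integral {0..u} f" if "u \<in> {0..x+1}" for u
  proof -
    have u: "u \<ge> 0" using that by simp
    show ?thesis
      using ac_derivD(2)[OF F u] lebesgue_integral_eq_integral[OF ac_derivD(1)[OF F u]] by simp
  qed
  have "(F has_vector_derivative f x) (at x within {0..x+1})"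
    by (rule has_vector_derivative_transform[OF _ eq d]) (use x in simp)
  moreover have "at x within {0..} = at x within {0..x+1}"
    by (rule at_within_nhd[of _ "{..<x+1}"]) auto
  ultimately show ?thesis by simp
qed

section \<open>Tail integrals and limits at infinity\<close>

definition tail_integral :: "(real \<Rightarrow> complex) \<Rightarrow> real \<Rightarrow> complex" where
  "tail_integral f x = (LINT t|half_line. (if x < t then f t else 0))"

lemma half_line_measurable_sets [measurable]:
  "Measurable.pred half_line (\<lambda>t. x < t)" "Measurable.pred half_line (\<lambda>t. t < x)"
  "Measurable.pred half_line (\<lambda>t. t \<le> x)"
  by measurable

lemma half_line_sets [simp, measurable]:
  "{t. 0 < t \<and> x < t} \<in> sets half_line" "{t. 0 < t \<and> t < x} \<in> sets half_line"
  "{t. 0 < t \<and> t \<le> x} \<in> sets half_line"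
  using half_line_measurable_sets[of x] by (simp_all add: pred_def)

lemma integral_half_line_split:
  fixes f :: "real \<Rightarrow> complex"
  assumes f: "integrable half_line f" and x: "x \<ge> 0"
  shows "(LINT t|lebesgue_on {0..x}. f t) = (LINT t|half_line. f t) - tail_integral f x"
proof -
  have "(LINT t|half_line. f t) =
      (LINT t|half_line. (if t \<le> x then f t else 0) + (if x < t then f t else 0))"
    by (rule Bochner_Integration.integral_cong) auto
  also have "\<dots> = (LINT t|half_line. (if t \<le> x then f t else 0)) + tail_integral f x"
    unfolding tail_integral_def
    by (intro Bochner_Integration.integral_add integrable_if f) measurable
  finally show ?thesis by (simp add: integral_Icc_eq_half_line[OF f x])
qed

lemma ac_deriv_tail_integral:
  assumes f: "integrable half_line f"
  shows "ac_deriv (tail_integral f) (\<lambda>t. - f t)"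
  unfolding ac_deriv_def
proof (intro allI impI)
  fix x :: real assume x: "x \<ge> 0"
  have "tail_integral f 0 = (LINT t|half_line. f t)"
    unfolding tail_integral_def by (rule Bochner_Integration.integral_cong) auto
  then show "integrable (lebesgue_on {0..x}) (\<lambda>t. - f t) \<and>
      tail_integral f x = tail_integral f 0 + (LINT t|lebesgue_on {0..x}. - f t)"
    using integrable_half_line_imp_Icc[OF f x] integral_half_line_split[OF f x] by simp
qed

lemma tail_integral_tendsto_0:
  assumes f: "integrable half_line f"
  shows "(tail_integral f \<longlongrightarrow> 0) at_top"
proof -
  have [measurable]: "f \<in> borel_measurable half_line" using f by (rule borel_measurable_integrable)
  have "((\<lambda>x. LINT t|half_line. (if x < t then f t else 0)) \<longlongrightarrow> (LINT t|half_line. 0)) at_top"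
  proof (rule integral_dominated_convergence_at_top[where w="\<lambda>t. norm (f t)"])
    show "AE t in half_line. ((\<lambda>x. if x < t then f t else 0) \<longlongrightarrow> 0) at_top"
    proof (rule AE_I2)
      fix t
      have "\<forall>\<^sub>F x in at_top. (if x < t then f t else 0) = 0"
        using eventually_ge_at_top[of t] by eventually_elim auto
      then show "((\<lambda>x. if x < t then f t else 0) \<longlongrightarrow> 0) at_top"
        by (rule tendsto_eventually)
    qed
  qed (use f in auto)
  then show ?thesis unfolding tail_integral_def by simp
qed

lemma integral_Icc_tendsto_half_line:
  fixes f :: "real \<Rightarrow> complex"
  assumes f: "integrable half_line f"
  shows "((\<lambda>x. LINT t|lebesgue_on {0..x}. f t) \<longlongrightarrow> (LINT t|half_line. f t)) at_top"
proof -
  have lim: "((\<lambda>x. (LINT t|half_line. f t) - tail_integral f x) \<longlongrightarrow> (LINT t|half_line. f t) - 0) at_top"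
    by (intro tendsto_intros tail_integral_tendsto_0 f)
  have ev: "\<forall>\<^sub>F x in at_top. (LINT t|half_line. f t) - tail_integral f x = (LINT t|lebesgue_on {0..x}. f t)"
    using eventually_ge_at_top[of 0] by eventually_elim (simp add: integral_half_line_split[OF f])
  from Lim_transform_eventually[OF lim ev] show ?thesis by simp
qed

text \<open>If L were nonzero, |h| would be at least |L|/2 on a whole ray, and its integral over
  intervals of length n would grow like n. This removes the boundary term at infinity in
  \<open>H0I\<close>.\<close>

lemma limit_of_integrable_eq_0:
  fixes h :: "real \<Rightarrow> complex"
  assumes h: "integrable half_line h" and L: "(h \<longlongrightarrow> L) at_top"
  shows "L = 0"
proof (rule ccontr)
  assume "L \<noteq> 0"
  then have "\<forall>\<^sub>F x in at_top. dist (h x) L < cmod L / 2"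
    using L by (intro tendstoD) auto
  then obtain X where X: "\<And>x. x \<ge> X \<Longrightarrow> dist (h x) L < cmod L / 2"
    by (auto simp: eventually_at_top_linorder)
  \<comment> \<open>The maximum with 1 keeps the ray inside the open half-line.\<close>
  define Y where "Y = max X 1"
  have big: "cmod L / 2 \<le> cmod (h x)" if "x \<ge> Y" for x
    using X[of x] that norm_triangle_ineq2[of L "h x"] by (auto simp: Y_def dist_norm norm_minus_commute)
  have "real n * (cmod L / 2) \<le> (LINT x|half_line. norm (h x))" for n
  proof -
    have "real n * (cmod L / 2) = (LINT x|lebesgue_on {Y..Y + real n}. cmod L / 2)"
      by (simp add: measure_restrict_space)
    also have "\<dots> = (LINT x|half_line. (if x \<in> {Y..Y + real n} then cmod L / 2 else 0))"
      by (rule Lebesgue_Measure.integral_restrict[symmetric]) (auto simp: Y_def)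
    also have "\<dots> \<le> (LINT x|half_line. norm (h x))"
    proof (rule integral_mono_AE')
      show "AE x in half_line. (if x \<in> {Y..Y + real n} then cmod L / 2 else 0) \<le> norm (h x)"
        using big by auto
    qed (use h in auto)
    finally show ?thesis .
  qed
  moreover obtain n where "(LINT x|half_line. norm (h x)) < real n * (cmod L / 2)"
    using reals_Archimedean3[of "cmod L / 2"] \<open>L \<noteq> 0\<close> by auto
  ultimately show False by (meson not_le)
qed

lemma ac_deriv_measurable:
  assumes "ac_deriv F f"
  shows "F \<in> borel_measurable half_line"
  by (rule continuous_imp_measurable_on_sets_lebesgue[OF continuous_on_subset[OF ac_deriv_continuous_on[OF assms]]]) auto

text \<open>Integration from infinity instead of from 0. In this way a limit condition at infinity
  becomes an integral equation; uniqueness of the Jost solution rests on it.\<close>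

lemma ac_deriv_eq_tail_integral:
  assumes F: "ac_deriv F f" and f: "integrable half_line f" and lim: "(F \<longlongrightarrow> L) at_top" and x: "x \<ge> 0"
  shows "F x = L - tail_integral f x"
proof -
  have "((\<lambda>X. F 0 + (LINT t|lebesgue_on {0..X}. f t)) \<longlongrightarrow> F 0 + (LINT t|half_line. f t)) at_top"
    by (intro tendsto_intros integral_Icc_tendsto_half_line f)
  moreover have "\<forall>\<^sub>F X in at_top. F 0 + (LINT t|lebesgue_on {0..X}. f t) = F X"
    using eventually_ge_at_top[of 0] by eventually_elim (rule ac_derivD(2)[OF F, symmetric])
  ultimately have "(F \<longlongrightarrow> F 0 + (LINT t|half_line. f t)) at_top"
    by (rule Lim_transform_eventually)
  then have "L = F 0 + (LINT t|half_line. f t)"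
    by (rule tendsto_unique[OF trivial_limit_at_top_linorder lim])
  then show ?thesis
    using ac_derivD(2)[OF F x] integral_half_line_split[OF f x] by (simp only:) simp
qed

section \<open>The Jost solution as a Volterra series\<close>

lemma norm_exp_le_1: "Re \<kappa> \<le> 0 \<Longrightarrow> t \<ge> 0 \<Longrightarrow> cmod (exp (\<kappa> * of_real t)) \<le> 1"
  by (simp add: mult_nonpos_nonneg)

text \<open>With \<open>\<kappa> = i\<zeta>\<close>, the kernel is \<open>e\<^bsup>i\<zeta>t\<^esup> sin(\<zeta>t)/\<zeta>\<close>; the iterates of \<open>1\<close> sum to \<open>\<theta>(x,\<zeta>) e\<^bsup>-i\<zeta>x\<^esup>\<close>.\<close>

definition volterra_kernel :: "complex \<Rightarrow> real \<Rightarrow> complex" where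
  "volterra_kernel \<kappa> t = (exp (2 * \<kappa> * of_real t) - 1) / (2 * \<kappa>)"

definition volterra :: "(real \<Rightarrow> real) \<Rightarrow> complex \<Rightarrow> (real \<Rightarrow> complex) \<Rightarrow> real \<Rightarrow> complex" where
  "volterra V \<kappa> f x =
     (LINT y|half_line. (if x < y then volterra_kernel \<kappa> (y - x) * of_real (V y) * f y else 0))"

definition jost_iterate :: "(real \<Rightarrow> real) \<Rightarrow> complex \<Rightarrow> nat \<Rightarrow> real \<Rightarrow> complex" where
  "jost_iterate V \<kappa> j = (volterra V \<kappa> ^^ j) (\<lambda>_. 1)"

locale jost_setting =
  fixes V :: "real \<Rightarrow> real" and \<kappa> :: complex
  assumes V: "integrable half_line V" and \<kappa>: "Re \<kappa> < 0"
begin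

lemma \<kappa>_nz: "\<kappa> \<noteq> 0" using \<kappa> by auto

lemma V_measurable [measurable]: "V \<in> borel_measurable half_line"
  using V by (rule borel_measurable_integrable)

lemma kernel_bound:
  assumes "t \<ge> 0"
  shows "cmod (volterra_kernel \<kappa> t) \<le> 1 / cmod \<kappa>"
proof -
  have "cmod (exp (2 * \<kappa> * of_real t) - 1) \<le> cmod (exp (2 * \<kappa> * of_real t)) + cmod 1"
    by (rule norm_triangle_ineq4)
  also have "\<dots> \<le> 2"
    using norm_exp_le_1[of "2 * \<kappa>" t] \<kappa> assms by simp
  finally show ?thesis
    by (simp add: volterra_kernel_def norm_divide norm_mult divide_simps)
qed

lemma kernel_measurable [measurable]: "(\<lambda>y. volterra_kernel \<kappa> (y - x)) \<in> borel_measurable half_line"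
  unfolding volterra_kernel_def by measurable

definition bdd_meas :: "(real \<Rightarrow> complex) \<Rightarrow> bool" where
  "bdd_meas f \<longleftrightarrow> f \<in> borel_measurable half_line \<and> (\<exists>B. \<forall>x>0. cmod (f x) \<le> B)"

lemma bdd_measI: "f \<in> borel_measurable half_line \<Longrightarrow> (\<And>x. x > 0 \<Longrightarrow> cmod (f x) \<le> B) \<Longrightarrow> bdd_meas f"
  unfolding bdd_meas_def by blast

lemma bdd_meas_integrable:
  assumes "bdd_meas f"
  shows "integrable half_line (\<lambda>t. of_real (V t) * f t)"
proof -
  obtain B where B: "\<And>x. x > 0 \<Longrightarrow> cmod (f x) \<le> B" and [measurable]: "f \<in> borel_measurable half_line"
    using assms unfolding bdd_meas_def by blast
  have B0: "B \<ge> 0" using B[of 1] norm_ge_zero[of "f 1"] by linarith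
  show ?thesis
  proof (rule Bochner_Integration.integrable_bound)
    show "integrable half_line (\<lambda>t. B * V t)" using V by simp
    show "AE t in half_line. norm (of_real (V t) * f t) \<le> norm (B * V t)"
      using B B0 by (intro AE_I2) (simp add: norm_mult abs_mult mult.commute[of B] mult_left_mono)
  qed measurable
qed

lemma exp_bdd_meas: "bdd_meas f \<Longrightarrow> bdd_meas (\<lambda>t. exp (2 * \<kappa> * of_real t) * f t)"
proof -
  assume "bdd_meas f"
  then obtain B where B: "\<And>x. x > 0 \<Longrightarrow> cmod (f x) \<le> B" and [measurable]: "f \<in> borel_measurable half_line"
    unfolding bdd_meas_def by blast
  show ?thesis
  proof (rule bdd_measI[of _ B])
    fix x :: real assume "x > 0"
    then have "cmod (exp (2 * \<kappa> * of_real x)) * cmod (f x) \<le> 1 * cmod (f x)"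
      using norm_exp_le_1[of "2 * \<kappa>" x] \<kappa> by (intro mult_right_mono) auto
    then show "cmod (exp (2 * \<kappa> * of_real x) * f x) \<le> B"
      using B[OF \<open>x > 0\<close>] by (simp add: norm_mult)
  qed measurable
qed

text \<open>The kernel is a difference of two products of a function of x and a function of y, so a
  Volterra integral is built from two tail integrals. Continuity here and the derivatives of the
  Jost solution later are read off from them.\<close>

lemma volterra_eq_tails:
  assumes f: "bdd_meas f"
  shows "volterra V \<kappa> f x =
    (exp (- (2 * \<kappa>) * of_real x) * tail_integral (\<lambda>t. of_real (V t) * (exp (2 * \<kappa> * of_real t) * f t)) x -
     tail_integral (\<lambda>t. of_real (V t) * f t) x) / (2 * \<kappa>)"
proof -
  let ?e = "exp (- (2 * \<kappa>) * of_real x)"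
  let ?R = "\<lambda>t. of_real (V t) * (exp (2 * \<kappa> * of_real t) * f t)" and ?P = "\<lambda>t. of_real (V t) * f t"
  have R: "integrable half_line (\<lambda>t. if x < t then ?R t else 0)"
    by (intro integrable_if bdd_meas_integrable exp_bdd_meas f) measurable
  have P: "integrable half_line (\<lambda>t. if x < t then ?P t else 0)"
    by (intro integrable_if bdd_meas_integrable f) measurable
  have "volterra V \<kappa> f x = (LINT t|half_line. (?e / (2 * \<kappa>)) * (if x < t then ?R t else 0) -
      (1 / (2 * \<kappa>)) * (if x < t then ?P t else 0))"
    unfolding volterra_def
  proof (rule Bochner_Integration.integral_cong[OF refl])
    fix t
    have "exp (2 * \<kappa> * of_real (t - x)) = ?e * exp (2 * \<kappa> * of_real t)"
      by (simp flip: exp_add add: algebra_simps)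
    then show "(if x < t then volterra_kernel \<kappa> (t - x) * of_real (V t) * f t else 0) =
        (?e / (2 * \<kappa>)) * (if x < t then ?R t else 0) - (1 / (2 * \<kappa>)) * (if x < t then ?P t else 0)"
      using \<kappa>_nz by (auto simp: volterra_kernel_def field_simps)
  qed
  also have "\<dots> = (?e / (2 * \<kappa>)) * tail_integral ?R x - (1 / (2 * \<kappa>)) * tail_integral ?P x"
    unfolding tail_integral_def using R P by simp
  finally show ?thesis by (simp add: diff_divide_distrib)
qed

lemma volterra_continuous:
  assumes f: "bdd_meas f"
  shows "continuous_on {0..} (volterra V \<kappa> f)"
proof -
  have "continuous_on {0..} (\<lambda>x. (exp (- (2 * \<kappa>) * of_real x) * tail_integral (\<lambda>t. of_real (V t) * (exp (2 * \<kappa> * of_real t) * f t)) x -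
     tail_integral (\<lambda>t. of_real (V t) * f t) x) / (2 * \<kappa>))"
    using ac_deriv_continuous_on[OF ac_deriv_tail_integral[OF bdd_meas_integrable[OF f]]]
      ac_deriv_continuous_on[OF ac_deriv_tail_integral[OF bdd_meas_integrable[OF exp_bdd_meas[OF f]]]]
    by (intro continuous_on_divide continuous_on_diff continuous_on_mult continuous_intros) (use \<kappa>_nz in auto)
  then show ?thesis by (simp add: volterra_eq_tails[OF f, abs_def])
qed

lemma continuous_measurable: "continuous_on {0..} f \<Longrightarrow> (f :: real \<Rightarrow> complex) \<in> borel_measurable half_line"
  by (rule continuous_imp_measurable_on_sets_lebesgue[OF continuous_on_subset]) auto

text \<open>The L1 norm of V beyond x. Since its derivative is -|V|, it is the natural variable in
  which to bound the Volterra iterates.\<close>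

definition Q :: "real \<Rightarrow> real" where
  "Q x = (LINT t|half_line. (if x < t then \<bar>V t\<bar> else 0))"

lemma Q_eq: "tail_integral (\<lambda>t. of_real \<bar>V t\<bar>) x = of_real (Q x)"
proof -
  have "(if x < t then complex_of_real \<bar>V t\<bar> else 0) = of_real (if x < t then \<bar>V t\<bar> else 0)" for t by simp
  then show ?thesis unfolding tail_integral_def Q_def by (simp only: integral_complex_of_real)
qed

lemma Q_nonneg: "Q x \<ge> 0" unfolding Q_def by (rule Bochner_Integration.integral_nonneg) auto

lemma Q_le: "x \<ge> 0 \<Longrightarrow> Q x \<le> Q 0"
  unfolding Q_def
proof -
  assume x: "x \<ge> 0"
  have i: "integrable half_line (\<lambda>t. if y < t then \<bar>V t\<bar> else 0)" for y
    by (rule integrable_if) (use V in auto)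
  show "(LINT t|half_line. (if x < t then \<bar>V t\<bar> else 0)) \<le> (LINT t|half_line. (if 0 < t then \<bar>V t\<bar> else 0))"
    by (rule integral_mono[OF i i]) (use x in auto)
qed

lemma absV_ac: "ac_deriv (\<lambda>x. of_real (Q x)) (\<lambda>t. - of_real \<bar>V t\<bar>)"
proof -
  have "integrable half_line (\<lambda>t. complex_of_real \<bar>V t\<bar>)" using V by simp
  from ac_deriv_tail_integral[OF this] show ?thesis
    by (rule ac_deriv_cong) (simp_all add: Q_eq)
qed

lemma Q_power_ac:
  "ac_deriv (\<lambda>x. of_real (Q x ^ Suc j)) (\<lambda>t. - of_real (real (Suc j) * (\<bar>V t\<bar> * Q t ^ j)))"
proof (induction j)
  case 0
  show ?case by (rule ac_deriv_cong[OF absV_ac]) auto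
next
  case (Suc j)
  show ?case by (rule ac_deriv_cong[OF ac_deriv_mult[OF absV_ac Suc]]) (auto simp: algebra_simps)
qed

lemma Q_measurable [measurable]: "Q \<in> borel_measurable half_line"
proof -
  have "(\<lambda>x. Re (of_real (Q x))) \<in> borel_measurable half_line"
    using ac_deriv_measurable[OF absV_ac] by measurable
  then show ?thesis by simp
qed

lemma VQ_integrable: "integrable half_line (\<lambda>t. \<bar>V t\<bar> * Q t ^ j)"
proof (rule Bochner_Integration.integrable_bound)
  show "integrable half_line (\<lambda>t. Q 0 ^ j * V t)" using V by simp
  have "\<bar>V t\<bar> * Q t ^ j \<le> Q 0 ^ j * \<bar>V t\<bar>" if "t > 0" for t
    using that Q_nonneg Q_le[of t] by (auto intro!: mult_left_mono power_mono simp: mult.commute)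
  then show "AE t in half_line. norm (\<bar>V t\<bar> * Q t ^ j) \<le> norm (Q 0 ^ j * V t)"
    using Q_nonneg by (intro AE_I2) (auto simp: abs_mult)
qed measurable

text \<open>Since Q' = -|V| and Q vanishes at infinity, the integrand is minus the derivative of
  Q^(j+1)/(j+1). The division by j+1 builds up the factorials, so the Neumann series converges
  whatever the size of V.\<close>

lemma integral_VQ:
  assumes x: "x \<ge> 0"
  shows "(LINT t|half_line. (if x < t then \<bar>V t\<bar> * Q t ^ j else 0)) = Q x ^ Suc j / real (Suc j)"
proof -
  let ?f = "\<lambda>t. - complex_of_real (real (Suc j) * (\<bar>V t\<bar> * Q t ^ j))"
  have f: "integrable half_line ?f"
    by (intro Bochner_Integration.integrable_minus integrable_of_real integrable_mult_right VQ_integrable)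
  have absV: "integrable half_line (\<lambda>t. complex_of_real \<bar>V t\<bar>)" using V by simp
  have "((\<lambda>x. complex_of_real (Q x)) \<longlongrightarrow> 0) at_top"
    using tail_integral_tendsto_0[OF absV] unfolding Q_eq[abs_def] .
  then have "((\<lambda>x. complex_of_real (Q x) ^ Suc j) \<longlongrightarrow> 0 ^ Suc j) at_top"
    by (rule tendsto_power)
  then have lim: "((\<lambda>x. complex_of_real (Q x ^ Suc j)) \<longlongrightarrow> 0) at_top" by simp
  have "complex_of_real (Q x ^ Suc j) = 0 - tail_integral ?f x"
    by (rule ac_deriv_eq_tail_integral[OF Q_power_ac f lim x])
  also have "tail_integral ?f x =
      (LINT t|half_line. - complex_of_real (real (Suc j) * (if x < t then \<bar>V t\<bar> * Q t ^ j else 0)))"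
    unfolding tail_integral_def by (rule Bochner_Integration.integral_cong) auto
  also have "\<dots> = - complex_of_real (real (Suc j) * (LINT t|half_line. (if x < t then \<bar>V t\<bar> * Q t ^ j else 0)))"
    by (simp only: integral_minus integral_complex_of_real integral_mult_right_zero)
  finally have "complex_of_real (Q x ^ Suc j) =
      complex_of_real (real (Suc j) * (LINT t|half_line. (if x < t then \<bar>V t\<bar> * Q t ^ j else 0)))"
    by simp
  then have "Q x ^ Suc j = real (Suc j) * (LINT t|half_line. (if x < t then \<bar>V t\<bar> * Q t ^ j else 0))"
    by (simp only: of_real_eq_iff)
  then show ?thesis by (simp add: field_simps)
qed

text \<open>One application of the operator raises the power of Q/|\<kappa>| and the factorial by
  one. The free constant B allows three uses: B = 1 for the iterates, a bound of M for the limit of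
  M at infinity, and a bound of a fixed point for uniqueness.\<close>

lemma volterra_bound:
  assumes f: "f \<in> borel_measurable half_line" and B: "B \<ge> 0"
    and le: "\<And>x. x > 0 \<Longrightarrow> cmod (f x) \<le> B * (Q x / cmod \<kappa>) ^ j / fact j" and x: "x \<ge> 0"
  shows "cmod (volterra V \<kappa> f x) \<le> B * (Q x / cmod \<kappa>) ^ Suc j / fact (Suc j)"
proof -
  note [measurable] = f
  let ?w = "\<lambda>y. (B / (cmod \<kappa> ^ Suc j * fact j)) * (if x < y then \<bar>V y\<bar> * Q y ^ j else 0)"
  have w: "integrable half_line ?w"
    by (intro integrable_mult_right integrable_if VQ_integrable) measurable
  have pt: "norm (if x < y then volterra_kernel \<kappa> (y - x) * of_real (V y) * f y else 0) \<le> ?w y" for y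
  proof (cases "x < y")
    case True
    have "norm (volterra_kernel \<kappa> (y - x) * of_real (V y) * f y) \<le>
        (1 / cmod \<kappa>) * \<bar>V y\<bar> * (B * (Q y / cmod \<kappa>) ^ j / fact j)"
      unfolding norm_mult norm_of_real
      using True x B Q_nonneg by (intro mult_mono kernel_bound le mult_nonneg_nonneg) auto
    then show ?thesis using True by (simp add: power_divide mult_ac)
  qed (use B in auto)
  have "cmod (volterra V \<kappa> f x) \<le> (LINT y|half_line. ?w y)"
    unfolding volterra_def
  proof (rule Bochner_Integration.integral_norm_bound_integral)
    show "integrable half_line (\<lambda>y. if x < y then volterra_kernel \<kappa> (y - x) * of_real (V y) * f y else 0)"
    proof (rule Bochner_Integration.integrable_bound[OF w])
      show "AE y in half_line. norm (if x < y then volterra_kernel \<kappa> (y - x) * of_real (V y) * f y else 0)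
          \<le> norm (?w y)"
        unfolding real_norm_def by (rule AE_I2) (rule order_trans[OF pt abs_ge_self])
    qed measurable
  qed (use w pt in auto)
  also have "\<dots> = (B / (cmod \<kappa> ^ Suc j * fact j)) * (Q x ^ Suc j / real (Suc j))"
    by (simp only: integral_mult_right_zero integral_VQ[OF x])
  also have "\<dots> = B * (Q x / cmod \<kappa>) ^ Suc j / fact (Suc j)"
    by (simp add: power_divide field_simps)
  finally show ?thesis .
qed

abbreviation "m \<equiv> jost_iterate V \<kappa>"

lemma m_0 [simp]: "m 0 = (\<lambda>_. 1)" and m_Suc: "m (Suc j) = volterra V \<kappa> (m j)"
  by (simp_all add: jost_iterate_def)

lemma m_continuous: "continuous_on {0..} (m j)"
  and m_bound: "x \<ge> 0 \<Longrightarrow> cmod (m j x) \<le> (Q x / cmod \<kappa>) ^ j / fact j"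
proof (induction j arbitrary: x)
  case (Suc j)
  have meas: "m j \<in> borel_measurable half_line" by (rule continuous_measurable[OF Suc(1)])
  have le: "cmod (m j x) \<le> 1 * (Q x / cmod \<kappa>) ^ j / fact j" if "x > 0" for x
    using Suc(2)[of x] that by simp
  have "bdd_meas (m j)"
  proof (rule bdd_measI[OF meas])
    fix x :: real assume "x > 0"
    then show "cmod (m j x) \<le> (Q 0 / cmod \<kappa>) ^ j / fact j"
      using Q_le[of x] Q_nonneg
      by (intro order_trans[OF Suc(2)] divide_right_mono power_mono) auto
  qed
  then show "continuous_on {0..} (m (Suc j))" unfolding m_Suc by (rule volterra_continuous)
  show "x \<ge> 0 \<Longrightarrow> cmod (m (Suc j) x) \<le> (Q x / cmod \<kappa>) ^ Suc j / fact (Suc j)" for x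
    using volterra_bound[OF meas _ le] unfolding m_Suc by simp
qed auto

lemma m_measurable [measurable]: "m j \<in> borel_measurable half_line"
  by (rule continuous_measurable[OF m_continuous])

definition C :: "nat \<Rightarrow> real" where "C j = (Q 0 / cmod \<kappa>) ^ j / fact j"

lemma m_bound_C: "x \<ge> 0 \<Longrightarrow> cmod (m j x) \<le> C j"
  unfolding C_def using Q_le[of x] Q_nonneg
  by (intro order_trans[OF m_bound] divide_right_mono power_mono) auto

lemma C_summable: "summable C"
  using summable_exp[of "Q 0 / cmod \<kappa>"] unfolding C_def by (simp add: field_simps)

lemma C_nonneg: "C j \<ge> 0" unfolding C_def using Q_nonneg by simp

lemma m_summable: "x \<ge> 0 \<Longrightarrow> summable (\<lambda>j. m j x)"
  by (rule summable_comparison_test'[OF C_summable]) (rule m_bound_C)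

definition M :: "real \<Rightarrow> complex" where "M x = (\<Sum>j. m j x)"

lemma M_measurable [measurable]: "M \<in> borel_measurable half_line"
  unfolding M_def by measurable

lemma M_bound: "x \<ge> 0 \<Longrightarrow> cmod (M x) \<le> suminf C"
  unfolding M_def
proof -
  assume x: "x \<ge> 0"
  have s: "summable (\<lambda>j. norm (m j x))"
    by (rule summable_comparison_test'[OF C_summable, of 0]) (simp add: m_bound_C[OF x])
  show "cmod (\<Sum>j. m j x) \<le> suminf C"
    by (rule order_trans[OF summable_norm[OF s] suminf_le[OF m_bound_C[OF x] s C_summable]])
qed

lemma M_bdd_meas: "bdd_meas M"
  by (rule bdd_measI[OF M_measurable M_bound]) simp

text \<open>The majorants \<open>C j\<close> do not depend on y, so sum and integral may be
  exchanged. With the cut-off kernel as \<open>g\<close> this yields the fixed point equation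
  \<open>M_eq\<close>, with \<open>green_diagonal\<close> the series for the Jost function.\<close>

lemma integral_V_M_sums:
  assumes g: "bdd_meas g"
  shows "(\<lambda>j. LINT y|half_line. of_real (V y) * g y * m j y) sums (LINT y|half_line. of_real (V y) * g y * M y)"
proof -
  note Vg = bdd_meas_integrable[OF g]
  note [measurable] = borel_measurable_integrable[OF Vg]
  have b: "norm (of_real (V y) * g y * m j y) \<le> C j * norm (of_real (V y) * g y)" if "y > 0" for y j
    using m_bound_C[of y j] that by (subst norm_mult, subst mult.commute) (intro mult_right_mono, auto)
  have i: "integrable half_line (\<lambda>y. of_real (V y) * g y * m j y)" for j
  proof (rule Bochner_Integration.integrable_bound)
    show "integrable half_line (\<lambda>y. C j * norm (of_real (V y) * g y))"
      using integrable_norm[OF Vg] by (intro integrable_mult_right)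
    show "AE y in half_line. norm (of_real (V y) * g y * m j y) \<le> norm (C j * norm (of_real (V y) * g y))"
      using b C_nonneg by (intro AE_I2) (simp add: abs_mult)
  qed measurable
  have "(\<lambda>j. LINT y|half_line. of_real (V y) * g y * m j y) sums
      (LINT y|half_line. (\<Sum>j. of_real (V y) * g y * m j y))"
  proof (rule sums_integral[OF i])
    show "AE y in half_line. summable (\<lambda>j. norm (of_real (V y) * g y * m j y))"
      by (rule AE_I2, rule summable_comparison_test'[OF summable_mult2[OF C_summable]]) (use b in auto)
    show "summable (\<lambda>j. LINT y|half_line. norm (of_real (V y) * g y * m j y))"
    proof (rule summable_comparison_test'[OF summable_mult2[OF C_summable]])
      fix j
      have "(LINT y|half_line. norm (of_real (V y) * g y * m j y)) \<le>
          (LINT y|half_line. C j * norm (of_real (V y) * g y))"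
        by (rule integral_mono[OF integrable_norm[OF i] integrable_mult_right[OF integrable_norm[OF Vg]]])
          (use b in auto)
      then show "norm (LINT y|half_line. norm (of_real (V y) * g y * m j y)) \<le>
          C j * (LINT y|half_line. norm (of_real (V y) * g y))"
        by simp
    qed
  qed
  also have "(LINT y|half_line. (\<Sum>j. of_real (V y) * g y * m j y)) = (LINT y|half_line. of_real (V y) * g y * M y)"
    by (rule Bochner_Integration.integral_cong) (auto simp: M_def intro!: suminf_mult m_summable)
  finally show ?thesis .
qed

lemma M_eq:
  assumes x: "x \<ge> 0"
  shows "M x = 1 + volterra V \<kappa> M x"
proof -
  let ?g = "\<lambda>y. if x < y then volterra_kernel \<kappa> (y - x) else 0"
  have g: "bdd_meas ?g"
    by (rule bdd_measI[of _ "1 / cmod \<kappa>"]) (measurable, use kernel_bound in auto)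
  have eq: "(LINT y|half_line. of_real (V y) * ?g y * f y) = volterra V \<kappa> f x" for f
    unfolding volterra_def by (rule Bochner_Integration.integral_cong) auto
  have "(\<lambda>j. m (Suc j) x) sums volterra V \<kappa> M x"
    using integral_V_M_sums[OF g] unfolding eq m_Suc .
  then have "(\<lambda>j. m j x) sums (volterra V \<kappa> M x + m 0 x)"
    by (rule sums_Suc)
  then show ?thesis unfolding M_def by (simp add: sums_iff)
qed

text \<open>Feeding a bound back into the equation improves it to the next term of an exponential
  series; the bounds B (Q/|\<kappa>|)^j / j! tend to 0.\<close>

lemma volterra_fixed_point_eq_0:
  assumes f: "bdd_meas f" and fp: "\<And>x. x \<ge> 0 \<Longrightarrow> f x = volterra V \<kappa> f x" and x: "x \<ge> 0"
  shows "f x = 0"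
proof -
  obtain B where B: "\<And>x. x > 0 \<Longrightarrow> cmod (f x) \<le> B" and meas: "f \<in> borel_measurable half_line"
    using f unfolding bdd_meas_def by blast
  have B0: "B \<ge> 0" using B[of 1] norm_ge_zero[of "f 1"] by linarith
  have bd: "x > 0 \<Longrightarrow> cmod (f x) \<le> B * (Q x / cmod \<kappa>) ^ j / fact j" for j x
  proof (induction j arbitrary: x)
    case 0
    then show ?case using B by simp
  next
    case (Suc j)
    show ?case
      using volterra_bound[OF meas B0 Suc.IH, of x] fp[of x] Suc.prems by simp
  qed
  \<comment> \<open>One more application of the bound, because \<open>bd\<close> speaks of x > 0
    only and x may be 0 here.\<close>
  have "cmod (f x) \<le> B * (Q x / cmod \<kappa>) ^ Suc j / fact (Suc j)" for j
    using volterra_bound[OF meas B0 bd x] fp[OF x] by simp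
  moreover have "(\<lambda>j. B * (Q x / cmod \<kappa>) ^ Suc j / fact (Suc j)) \<longlonglongrightarrow> 0"
  proof -
    have "(\<lambda>j. (Q x / cmod \<kappa>) ^ j / fact j) \<longlonglongrightarrow> 0"
      using summable_LIMSEQ_zero[OF summable_exp[of "Q x / cmod \<kappa>"]] by (simp add: field_simps)
    then have "(\<lambda>j. (Q x / cmod \<kappa>) ^ Suc j / fact (Suc j)) \<longlonglongrightarrow> 0"
      by (rule LIMSEQ_Suc)
    from tendsto_mult_right_zero[OF this, of B] show ?thesis by (simp only: times_divide_eq_right)
  qed
  ultimately have "cmod (f x) \<le> 0"
    by (intro LIMSEQ_le_const) auto
  then show ?thesis by simp
qed

end

section \<open>Existence and uniqueness of the Jost solution\<close>

context jost_setting
begin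

definition P :: "real \<Rightarrow> complex" where "P = tail_integral (\<lambda>t. of_real (V t) * M t)"
definition R :: "real \<Rightarrow> complex" where "R = tail_integral (\<lambda>t. of_real (V t) * (exp (2 * \<kappa> * of_real t) * M t))"

definition theta :: "real \<Rightarrow> complex" where "theta x = exp (\<kappa> * of_real x) * M x"
definition theta' :: "real \<Rightarrow> complex" where
  "theta' x = \<kappa> * (exp (\<kappa> * of_real x) * (1 + (- 1 / (2 * \<kappa>)) * P x)) - exp (- \<kappa> * of_real x) * R x / 2"

lemma P_ac: "ac_deriv P (\<lambda>t. - (of_real (V t) * M t))"
  unfolding P_def by (intro ac_deriv_tail_integral bdd_meas_integrable M_bdd_meas)

lemma R_ac: "ac_deriv R (\<lambda>t. - (of_real (V t) * (exp (2 * \<kappa> * of_real t) * M t)))"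
  unfolding R_def by (intro ac_deriv_tail_integral bdd_meas_integrable exp_bdd_meas M_bdd_meas)

lemma M_eq_PR: "x \<ge> 0 \<Longrightarrow> M x = 1 + (exp (- (2 * \<kappa>) * of_real x) * R x - P x) / (2 * \<kappa>)"
  using M_eq[of x] volterra_eq_tails[OF M_bdd_meas, of x] by (simp only: P_def R_def)

lemma exp_relations:
  "exp (2 * \<kappa> * of_real x) = exp (\<kappa> * of_real x) * exp (\<kappa> * of_real x)"
  "exp (- \<kappa> * of_real x) = inverse (exp (\<kappa> * of_real x))"
  "exp (- (2 * \<kappa>) * of_real x) = inverse (exp (\<kappa> * of_real x)) * inverse (exp (\<kappa> * of_real x))"
  by (simp_all flip: exp_add exp_minus add: algebra_simps)

lemma theta_eq:
  assumes "x \<ge> 0"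
  shows "theta x = exp (\<kappa> * of_real x) * (1 + (- 1 / (2 * \<kappa>)) * P x) + (1 / (2 * \<kappa>)) * (exp (- \<kappa> * of_real x) * R x)"
  unfolding theta_def M_eq_PR[OF assms] exp_relations using \<kappa>_nz by (simp add: field_simps)

text \<open>Variation of constants: in exp(\<kappa>x)(1 - P/(2\<kappa>)) + exp(-\<kappa>x)
  R/(2\<kappa>) the terms with P' and R' cancel on the first differentiation, which is why
  \<open>theta'\<close> contains no V explicitly. On the second they add up to V times
  \<open>theta\<close>.\<close>

lemma
  shows theta_ac: "ac_deriv theta theta'"
    and theta'_ac: "ac_deriv theta' (\<lambda>x. (of_real (V x) + \<kappa>\<^sup>2) * theta x)"
proof -
  note A = ac_deriv_mult[OF ac_deriv_exp[of \<kappa>] ac_deriv_add[OF ac_deriv_const[of 1] ac_deriv_scale[OF P_ac, of "- 1 / (2 * \<kappa>)"]]]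
  note B = ac_deriv_mult[OF ac_deriv_exp[of "- \<kappa>"] R_ac]
  show "ac_deriv theta theta'"
  proof (rule ac_deriv_cong[OF ac_deriv_add[OF A ac_deriv_scale[OF B, of "1 / (2 * \<kappa>)"]]])
    fix x :: real assume x: "x \<ge> 0"
    show "exp (\<kappa> * of_real x) * (1 + (- 1 / (2 * \<kappa>)) * P x) + 1 / (2 * \<kappa>) * (exp (- \<kappa> * of_real x) * R x) = theta x"
      using theta_eq[OF x] by simp
    show "\<kappa> * exp (\<kappa> * of_real x) * (1 + - 1 / (2 * \<kappa>) * P x) +
         exp (\<kappa> * of_real x) * (0 + - 1 / (2 * \<kappa>) * - (of_real (V x) * M x)) +
         1 / (2 * \<kappa>) * (- \<kappa> * exp (- \<kappa> * of_real x) * R x +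
          exp (- \<kappa> * of_real x) * - (of_real (V x) * (exp (2 * \<kappa> * of_real x) * M x))) = theta' x"
      unfolding theta'_def exp_relations using \<kappa>_nz by (simp add: field_simps)
  qed
  show "ac_deriv theta' (\<lambda>x. (of_real (V x) + \<kappa>\<^sup>2) * theta x)"
  proof (rule ac_deriv_cong[OF ac_deriv_add[OF ac_deriv_scale[OF A, of \<kappa>] ac_deriv_scale[OF B, of "- 1 / 2"]]])
    fix x :: real assume x: "x \<ge> 0"
    show "\<kappa> * (exp (\<kappa> * of_real x) * (1 + (- 1 / (2 * \<kappa>)) * P x)) + - 1 / 2 * (exp (- \<kappa> * of_real x) * R x) = theta' x"
      by (simp add: theta'_def)
    have MV: "(of_real (V x) + \<kappa>\<^sup>2) * theta x = exp (\<kappa> * of_real x) * (of_real (V x) * M x) + \<kappa>\<^sup>2 * theta x"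
      by (simp add: theta_def algebra_simps)
    show "\<kappa> * (\<kappa> * exp (\<kappa> * of_real x) * (1 + - 1 / (2 * \<kappa>) * P x) +
         exp (\<kappa> * of_real x) * (0 + - 1 / (2 * \<kappa>) * - (of_real (V x) * M x))) +
         - 1 / 2 * (- \<kappa> * exp (- \<kappa> * of_real x) * R x +
          exp (- \<kappa> * of_real x) * - (of_real (V x) * (exp (2 * \<kappa> * of_real x) * M x))) =
        (of_real (V x) + \<kappa>\<^sup>2) * theta x"
      unfolding MV unfolding theta_eq[OF x] exp_relations using \<kappa>_nz by (simp add: field_simps power2_eq_square)
  qed
qed

lemma M_tendsto: "(M \<longlongrightarrow> 1) at_top"
proof -
  have absV: "integrable half_line (\<lambda>t. complex_of_real \<bar>V t\<bar>)" using V by simp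
  have "((\<lambda>x. Re (complex_of_real (Q x))) \<longlongrightarrow> Re 0) at_top"
    using tail_integral_tendsto_0[OF absV] unfolding Q_eq[abs_def] by (rule tendsto_Re)
  then have Q: "(Q \<longlongrightarrow> 0) at_top" by simp
  have K: "suminf C \<ge> 0" by (intro suminf_nonneg C_summable C_nonneg)
  have le: "cmod (M x - 1) \<le> suminf C * (Q x / cmod \<kappa>)" if "x \<ge> 0" for x
    using volterra_bound[OF M_measurable K _ that, of 0] M_bound M_eq[OF that] by simp
  have "((\<lambda>x. M x - 1) \<longlongrightarrow> 0) at_top"
  proof (rule Lim_null_comparison)
    show "\<forall>\<^sub>F x in at_top. norm (M x - 1) \<le> suminf C * (Q x / cmod \<kappa>)"
      using eventually_ge_at_top[of 0] by eventually_elim (rule le)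
    show "((\<lambda>x. suminf C * (Q x / cmod \<kappa>)) \<longlongrightarrow> 0) at_top"
      by (rule tendsto_mult_right_zero, rule tendsto_divide_zero, rule Q)
  qed
  then show ?thesis by (simp add: LIM_zero_iff)
qed

lemma P_tendsto: "(P \<longlongrightarrow> 0) at_top"
  unfolding P_def by (intro tail_integral_tendsto_0 bdd_meas_integrable M_bdd_meas)

lemma theta'_tendsto: "((\<lambda>x. theta' x / (\<kappa> * exp (\<kappa> * of_real x))) \<longlongrightarrow> 1) at_top"
proof -
  \<comment> \<open>\<open>M_eq_PR\<close> expresses exp(-2\<kappa>x) R/(2\<kappa>) as M - 1 +
    P/(2\<kappa>), so the growing exponential gets by without an estimate of its own.\<close>
  have "((\<lambda>x. (1 - P x / (2 * \<kappa>)) - (M x - 1 + P x / (2 * \<kappa>))) \<longlongrightarrow> (1 - 0 / (2 * \<kappa>)) - (1 - 1 + 0 / (2 * \<kappa>))) at_top"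
    by (rule tendsto_diff[OF tendsto_diff[OF tendsto_const tendsto_divide[OF P_tendsto tendsto_const]]
          tendsto_add[OF tendsto_diff[OF M_tendsto tendsto_const] tendsto_divide[OF P_tendsto tendsto_const]]])
      (use \<kappa>_nz in auto)
  moreover have "\<forall>\<^sub>F x in at_top. (1 - P x / (2 * \<kappa>)) - (M x - 1 + P x / (2 * \<kappa>)) =
      theta' x / (\<kappa> * exp (\<kappa> * of_real x))"
    using eventually_ge_at_top[of 0]
  proof eventually_elim
    case (elim x)
    show ?case
      unfolding theta'_def M_eq_PR[OF elim] exp_relations using \<kappa>_nz by (simp add: field_simps)
  qed
  ultimately show ?thesis
    by (simp add: Lim_transform_eventually)
qed

lemma is_jost_solution_theta:
  assumes "\<kappa> = \<i> * \<zeta>"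
  shows "is_jost_solution V \<zeta> (restrict theta {0..})"
  unfolding is_jost_solution_def
proof (intro conjI exI[of _ theta'] allI impI)
  have z2: "\<kappa>\<^sup>2 = - (\<zeta>\<^sup>2)" by (simp add: assms power_mult_distrib)
  show "restrict theta {0..} \<in> extensional {0..}" by simp
  fix x :: real assume x: "x \<ge> 0"
  have "(theta has_vector_derivative theta' x) (at x within {0..})"
    by (rule ac_deriv_has_vector_derivative[OF theta_ac ac_deriv_continuous_on[OF theta'_ac] x])
  then show "(restrict theta {0..} has_vector_derivative theta' x) (at x within {0..})"
    by (rule has_vector_derivative_transform[rotated 2]) (use x in auto)
  have "(LINT t|lebesgue_on {0..x}. (of_real (V t) - \<zeta>\<^sup>2) * restrict theta {0..} t) =
      (LINT t|lebesgue_on {0..x}. (of_real (V t) + \<kappa>\<^sup>2) * theta t)"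
    by (rule Bochner_Integration.integral_cong) (auto simp: z2)
  then show "theta' x = theta' 0 + (LINT t|lebesgue_on {0..x}. (of_real (V t) - \<zeta>\<^sup>2) * restrict theta {0..} t)"
    using ac_derivD(2)[OF theta'_ac x] by (simp only:)
next
  have "\<forall>\<^sub>F x in at_top. M x = restrict theta {0..} x / exp (\<i> * \<zeta> * of_real x)"
    using eventually_ge_at_top[of 0] by eventually_elim (simp add: theta_def flip: assms)
  then show "((\<lambda>x. restrict theta {0..} x / exp (\<i> * \<zeta> * of_real x)) \<longlongrightarrow> 1) at_top"
    by (rule Lim_transform_eventually[OF M_tendsto])
  show "((\<lambda>x. theta' x / (\<i> * \<zeta> * exp (\<i> * \<zeta> * of_real x))) \<longlongrightarrow> 1) at_top"
    using theta'_tendsto by (simp only: assms)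
qed

text \<open>The definition states the integral identity but says nothing about integrability of its
  integrand. This comes from continuity of the solution, which is bounded on compact intervals, and
  integrability of V; the product rule is then available.\<close>

lemma jost_solutionD:
  assumes \<zeta>: "\<kappa> = \<i> * \<zeta>" and J: "is_jost_solution V \<zeta> \<theta>"
  obtains \<theta>' where "ac_deriv \<theta> \<theta>'" "ac_deriv \<theta>' (\<lambda>x. (of_real (V x) + \<kappa>\<^sup>2) * \<theta> x)"
    "((\<lambda>x. exp (- \<kappa> * of_real x) * \<theta> x) \<longlongrightarrow> 1) at_top"
    "((\<lambda>x. exp (- \<kappa> * of_real x) * \<theta>' x) \<longlongrightarrow> \<kappa>) at_top"
proof -
  obtain \<theta>' where d: "\<And>x. x \<ge> 0 \<Longrightarrow> (\<theta> has_vector_derivative \<theta>' x) (at x within {0..})"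
    and i: "\<And>x. x \<ge> 0 \<Longrightarrow> \<theta>' x = \<theta>' 0 + (LINT t|lebesgue_on {0..x}. (of_real (V t) - \<zeta>\<^sup>2) * \<theta> t)"
    and l: "((\<lambda>x. \<theta> x / exp (\<i> * \<zeta> * of_real x)) \<longlongrightarrow> 1) at_top"
      "((\<lambda>x. \<theta>' x / (\<i> * \<zeta> * exp (\<i> * \<zeta> * of_real x))) \<longlongrightarrow> 1) at_top"
    using J unfolding is_jost_solution_def by blast
  have z2: "of_real (V x) - \<zeta>\<^sup>2 = of_real (V x) + \<kappa>\<^sup>2" for x by (simp add: \<zeta> power_mult_distrib)
  have cont: "continuous_on {0..} \<theta>"
    using d by (auto simp: continuous_on_eq_continuous_within intro: has_vector_derivative_continuous)
  have ac': "ac_deriv \<theta>' (\<lambda>x. (of_real (V x) + \<kappa>\<^sup>2) * \<theta> x)"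
    unfolding ac_deriv_def
  proof (intro allI impI conjI)
    fix x :: real assume x: "x \<ge> 0"
    show "\<theta>' x = \<theta>' 0 + (LINT t|lebesgue_on {0..x}. (of_real (V t) + \<kappa>\<^sup>2) * \<theta> t)"
      using i[OF x] by (simp only: z2)
    have cx: "continuous_on {0..x} \<theta>" by (rule continuous_on_subset[OF cont]) auto
    then have "bounded (\<theta> ` {0..x})"
      by (intro compact_imp_bounded compact_continuous_image) auto
    then obtain B where "\<forall>y\<in>\<theta> ` {0..x}. cmod y \<le> B" unfolding bounded_iff by blast
    then have B: "\<And>t. t \<in> {0..x} \<Longrightarrow> cmod (\<theta> t) \<le> B" by simp
    have Vx: "integrable (lebesgue_on {0..x}) (\<lambda>t. complex_of_real (V t))"
      using V by (intro integrable_half_line_imp_Icc x) simp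
    have meas: "\<theta> \<in> borel_measurable (lebesgue_on {0..x})"
      by (rule continuous_imp_measurable_on_sets_lebesgue[OF cx]) auto
    have "integrable (lebesgue_on {0..x}) (\<lambda>t. complex_of_real (V t) * \<theta> t)"
    proof (rule Bochner_Integration.integrable_bound)
      show "integrable (lebesgue_on {0..x}) (\<lambda>t. of_real B * complex_of_real (V t))"
        using Vx by simp
      show "(\<lambda>t. complex_of_real (V t) * \<theta> t) \<in> borel_measurable (lebesgue_on {0..x})"
        by (rule borel_measurable_times[OF borel_measurable_integrable[OF Vx] meas])
      show "AE t in lebesgue_on {0..x}. norm (complex_of_real (V t) * \<theta> t) \<le> norm (of_real B * complex_of_real (V t))"
      proof (rule AE_I2)
        fix t assume "t \<in> space (lebesgue_on {0..x})"
        then have "cmod (\<theta> t) \<le> \<bar>B\<bar>" using B[of t] by auto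
        then show "norm (complex_of_real (V t) * \<theta> t) \<le> norm (of_real B * complex_of_real (V t))"
          by (simp add: norm_mult mult.commute[of "\<bar>B\<bar>"] mult_left_mono)
      qed
    qed
    moreover have "integrable (lebesgue_on {0..x}) (\<lambda>t. \<kappa>\<^sup>2 * \<theta> t)"
      using continuous_imp_integrable_real[OF cx] by simp
    ultimately show "integrable (lebesgue_on {0..x}) (\<lambda>t. (of_real (V t) + \<kappa>\<^sup>2) * \<theta> t)"
      by (simp add: distrib_right)
  qed
  have ac: "ac_deriv \<theta> \<theta>'"
    by (rule ac_deriv_C1[OF d ac_deriv_continuous_on[OF ac']])
  have "((\<lambda>x. exp (- \<kappa> * of_real x) * \<theta> x) \<longlongrightarrow> 1) at_top"
    using l(1) by (simp add: \<zeta> exp_minus field_simps)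
  moreover have "((\<lambda>x. exp (- \<kappa> * of_real x) * \<theta>' x) \<longlongrightarrow> \<kappa>) at_top"
  proof -
    have "((\<lambda>x. \<kappa> * (\<theta>' x / (\<i> * \<zeta> * exp (\<i> * \<zeta> * of_real x)))) \<longlongrightarrow> \<kappa> * 1) at_top"
      by (rule tendsto_mult_left[OF l(2)])
    moreover have "\<kappa> * (\<theta>' x / (\<i> * \<zeta> * exp (\<i> * \<zeta> * of_real x))) = exp (- \<kappa> * of_real x) * \<theta>' x" for x
      using \<kappa>_nz unfolding \<zeta>[symmetric] exp_relations(2) by (simp add: field_simps)
    ultimately show ?thesis by simp
  qed
  ultimately show ?thesis using that ac ac' by blast
qed

text \<open>The difference \<delta> of two solutions, rescaled to \<mu> = exp(-\<kappa>x) \<delta>,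
  tends to 0 and is therefore bounded. It solves the homogeneous Volterra equation, hence
  vanishes.\<close>

lemma jost_solution_unique:
  assumes \<zeta>: "\<kappa> = \<i> * \<zeta>" and J: "is_jost_solution V \<zeta> \<theta>\<^sub>1" "is_jost_solution V \<zeta> \<theta>\<^sub>2" and x: "x \<ge> 0"
  shows "\<theta>\<^sub>1 x = \<theta>\<^sub>2 x"
proof -
  obtain \<phi>\<^sub>1 where 1: "ac_deriv \<theta>\<^sub>1 \<phi>\<^sub>1" "ac_deriv \<phi>\<^sub>1 (\<lambda>x. (of_real (V x) + \<kappa>\<^sup>2) * \<theta>\<^sub>1 x)"
    "((\<lambda>x. exp (- \<kappa> * of_real x) * \<theta>\<^sub>1 x) \<longlongrightarrow> 1) at_top"
    "((\<lambda>x. exp (- \<kappa> * of_real x) * \<phi>\<^sub>1 x) \<longlongrightarrow> \<kappa>) at_top"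
    by (rule jost_solutionD[OF \<zeta> J(1)])
  obtain \<phi>\<^sub>2 where 2: "ac_deriv \<theta>\<^sub>2 \<phi>\<^sub>2" "ac_deriv \<phi>\<^sub>2 (\<lambda>x. (of_real (V x) + \<kappa>\<^sup>2) * \<theta>\<^sub>2 x)"
    "((\<lambda>x. exp (- \<kappa> * of_real x) * \<theta>\<^sub>2 x) \<longlongrightarrow> 1) at_top"
    "((\<lambda>x. exp (- \<kappa> * of_real x) * \<phi>\<^sub>2 x) \<longlongrightarrow> \<kappa>) at_top"
    by (rule jost_solutionD[OF \<zeta> J(2)])
  define \<delta> where "\<delta> x = \<theta>\<^sub>1 x + (-1) * \<theta>\<^sub>2 x" for x
  define \<delta>' where "\<delta>' x = \<phi>\<^sub>1 x + (-1) * \<phi>\<^sub>2 x" for x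
  define \<mu> where "\<mu> x = exp (- \<kappa> * of_real x) * \<delta> x" for x
  have d: "ac_deriv \<delta> \<delta>'"
    unfolding \<delta>_def[abs_def] \<delta>'_def[abs_def] by (intro ac_deriv_add ac_deriv_scale 1 2)
  have d': "ac_deriv \<delta>' (\<lambda>x. (of_real (V x) + \<kappa>\<^sup>2) * \<delta> x)"
    by (rule ac_deriv_cong[OF ac_deriv_add[OF 1(2) ac_deriv_scale[OF 2(2), of "-1"]]])
      (simp_all add: \<delta>_def \<delta>'_def algebra_simps)
  have \<mu>_lim: "(\<mu> \<longlongrightarrow> 0) at_top"
    using tendsto_diff[OF 1(3) 2(3)] by (simp add: \<mu>_def[abs_def] \<delta>_def algebra_simps)
  have \<delta>'_lim: "((\<lambda>x. exp (- \<kappa> * of_real x) * \<delta>' x) \<longlongrightarrow> 0) at_top"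
    using tendsto_diff[OF 1(4) 2(4)] by (simp add: \<delta>'_def algebra_simps)
  have \<mu>_ac: "ac_deriv \<mu> (\<lambda>x. - \<kappa> * exp (- \<kappa> * of_real x) * \<delta> x + exp (- \<kappa> * of_real x) * \<delta>' x)"
    unfolding \<mu>_def[abs_def] by (rule ac_deriv_mult[OF ac_deriv_exp d])
  have \<mu>_b: "bdd_meas \<mu>"
  proof -
    have "\<forall>\<^sub>F x in at_top. dist (\<mu> x) 0 < 1" using \<mu>_lim by (rule tendstoD) simp
    then obtain X where X: "\<And>x. x \<ge> X \<Longrightarrow> cmod (\<mu> x) < 1"
      by (auto simp: eventually_at_top_linorder)
    have "bounded (\<mu> ` {0..X})"
      by (intro compact_imp_bounded compact_continuous_image)
        (auto intro: continuous_on_subset[OF ac_deriv_continuous_on[OF \<mu>_ac]])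
    then obtain B where "\<forall>y\<in>\<mu> ` {0..X}. cmod y \<le> B" unfolding bounded_iff by blast
    then have B: "\<And>t. t \<in> {0..X} \<Longrightarrow> cmod (\<mu> t) \<le> B" by simp
    show ?thesis
    proof (rule bdd_measI[of _ "max B 1"])
      fix x :: real assume "x > 0"
      then show "cmod (\<mu> x) \<le> max B 1"
        using X[of x] B[of x] by (cases "x \<ge> X") auto
    qed (rule ac_deriv_measurable[OF \<mu>_ac])
  qed
  \<comment> \<open>The Wronskians of exp(\<kappa>y) and exp(-\<kappa>y) with \<delta>. In their
    derivatives everything cancels except V times the exponential times \<delta>, and \<mu> is
    recovered as (b - exp(-2\<kappa>x) a)/(2\<kappa>).\<close>
  let ?a = "\<lambda>y. exp (\<kappa> * of_real y) * (\<delta>' y + (- \<kappa>) * \<delta> y)"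
  let ?b = "\<lambda>y. exp (- \<kappa> * of_real y) * (\<delta>' y + \<kappa> * \<delta> y)"
  have e\<mu>: "exp (2 * \<kappa> * of_real y) * \<mu> y = exp (\<kappa> * of_real y) * \<delta> y" for y
  proof -
    have "exp (2 * \<kappa> * of_real y) * exp (- \<kappa> * of_real y) = exp (\<kappa> * of_real y)"
      by (simp flip: exp_add add: algebra_simps)
    then show ?thesis by (simp only: \<mu>_def mult.assoc[symmetric])
  qed
  have a: "ac_deriv ?a (\<lambda>y. of_real (V y) * (exp (2 * \<kappa> * of_real y) * \<mu> y))"
    by (rule ac_deriv_cong[OF ac_deriv_mult[OF ac_deriv_exp[of \<kappa>] ac_deriv_add[OF d' ac_deriv_scale[OF d, of "- \<kappa>"]]]])
      (simp, simp only: e\<mu>, simp add: algebra_simps power2_eq_square)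
  have b: "ac_deriv ?b (\<lambda>y. of_real (V y) * \<mu> y)"
    by (rule ac_deriv_cong[OF ac_deriv_mult[OF ac_deriv_exp[of "- \<kappa>"] ac_deriv_add[OF d' ac_deriv_scale[OF d, of \<kappa>]]]])
      (simp_all add: \<mu>_def field_simps power2_eq_square)
  have b_eq: "?b y = exp (- \<kappa> * of_real y) * \<delta>' y + \<kappa> * \<mu> y" for y
    by (simp add: \<mu>_def algebra_simps)
  have b_lim: "(?b \<longlongrightarrow> 0) at_top"
    unfolding b_eq using tendsto_add[OF \<delta>'_lim tendsto_mult_right_zero[OF \<mu>_lim, of \<kappa>]] by simp
  have a_eq: "?a y = exp (2 * \<kappa> * of_real y) * (exp (- \<kappa> * of_real y) * \<delta>' y - \<kappa> * \<mu> y)" for y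
    unfolding \<mu>_def exp_relations by (simp add: field_simps)
  have c_lim: "((\<lambda>y. exp (- \<kappa> * of_real y) * \<delta>' y - \<kappa> * \<mu> y) \<longlongrightarrow> 0) at_top"
    using tendsto_diff[OF \<delta>'_lim tendsto_mult_right_zero[OF \<mu>_lim, of \<kappa>]] by simp
  have a_lim: "(?a \<longlongrightarrow> 0) at_top"
    unfolding a_eq
  proof (rule Lim_null_comparison[OF _ tendsto_norm_zero[OF c_lim]])
    show "\<forall>\<^sub>F y in at_top. norm (exp (2 * \<kappa> * of_real y) * (exp (- \<kappa> * of_real y) * \<delta>' y - \<kappa> * \<mu> y))
        \<le> norm (exp (- \<kappa> * of_real y) * \<delta>' y - \<kappa> * \<mu> y)"
      using eventually_ge_at_top[of 0]
    proof eventually_elim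
      case (elim y)
      then show ?case
        unfolding norm_mult using norm_exp_le_1[of "2 * \<kappa>" y] \<kappa> by (intro mult_left_le_one_le) auto
    qed
  qed
  have \<mu>_eq: "\<mu> x = volterra V \<kappa> \<mu> x" if x: "x \<ge> 0" for x
  proof -
    have ax: "?a x = 0 - tail_integral (\<lambda>y. of_real (V y) * (exp (2 * \<kappa> * of_real y) * \<mu> y)) x"
      by (rule ac_deriv_eq_tail_integral[OF a bdd_meas_integrable[OF exp_bdd_meas[OF \<mu>_b]] a_lim x])
    have bx: "?b x = 0 - tail_integral (\<lambda>y. of_real (V y) * \<mu> y) x"
      by (rule ac_deriv_eq_tail_integral[OF b bdd_meas_integrable[OF \<mu>_b] b_lim x])
    have "\<mu> x = (?b x - exp (- (2 * \<kappa>) * of_real x) * ?a x) / (2 * \<kappa>)"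
      unfolding \<mu>_def exp_relations using \<kappa>_nz by (simp add: field_simps)
    then show ?thesis
      unfolding volterra_eq_tails[OF \<mu>_b] ax bx by simp
  qed
  have "\<mu> x = 0" by (rule volterra_fixed_point_eq_0[OF \<mu>_b \<mu>_eq x])
  then show ?thesis by (simp add: \<mu>_def \<delta>_def)
qed

lemma jost_solution_eq:
  assumes \<zeta>: "\<kappa> = \<i> * \<zeta>"
  shows "jost_solution V \<zeta> = restrict theta {0..}"
  unfolding jost_solution_def
proof (rule the_equality)
  show "is_jost_solution V \<zeta> (restrict theta {0..})" by (rule is_jost_solution_theta[OF \<zeta>])
  fix \<theta> assume J: "is_jost_solution V \<zeta> \<theta>"
  show "\<theta> = restrict theta {0..}"
  proof (rule extensionalityI)
    show "\<theta> \<in> extensional {0..}" using J by (simp add: is_jost_solution_def)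
    show "\<theta> x = restrict theta {0..} x" if "x \<in> {0..}" for x
      using jost_solution_unique[OF \<zeta> J is_jost_solution_theta[OF \<zeta>]] that by simp
  qed auto
qed

section \<open>The Jost function as a series of integrals\<close>

lemma jost_function_eq:
  assumes \<zeta>: "\<kappa> = \<i> * \<zeta>"
  shows "jost_function \<gamma> V \<zeta> = of_real \<gamma> * theta 0 - theta' 0"
proof -
  have "(theta has_vector_derivative theta' 0) (at 0 within {0..})"
    by (rule ac_deriv_has_vector_derivative[OF theta_ac ac_deriv_continuous_on[OF theta'_ac]]) simp
  then have "(restrict theta {0..} has_vector_derivative theta' 0) (at 0 within {0..})"
    by (rule has_vector_derivative_transform[rotated 2]) auto
  moreover have "at (0::real) within {0..} \<noteq> bot"
    by (simp add: at_within_Ici_at_right)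
  ultimately have "vector_derivative (restrict theta {0..}) (at 0 within {0..}) = theta' 0"
    by (intro vector_derivative_within)
  then show ?thesis by (simp add: jost_function_def jost_solution_eq[OF \<zeta>])
qed

definition green_diagonal :: "complex \<Rightarrow> real \<Rightarrow> complex" where
  "green_diagonal c x = c * exp (2 * \<kappa> * of_real x) + volterra_kernel \<kappa> x"

lemma green_diagonal_bdd_meas: "bdd_meas (green_diagonal c)"
proof (rule bdd_measI[of _ "cmod c + 1 / cmod \<kappa>"])
  show "green_diagonal c \<in> borel_measurable half_line"
    unfolding green_diagonal_def[abs_def] volterra_kernel_def[abs_def] by measurable
  fix x :: real assume x: "x > 0"
  have "cmod (green_diagonal c x) \<le> cmod (c * exp (2 * \<kappa> * of_real x)) + cmod (volterra_kernel \<kappa> x)"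
    unfolding green_diagonal_def by (rule norm_triangle_ineq)
  also have "cmod (c * exp (2 * \<kappa> * of_real x)) \<le> cmod c"
    unfolding norm_mult using norm_exp_le_1[of "2 * \<kappa>" x] \<kappa> x by (intro mult_right_le_one_le) auto
  also have "cmod (volterra_kernel \<kappa> x) \<le> 1 / cmod \<kappa>"
    using x by (intro kernel_bound) simp
  finally show "cmod (green_diagonal c x) \<le> cmod c + 1 / cmod \<kappa>" by simp
qed

text \<open>\<open>theta 0\<close> and \<open>theta' 0\<close> are affine in P(0) and R(0). The
  quotient minus 1 comes out as (c + 1/(2\<kappa>)) R(0) - P(0)/(2\<kappa>), where c + 1/(2\<kappa>)
  = (\<gamma> + \<kappa>)/(2\<kappa>(\<gamma> - \<kappa>)). This is a single integral of V M against
  the diagonal of the Green function.\<close>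

theorem jost_function_series:
  assumes \<zeta>: "\<kappa> = \<i> * \<zeta>" and w: "of_real \<gamma> - \<kappa> \<noteq> 0"
  defines "c \<equiv> 1 / (of_real \<gamma> - \<kappa>)"
  shows "(\<lambda>j. LINT y|half_line. of_real (V y) * green_diagonal c y * m j y) sums
    (jost_function \<gamma> V \<zeta> / (of_real \<gamma> - \<kappa>) - 1)"
proof -
  let ?P = "LINT y|half_line. of_real (V y) * M y"
  let ?R = "LINT y|half_line. of_real (V y) * (exp (2 * \<kappa> * of_real y) * M y)"
  have P0: "P 0 = ?P" and R0: "R 0 = ?R"
    unfolding P_def R_def tail_integral_def by (rule Bochner_Integration.integral_cong; auto)+
  have iP: "integrable half_line (\<lambda>y. of_real (V y) * M y)"
    and iR: "integrable half_line (\<lambda>y. of_real (V y) * (exp (2 * \<kappa> * of_real y) * M y))"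
    by (intro bdd_meas_integrable exp_bdd_meas M_bdd_meas)+
  have "(LINT y|half_line. of_real (V y) * green_diagonal c y * M y) =
      (LINT y|half_line. (c + 1 / (2 * \<kappa>)) * (of_real (V y) * (exp (2 * \<kappa> * of_real y) * M y)) -
         (1 / (2 * \<kappa>)) * (of_real (V y) * M y))"
    by (rule Bochner_Integration.integral_cong)
      (simp_all add: green_diagonal_def volterra_kernel_def algebra_simps diff_divide_distrib)
  also have "\<dots> = (c + 1 / (2 * \<kappa>)) * R 0 - (1 / (2 * \<kappa>)) * P 0"
    unfolding P0 R0 using iP iR by simp
  also have "\<dots> = jost_function \<gamma> V \<zeta> / (of_real \<gamma> - \<kappa>) - 1"
  proof -
    have t0: "theta 0 = 1 + (R 0 - P 0) / (2 * \<kappa>)"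
      using theta_eq[of 0] by (simp add: diff_divide_distrib)
    have t1: "theta' 0 = \<kappa> - (P 0 + R 0) / 2"
      using \<kappa>_nz by (simp add: theta'_def field_simps)
    show ?thesis
      unfolding jost_function_eq[OF \<zeta>] t0 t1 c_def using w \<kappa>_nz by (simp add: divide_simps) (simp add: algebra_simps)
  qed
  finally show ?thesis using integral_V_M_sums[OF green_diagonal_bdd_meas[of c]] by simp
qed

end

section \<open>The operator \<open>H\<^sub>0\<close>\<close>

lemma integrable_half_line_cutoff:
  fixes f :: "real \<Rightarrow> 'b::euclidean_space"
  assumes "integrable (lebesgue_on {0..x}) f" "x \<ge> 0"
  shows "integrable half_line (\<lambda>t. if t \<le> x then f t else 0)"
proof -
  have "integrable (lebesgue_on {0<..x}) f"
    by (rule integrable_lebesgue_on_subset[OF assms(1)]) auto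
  then have "integrable lebesgue (\<lambda>t. if t \<in> {0<..x} then f t else 0)"
    by (subst Lebesgue_Measure.integrable_restrict_UNIV) auto
  moreover have "(\<lambda>t. if t \<in> {0<..x} then f t else 0) =
      (\<lambda>t. if t \<in> {0<..} then (if t \<le> x then f t else 0) else 0)" by auto
  ultimately have "integrable lebesgue (\<lambda>t. if t \<in> {0<..} then (if t \<le> x then f t else 0) else 0)"
    by (simp only:)
  then show ?thesis
    by (rule iffD1[OF Lebesgue_Measure.integrable_restrict_UNIV, rotated]) auto
qed

lemma integral_half_line_cutoff:
  fixes f :: "real \<Rightarrow> 'b::euclidean_space"
  assumes "integrable (lebesgue_on {0..x}) f" "x \<ge> 0"
  shows "(LINT t|half_line. (if t \<le> x then f t else 0)) = (LINT t|lebesgue_on {0..x}. f t)"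
proof -
  have "(LINT t|lebesgue_on {0..x}. f t) = (LINT t|lebesgue_on {0..x}. (if t \<le> x then f t else 0))"
    by (rule Bochner_Integration.integral_cong) auto
  also have "\<dots> = (LINT t|half_line. (if t \<le> x then (if t \<le> x then f t else 0) else 0))"
    by (rule integral_Icc_eq_half_line[OF integrable_half_line_cutoff[OF assms] assms(2)])
  also have "\<dots> = (LINT t|half_line. (if t \<le> x then f t else 0))"
    by (rule Bochner_Integration.integral_cong) auto
  finally show ?thesis by simp
qed

lemma L2_integrable_Icc:
  assumes f: "f \<in> L2" and x: "x \<ge> 0"
  shows "integrable (lebesgue_on {0..x}) f"
proof -
  note [measurable] = L2D(1)[OF f]
  have one: "integrable half_line (\<lambda>t. if t \<le> x then 1 else (0::real))"
    by (rule integrable_half_line_cutoff[OF _ x]) (rule continuous_imp_integrable_real, simp)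
  have "integrable half_line (\<lambda>t. if t \<le> x then f t else 0)"
  proof (rule Bochner_Integration.integrable_bound)
    show "integrable half_line (\<lambda>t. (if t \<le> x then 1 else 0) + (cmod (f t))\<^sup>2)"
      by (intro Bochner_Integration.integrable_add one L2D(2)[OF f])
    have "a \<le> 1 + a\<^sup>2" for a :: real
      using zero_le_power2[of "a - 1/2"] by (simp add: power2_eq_square algebra_simps)
    then show "AE t in half_line. norm (if t \<le> x then f t else 0) \<le>
        norm ((if t \<le> x then 1 else 0) + (cmod (f t))\<^sup>2)"
      by (intro AE_I2) auto
  qed measurable
  from integrable_half_line_imp_Icc[OF this x]
  have "integrable (lebesgue_on {0..x}) (\<lambda>t. if t \<le> x then f t else 0)" .
  then show ?thesis
    by (subst Bochner_Integration.integrable_cong[OF refl, of _ _ "\<lambda>t. if t \<le> x then f t else 0"]) auto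
qed

text \<open>\<open>L2_integrable_Icc\<close> supplies the local integrability that
  \<open>ac_deriv\<close> asks for, through |f| \<le> 1 + |f|^2 on bounded intervals.\<close>

lemma has_weak_deriv_iff: "has_weak_deriv u g \<longleftrightarrow> g \<in> L2 \<and> ac_deriv u g"
  unfolding has_weak_deriv_def ac_deriv_def using L2_integrable_Icc by blast

subsection \<open>Uniqueness of weak derivatives\<close>

text \<open>Dynkin's argument with the rays {..a} as generator. Complements use that the total
  integral is 0, the limit of \<open>int\<close> for x tending to infinity; disjoint unions use
  dominated convergence.\<close>

lemma set_integral_eq_0_borel:
  fixes g :: "real \<Rightarrow> real"
  assumes g: "integrable half_line g"
    and int: "\<And>x. x \<ge> 0 \<Longrightarrow> (LINT t|lebesgue_on {0..x}. g t) = 0" and A: "A \<in> sets borel"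
  shows "(LINT t|half_line. indicator A t * g t) = 0"
proof -
  have [measurable]: "g \<in> borel_measurable half_line" using g by (rule borel_measurable_integrable)
  have sub: "B \<in> sets borel \<Longrightarrow> Measurable.pred half_line (\<lambda>t. t \<in> B)" for B
    using borel_measurable_ident_lebesgue_on[of "{0<..}"] by (auto intro: measurable_sets_borel)
  have i: "integrable half_line (\<lambda>t. indicator B t * g t)" if "B \<in> sets borel" for B
  proof (rule Bochner_Integration.integrable_bound[OF g])
    show "(\<lambda>t. indicator B t * g t) \<in> borel_measurable half_line"
      using sub[OF that] by measurable
  qed (auto simp: indicator_def)
  have total: "(LINT t|half_line. g t) = 0"
  proof -
    have "((\<lambda>x. LINT t|lebesgue_on {0..x}. complex_of_real (g t)) \<longlongrightarrow> (LINT t|half_line. complex_of_real (g t))) at_top"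
      using g by (intro integral_Icc_tendsto_half_line) simp
    moreover have "\<forall>\<^sub>F x in at_top. (LINT t|lebesgue_on {0..x}. complex_of_real (g t)) = 0"
      using eventually_ge_at_top[of 0] by eventually_elim (simp add: int)
    ultimately have "((\<lambda>x::real. 0) \<longlongrightarrow> (LINT t|half_line. complex_of_real (g t))) at_top"
      by (rule Lim_transform_eventually)
    then show ?thesis by (simp add: tendsto_const_iff)
  qed
  have "sets borel = sigma_sets UNIV (range (\<lambda>a::real. {..a}))"
    by (simp add: borel_eq_atMost)
  with A have gen: "A \<in> sigma_sets UNIV (range (\<lambda>a::real. {..a}))" by simp
  have stable: "Int_stable (range (\<lambda>a::real. {..a}))"
    by (auto simp: Int_stable_def)
  have pow: "range (\<lambda>a::real. {..a}) \<subseteq> Pow UNIV" by simp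
  from stable pow gen show ?thesis
  proof (induction A rule: sigma_sets_induct_disjoint)
    case (basic A)
    then obtain a where A: "A = {..a}" by auto
    show ?case
    proof (cases "a \<ge> 0")
      case True
      have "(LINT t|half_line. indicator A t * g t) = (LINT t|half_line. (if t \<le> a then g t else 0))"
        unfolding A by (rule Bochner_Integration.integral_cong) (auto simp: indicator_def)
      also have "\<dots> = 0" using integral_Icc_eq_half_line[OF g True] int[OF True] by simp
      finally show ?thesis .
    next
      case False
      then have "(LINT t|half_line. indicator A t * g t) = (LINT t|half_line. 0)"
        unfolding A by (intro Bochner_Integration.integral_cong) (auto simp: indicator_def)
      then show ?thesis by simp
    qed
  next
    case (compl A)
    then have A: "A \<in> sets borel" by (simp add: borel_eq_atMost)
    have "(LINT t|half_line. indicator (UNIV - A) t * g t) = (LINT t|half_line. g t - indicator A t * g t)"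
      by (rule Bochner_Integration.integral_cong) (auto simp: indicator_def)
    then show ?case using compl g i[OF A] total by simp
  next
    case (union A)
    then have A: "A n \<in> sets borel" for n by (auto simp: borel_eq_atMost)
    have "(\<lambda>n. \<Sum>k<n. (LINT t|half_line. indicator (A k) t * g t)) \<longlonglongrightarrow>
        (LINT t|half_line. indicator (\<Union>k. A k) t * g t)"
    proof -
      have "(\<lambda>n. LINT t|half_line. (\<Sum>k<n. indicator (A k) t * g t)) \<longlonglongrightarrow>
          (LINT t|half_line. indicator (\<Union>k. A k) t * g t)"
      proof (rule integral_dominated_convergence[where w="\<lambda>t. \<bar>g t\<bar>"])
        have part: "(\<Sum>k<n. indicator (A k) t) = (indicator (\<Union>k<n. A k) t :: real)" for n t
          using union(1) by (subst indicator_UN_disjoint) (auto simp: disjoint_family_on_def)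
        show "AE t in half_line. (\<lambda>n. \<Sum>k<n. indicator (A k) t * g t) \<longlonglongrightarrow> indicator (\<Union>k. A k) t * g t"
        proof (rule AE_I2)
          fix t
          have "(\<lambda>n. (indicator (\<Union>k<n. A k) t :: real)) \<longlonglongrightarrow> indicator (\<Union>k. A k) t"
            by (rule LIMSEQ_indicator_UN)
          then show "(\<lambda>n. \<Sum>k<n. indicator (A k) t * g t) \<longlonglongrightarrow> indicator (\<Union>k. A k) t * g t"
            unfolding sum_distrib_right[symmetric] part by (intro tendsto_intros)
        qed
        show "AE t in half_line. norm (\<Sum>k<n. indicator (A k) t * g t) \<le> \<bar>g t\<bar>" for n
          unfolding sum_distrib_right[symmetric] part by (auto simp: indicator_def)
        show "(\<lambda>t. \<Sum>k<n. indicator (A k) t * g t) \<in> borel_measurable half_line" for n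
          using i[OF A] by (intro borel_measurable_sum borel_measurable_integrable)
        show "(\<lambda>t. indicator (\<Union>k. A k) t * g t) \<in> borel_measurable half_line"
          using A by (intro borel_measurable_integrable i) auto
      qed (use g in auto)
      then show ?thesis using i[OF A] by (subst (asm) Bochner_Integration.integral_sum) auto
    qed
    then show ?case using union by (simp add: LIMSEQ_const_iff)
  qed auto
qed

text \<open>A function is determined almost everywhere by its integrals over measurable sets. The
  measurable sets here are Lebesgue sets, each a Borel set up to a null set, so the Borel case
  suffices.\<close>

lemma integral_Icc_eq_0_imp_AE_0_real:
  fixes g :: "real \<Rightarrow> real"
  assumes g: "integrable half_line g"
    and int: "\<And>x. x \<ge> 0 \<Longrightarrow> (LINT t|lebesgue_on {0..x}. g t) = 0"
  shows "AE x in half_line. g x = 0"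
proof (rule density_unique_real[OF g])
  fix A assume A: "A \<in> sets half_line"
  then have "A \<in> sets lebesgue" by (simp add: sets_restrict_space_iff)
  then obtain S N N' where AS: "A = S \<union> N" "N \<subseteq> N'" "N' \<in> null_sets lborel" "S \<in> sets lborel"
    by (rule sets_completionE)
  have "AE t in lebesgue. t \<notin> N'"
    using AS(3) by (intro AE_not_in null_sets_completionI)
  then have N': "AE t in half_line. t \<notin> N'"
    by (simp add: AE_restrict_space_iff) (auto elim: eventually_mono)
  have SM: "S \<inter> {0<..} \<in> sets half_line"
    using AS(4) by (auto simp: sets_restrict_space_iff)
  have iS: "integrable half_line (\<lambda>t. indicator S t * g t)"
  proof (rule Bochner_Integration.integrable_bound[OF g])
    have "(\<lambda>t. indicator (S \<inter> {0<..}) t * g t) \<in> borel_measurable half_line"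
      using SM borel_measurable_integrable[OF g] by measurable
    then show "(\<lambda>t. indicator S t * g t) \<in> borel_measurable half_line"
      by (subst measurable_cong[where g="\<lambda>t. indicator (S \<inter> {0<..}) t * g t"]) (auto simp: indicator_def)
  qed (auto simp: indicator_def)
  have "(LINT t|half_line. indicator A t * g t) = (LINT t|half_line. indicator S t * g t)"
  proof (rule integral_cong_AE)
    show "(\<lambda>t. indicator A t * g t) \<in> borel_measurable half_line"
      using A borel_measurable_integrable[OF g] by measurable
    show "(\<lambda>t. indicator S t * g t) \<in> borel_measurable half_line"
      by (rule borel_measurable_integrable[OF iS])
    show "AE t in half_line. indicator A t * g t = indicator S t * g t"
      using N' by eventually_elim (use AS in \<open>auto simp: indicator_def\<close>)
  qed
  also have "\<dots> = 0"
    using AS(4) by (intro set_integral_eq_0_borel[OF g int]) auto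
  finally show "(LINT t:A|half_line. g t) = (LINT t:A|half_line. 0)"
    by (simp add: set_lebesgue_integral_def)
qed simp

text \<open>Cut-offs at n reduce the locally integrable case to the integrable one, for real and
  imaginary part separately. It serves twice: for uniqueness of weak derivatives and for
  completeness of the orthonormal basis constructed later.\<close>

lemma integral_Icc_eq_0_imp_AE_0:
  fixes g :: "real \<Rightarrow> complex"
  assumes g: "\<And>x. x \<ge> 0 \<Longrightarrow> integrable (lebesgue_on {0..x}) g"
    and int: "\<And>x. x \<ge> 0 \<Longrightarrow> (LINT t|lebesgue_on {0..x}. g t) = 0"
  shows "AE x in half_line. g x = 0"
proof -
  have n: "AE x in half_line. x \<le> real n \<longrightarrow> g x = 0" for n
  proof -
    let ?h = "\<lambda>t. if t \<le> real n then g t else 0"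
    have h: "integrable half_line ?h"
      by (rule integrable_half_line_cutoff[OF g]) auto
    have hx: "(LINT t|lebesgue_on {0..x}. ?h t) = 0" if x: "x \<ge> 0" for x
    proof -
      have "(LINT t|lebesgue_on {0..x}. ?h t) = (LINT t|half_line. (if t \<le> x then ?h t else 0))"
        by (rule integral_Icc_eq_half_line[OF h x])
      also have "\<dots> = (LINT t|half_line. (if t \<le> min x (real n) then g t else 0))"
        by (rule Bochner_Integration.integral_cong) auto
      also have "\<dots> = 0"
        using x by (subst integral_half_line_cutoff) (auto intro!: g int)
      finally show ?thesis .
    qed
    have c: "complex_integrable (lebesgue_on {0..x}) ?h" if "x \<ge> 0" for x
      by (rule integrable_half_line_imp_Icc[OF h that])
    have "AE x in half_line. Re (?h x) = 0"
      using integral_Re[OF c] hx by (intro integral_Icc_eq_0_imp_AE_0_real integrable_Re h) simp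
    moreover have "AE x in half_line. Im (?h x) = 0"
      using integral_Im[OF c] hx by (intro integral_Icc_eq_0_imp_AE_0_real integrable_Im h) simp
    ultimately show ?thesis
      by eventually_elim (auto simp: complex_eq_iff split: if_splits)
  qed
  have "AE x in half_line. \<forall>n. x \<le> real n \<longrightarrow> g x = 0"
    unfolding AE_all_countable by (intro allI n)
  then show ?thesis
    by eventually_elim (use real_arch_simple in blast)
qed

lemma ac_deriv_unique_AE:
  assumes "ac_deriv F f" "ac_deriv F g"
  shows "AE x in half_line. f x = g x"
proof -
  have "AE x in half_line. f x - g x = 0"
  proof (rule integral_Icc_eq_0_imp_AE_0)
    fix x :: real assume x: "x \<ge> 0"
    note f = ac_derivD[OF assms(1) x] and g = ac_derivD[OF assms(2) x]
    show "integrable (lebesgue_on {0..x}) (\<lambda>x. f x - g x)" using f(1) g(1) by simp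
    show "(LINT t|lebesgue_on {0..x}. f t - g t) = 0"
      using f(1) g(1) f(2) g(2) by (simp only: Bochner_Integration.integral_diff) simp
  qed
  then show ?thesis by simp
qed

subsection \<open>Membership in \<open>H\<^sub>0\<close>\<close>

lemma weak_deriv_AE:
  assumes "has_weak_deriv u g"
  shows "weak_deriv u \<in> L2" "AE x in half_line. weak_deriv u x = g x"
proof -
  have "has_weak_deriv u (weak_deriv u)"
    using someI[of "has_weak_deriv u", OF assms] by (simp only: weak_deriv_def)
  then show "weak_deriv u \<in> L2" "AE x in half_line. weak_deriv u x = g x"
    using assms ac_deriv_unique_AE unfolding has_weak_deriv_iff by blast+
qed

text \<open>\<open>weak_deriv\<close> is an arbitrary choice, but any two weak derivatives agree
  almost everywhere, so the form may be computed with whichever is at hand.\<close>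

lemma robin_form_eq:
  assumes u: "has_weak_deriv u p" and v: "has_weak_deriv v q"
  shows "robin_form \<gamma> u v = l2_inner p q + of_real \<gamma> * u 0 * cnj (v 0)"
proof -
  have p: "p \<in> L2" and q: "q \<in> L2" using u v by (auto simp: has_weak_deriv_iff)
  note wu = weak_deriv_AE[OF u] and wv = weak_deriv_AE[OF v]
  have "l2_inner (weak_deriv u) (weak_deriv v) = l2_inner p (weak_deriv v)"
    by (rule l2_inner_cong_AE[OF L2D(1)[OF wu(1)] L2D(1)[OF p] L2D(1)[OF wv(1)] wu(2)])
  also have "\<dots> = cnj (l2_inner (weak_deriv v) p)" by (rule l2_inner_cnj[symmetric])
  also have "l2_inner (weak_deriv v) p = l2_inner q p"
    by (rule l2_inner_cong_AE[OF L2D(1)[OF wv(1)] L2D(1)[OF q] L2D(1)[OF p] wv(2)])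
  also have "cnj \<dots> = l2_inner p q" by (rule l2_inner_cnj)
  finally show ?thesis by (simp add: robin_form_def)
qed

text \<open>Integration by parts against v. The product of p and the conjugate of v has an
  integrable derivative, hence a limit at infinity, and since the product is itself integrable this
  limit is 0. At 0 the condition on \<open>p 0\<close> produces the boundary term of the
  form.\<close>

lemma H0I:
  assumes u: "u \<in> L2" "ac_deriv u p" and p: "p \<in> L2" "ac_deriv p (\<lambda>x. - h x)" "p 0 = of_real \<gamma> * u 0"
    and h: "h \<in> L2"
  shows "(u, h) \<in> H0 \<gamma>"
proof -
  have wu: "has_weak_deriv u p" using u p by (simp add: has_weak_deriv_iff)
  have "robin_form \<gamma> u v = l2_inner h v" if vH1: "v \<in> H1" for v
  proof -
    obtain q where wv: "has_weak_deriv v q" and v: "v \<in> L2" using vH1 unfolding H1_def by blast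
    then have q: "q \<in> L2" "ac_deriv v q" by (auto simp: has_weak_deriv_iff)
    have ac: "ac_deriv (\<lambda>x. p x * cnj (v x)) (\<lambda>x. - h x * cnj (v x) + p x * cnj (q x))"
      by (rule ac_deriv_mult[OF p(2) ac_deriv_cnj[OF q(2)]])
    have i1: "integrable half_line (\<lambda>x. h x * cnj (v x))" and i2: "integrable half_line (\<lambda>x. p x * cnj (q x))"
      and i3: "integrable half_line (\<lambda>x. p x * cnj (v x))"
      by (intro l2_inner_integrable h v p q)+
    let ?D = "\<lambda>x. - h x * cnj (v x) + p x * cnj (q x)"
    have D: "integrable half_line ?D" using i1 i2 by simp
    let ?L = "p 0 * cnj (v 0) + (LINT x|half_line. ?D x)"
    have "((\<lambda>X. p 0 * cnj (v 0) + (LINT t|lebesgue_on {0..X}. ?D t)) \<longlongrightarrow> ?L) at_top"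
      by (intro tendsto_add tendsto_const integral_Icc_tendsto_half_line D)
    moreover have "\<forall>\<^sub>F X in at_top. p 0 * cnj (v 0) + (LINT t|lebesgue_on {0..X}. ?D t) = p X * cnj (v X)"
      using eventually_ge_at_top[of 0] by eventually_elim (rule ac_derivD(2)[OF ac, symmetric])
    ultimately have "((\<lambda>X. p X * cnj (v X)) \<longlongrightarrow> ?L) at_top"
      by (rule Lim_transform_eventually)
    then have "?L = 0" by (rule limit_of_integrable_eq_0[OF i3])
    moreover have "(LINT x|half_line. ?D x) = - l2_inner h v + l2_inner p q"
      unfolding l2_inner_def using i1 i2 by simp
    ultimately have "of_real \<gamma> * u 0 * cnj (v 0) + (- l2_inner h v + l2_inner p q) = 0"
      by (simp only: p(3))
    then show ?thesis unfolding robin_form_eq[OF wu wv] by algebra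
  qed
  then show ?thesis using u h wu by (auto simp: H0_def H1_def)
qed

lemma H0_diff:
  assumes "(u, h) \<in> H0 \<gamma>" "(u', h') \<in> H0 \<gamma>"
  shows "(\<lambda>x. u x - u' x, \<lambda>x. h x - h' x) \<in> H0 \<gamma>"
proof -
  obtain p p' where p: "has_weak_deriv u p" and p': "has_weak_deriv u' p'"
    and L: "u \<in> L2" "h \<in> L2" "u' \<in> L2" "h' \<in> L2"
    and eq: "\<And>v. v \<in> H1 \<Longrightarrow> robin_form \<gamma> u v = l2_inner h v" "\<And>v. v \<in> H1 \<Longrightarrow> robin_form \<gamma> u' v = l2_inner h' v"
    using assms by (auto simp: H0_def H1_def)
  have d: "has_weak_deriv (\<lambda>x. u x - u' x) (\<lambda>x. p x - p' x)"
    using p p' ac_deriv_add[of u p "\<lambda>x. (-1) * u' x" "\<lambda>x. (-1) * p' x"] ac_deriv_scale[of u' p' "-1"]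
    by (auto simp: has_weak_deriv_iff L2_diff)
  have "robin_form \<gamma> (\<lambda>x. u x - u' x) v = l2_inner (\<lambda>x. h x - h' x) v" if vH1: "v \<in> H1" for v
  proof -
    obtain q where q: "has_weak_deriv v q" and v: "v \<in> L2" using vH1 unfolding H1_def by blast
    have pq: "p \<in> L2" "p' \<in> L2" "q \<in> L2" using p p' q by (auto simp: has_weak_deriv_iff)
    show ?thesis
      using eq[OF vH1] unfolding robin_form_eq[OF d q] robin_form_eq[OF p q] robin_form_eq[OF p' q]
      by (simp add: l2_inner_diff_left L v pq algebra_simps)
  qed
  then show ?thesis using L d by (auto simp: H0_def H1_def L2_diff)
qed

lemma resolvent_set_bound:
  assumes "z \<in> resolvent_set A"
  obtains C where "C \<ge> 0" "\<And>u h. (u, h) \<in> A \<Longrightarrow> l2_norm u \<le> C * l2_norm (\<lambda>x. h x - z * u x)"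
proof -
  obtain C where C: "\<forall>(u, h)\<in>A. l2_norm u \<le> C * l2_norm (\<lambda>x. h x - z * u x)"
    using assms by (auto simp: resolvent_set_def)
  show ?thesis
  proof (rule that[of "max C 0"])
    fix u h assume "(u, h) \<in> A"
    then have "l2_norm u \<le> C * l2_norm (\<lambda>x. h x - z * u x)" using C by auto
    also have "\<dots> \<le> max C 0 * l2_norm (\<lambda>x. h x - z * u x)" by (intro mult_right_mono) auto
    finally show "l2_norm u \<le> max C 0 * l2_norm (\<lambda>x. h x - z * u x)" .
  qed simp
qed

lemma resolvent_unique_AE:
  assumes z: "z \<in> resolvent_set (H0 \<gamma>)"
    and u: "(u, \<lambda>x. f x + z * u x) \<in> H0 \<gamma>" and u': "(u', \<lambda>x. f x + z * u' x) \<in> H0 \<gamma>"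
  shows "AE x in half_line. u x = u' x"
proof -
  obtain C where C: "\<And>u h. (u, h) \<in> H0 \<gamma> \<Longrightarrow> l2_norm u \<le> C * l2_norm (\<lambda>x. h x - z * u x)"
    using resolvent_set_bound[OF z] by metis
  have "l2_norm (\<lambda>x. u x - u' x) \<le> C * l2_norm (\<lambda>x. (f x + z * u x - (f x + z * u' x)) - z * (u x - u' x))"
    by (rule C[OF H0_diff[OF u u']])
  also have "(\<lambda>x. (f x + z * u x - (f x + z * u' x)) - z * (u x - u' x)) = (\<lambda>x. 0)"
    by (simp add: algebra_simps)
  also have "l2_norm (\<lambda>x. 0) = 0" by (simp add: l2_norm_def)
  finally have "l2_norm (\<lambda>x. u x - u' x) = 0" using l2_norm_nonneg[of "\<lambda>x. u x - u' x"] by simp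
  moreover have "(\<lambda>x. u x - u' x) \<in> L2"
    using u u' by (intro L2_diff) (auto simp: H0_def H1_def)
  ultimately show ?thesis by (simp add: l2_norm_eq_0_iff)
qed

subsection \<open>Exponentials\<close>

lemma
  assumes "a > 0"
  shows exp_integrable_half_line: "integrable half_line (\<lambda>x. exp (- a * x))"
    and exp_integral_half_line: "(LINT x|half_line. exp (- a * x)) = 1 / a"
proof -
  have hi: "((\<lambda>x. exp (- a * x)) has_integral exp (- a * 0) / a) {0..}"
    by (rule has_integral_exp_minus_to_infinity[OF assms])
  have n1: "negligible {x \<in> {0..} - {0<..}. exp (- a * x) \<noteq> (0::real)}"
    by (rule negligible_subset[of "{0}"]) auto
  have n2: "negligible {x \<in> {0<..} - {0..}. exp (- a * x) \<noteq> (0::real)}"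
    by (rule negligible_subset[of "{0}"]) auto
  have "((\<lambda>x. exp (- a * x)) has_integral exp (- a * 0) / a) {0<..}"
    by (rule iffD1[OF has_integral_spike_set_eq[OF n1 n2] hi])
  then have hi': "((\<lambda>x. exp (- a * x)) has_integral 1 / a) {0<..}" by simp
  have "(\<lambda>x. exp (- a * x)) absolutely_integrable_on {0<..}"
    by (rule nonnegative_absolutely_integrable_1) (use hi' in auto)
  then show i: "integrable half_line (\<lambda>x. exp (- a * x))"
    by (rule absolutely_integrable_imp_integrable) auto
  show "(LINT x|half_line. exp (- a * x)) = 1 / a"
    using lebesgue_integral_eq_integral[OF i] hi' by (simp add: integral_unique)
qed

lemma cmod_exp_power2: "(cmod (exp (\<mu> * of_real x)))\<^sup>2 = exp (- (- 2 * Re \<mu>) * x)"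
  by (simp add: power2_eq_square flip: exp_add)

lemma exp_L2:
  assumes "Re \<mu> < 0"
  shows "(\<lambda>x. exp (\<mu> * of_real x)) \<in> L2"
proof -
  have "integrable half_line (\<lambda>x. (cmod (exp (\<mu> * of_real x)))\<^sup>2)"
    unfolding cmod_exp_power2 by (rule exp_integrable_half_line) (use assms in simp)
  then show ?thesis
    using ac_deriv_measurable[OF ac_deriv_exp[of \<mu>]] unfolding L2_def by blast
qed

lemma l2_norm_exp: "Re \<mu> < 0 \<Longrightarrow> l2_norm (\<lambda>x. exp (\<mu> * of_real x)) = sqrt (1 / (- 2 * Re \<mu>))"
  unfolding l2_norm_def cmod_exp_power2 by (subst exp_integral_half_line) auto

subsection \<open>The spectrum\<close>

lemma exp_combination_H0:
  assumes "Re \<mu> < 0" "Re \<nu> < 0" "a * \<mu> + b * \<nu> = of_real \<gamma> * (a + b)"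
  shows "(\<lambda>x. a * exp (\<mu> * of_real x) + b * exp (\<nu> * of_real x),
    \<lambda>x. - (a * \<mu>\<^sup>2) * exp (\<mu> * of_real x) + - (b * \<nu>\<^sup>2) * exp (\<nu> * of_real x)) \<in> H0 \<gamma>"
proof (rule H0I)
  note E = exp_L2[OF assms(1)] exp_L2[OF assms(2)]
  let ?p = "\<lambda>x. (a * \<mu>) * exp (\<mu> * of_real x) + (b * \<nu>) * exp (\<nu> * of_real x)"
  show "(\<lambda>x. a * exp (\<mu> * of_real x) + b * exp (\<nu> * of_real x)) \<in> L2" "?p \<in> L2"
    "(\<lambda>x. - (a * \<mu>\<^sup>2) * exp (\<mu> * of_real x) + - (b * \<nu>\<^sup>2) * exp (\<nu> * of_real x)) \<in> L2"
    by (intro L2_add L2_scale E)+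
  show "ac_deriv (\<lambda>x. a * exp (\<mu> * of_real x) + b * exp (\<nu> * of_real x)) ?p"
    by (rule ac_deriv_cong[OF ac_deriv_add[OF ac_deriv_scale[OF ac_deriv_exp[of \<mu>], of a] ac_deriv_scale[OF ac_deriv_exp[of \<nu>], of b]]])
      (simp_all add: mult.assoc)
  show "ac_deriv ?p (\<lambda>x. - (- (a * \<mu>\<^sup>2) * exp (\<mu> * of_real x) + - (b * \<nu>\<^sup>2) * exp (\<nu> * of_real x)))"
    by (rule ac_deriv_cong[OF ac_deriv_add[OF ac_deriv_scale[OF ac_deriv_exp[of \<mu>], of "a * \<mu>"] ac_deriv_scale[OF ac_deriv_exp[of \<nu>], of "b * \<nu>"]]])
      (simp_all add: mult_ac power2_eq_square)
  show "?p 0 = of_real \<gamma> * (a * exp (\<mu> * of_real 0) + b * exp (\<nu> * of_real 0))"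
    using assms(3) by simp
qed

text \<open>A Weyl sequence: \<open>e\<^bsup>(ik-\<epsilon>)x\<^esup> + b e\<^bsup>-Lx\<^esup>\<close> with \<open>\<epsilon> \<rightarrow> 0\<close>, where \<open>b\<close> restores the boundary condition.\<close>

lemma nonneg_real_not_in_resolvent_set:
  assumes z: "of_real (k\<^sup>2) \<in> resolvent_set (H0 \<gamma>)"
  shows False
proof -
  obtain C where C0: "C \<ge> 0"
    and C: "\<And>u h. (u, h) \<in> H0 \<gamma> \<Longrightarrow> l2_norm u \<le> C * l2_norm (\<lambda>x. h x - of_real (k\<^sup>2) * u x)"
    using resolvent_set_bound[OF z] by metis
  \<comment> \<open>L + \<gamma> \<ge> 1 for either sign of \<gamma>, so the coefficient b below is
    bounded uniformly in \<epsilon>.\<close>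
  define L where "L = 1 + \<bar>\<gamma>\<bar>"
  have L: "L > 0" "L + \<gamma> \<ge> 1" by (auto simp: L_def)
  let ?E = "\<lambda>\<mu> x. exp (\<mu> * complex_of_real x)"
  define N where "N = l2_norm (?E (- of_real L))"
  define B where "B = \<bar>k\<bar> + 1 + \<bar>\<gamma>\<bar>"
  have B0: "B \<ge> 0" by (simp add: B_def)
  \<comment> \<open>The left side is the norm of exp((ik - \<epsilon>)x), which blows up. On that
    exponential H_0 - k^2 acts as multiplication by 2ik\<epsilon> - \<epsilon>^2, so its
    contribution on the right stays bounded, and so does that of the corrector.\<close>
  have main: "1 / sqrt (2 * \<epsilon>) \<le> B * N + C * ((2 * \<bar>k\<bar> + 1) + B * (L\<^sup>2 + k\<^sup>2) * N)" if \<epsilon>: "\<epsilon> > 0" "\<epsilon> \<le> 1/2" for \<epsilon>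
  proof -
    define \<mu> where "\<mu> = \<i> * of_real k - of_real \<epsilon>"
    define \<nu> :: complex where "\<nu> = - of_real L"
    define b where "b = (\<mu> - of_real \<gamma>) / of_real (L + \<gamma>)"
    have re: "Re \<mu> < 0" "Re \<nu> < 0" using \<epsilon> L by (auto simp: \<mu>_def \<nu>_def)
    have Lg: "complex_of_real (L + \<gamma>) \<noteq> 0" using L(2) by (simp only: of_real_eq_0_iff)
    have "b * of_real (L + \<gamma>) = \<mu> - of_real \<gamma>" using Lg by (simp add: b_def)
    then have bc: "1 * \<mu> + b * \<nu> = of_real \<gamma> * (1 + b)"
      by (simp add: \<nu>_def algebra_simps)
    have bB: "cmod b \<le> B"
    proof -
      have "cmod b = cmod (\<mu> - of_real \<gamma>) / (L + \<gamma>)"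
        using L(2) by (simp add: b_def norm_divide flip: of_real_add)
      also have "\<dots> \<le> cmod (\<mu> - of_real \<gamma>) / 1"
        using L(2) by (intro divide_left_mono) auto
      also have "\<dots> \<le> cmod (\<i> * of_real k) + cmod (of_real \<epsilon> :: complex) + cmod (of_real \<gamma> :: complex)"
        unfolding \<mu>_def by (metis (no_types, lifting) add.commute add_mono_thms_linordered_semiring(3) div_by_1 norm_triangle_ineq4 order_trans)
      also have "\<dots> \<le> B" using \<epsilon> by (simp add: B_def norm_mult)
      finally show ?thesis .
    qed
    let ?u = "\<lambda>x. 1 * ?E \<mu> x + b * ?E \<nu> x"
    let ?h = "\<lambda>x. - (1 * \<mu>\<^sup>2) * ?E \<mu> x + - (b * \<nu>\<^sup>2) * ?E \<nu> x"
    have uL: "?u \<in> L2" by (intro L2_add L2_scale exp_L2 re)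
    have ineq: "l2_norm ?u \<le> C * l2_norm (\<lambda>x. ?h x - of_real (k\<^sup>2) * ?u x)"
      by (rule C[OF exp_combination_H0[OF re bc]])
    have norm\<mu>: "l2_norm (?E \<mu>) = 1 / sqrt (2 * \<epsilon>)"
      using l2_norm_exp[OF re(1)] by (simp add: \<mu>_def real_sqrt_divide)
    have "l2_norm (?E \<mu>) \<le> l2_norm ?u + l2_norm (\<lambda>x. (- b) * ?E \<nu> x)"
      using l2_norm_triangle[OF uL L2_scale[OF exp_L2[OF re(2)], of "- b"]] by simp
    also have "l2_norm (\<lambda>x. (- b) * ?E \<nu> x) = cmod b * N"
      by (simp only: l2_norm_scale norm_minus_cancel N_def \<nu>_def)
    also have "l2_norm ?u \<le> C * l2_norm (\<lambda>x. ?h x - of_real (k\<^sup>2) * ?u x)" by (rule ineq)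
    also have "(\<lambda>x. ?h x - of_real (k\<^sup>2) * ?u x) =
        (\<lambda>x. (2 * \<i> * of_real k * of_real \<epsilon> - of_real (\<epsilon>\<^sup>2)) * ?E \<mu> x + (- b * of_real (L\<^sup>2 + k\<^sup>2)) * ?E \<nu> x)"
    proof
      fix x
      have "- (\<mu>\<^sup>2) - of_real (k\<^sup>2) = 2 * \<i> * of_real k * of_real \<epsilon> - of_real (\<epsilon>\<^sup>2)"
        by (simp add: \<mu>_def power2_eq_square algebra_simps)
      then have m: "- (\<mu>\<^sup>2) = 2 * \<i> * of_real k * of_real \<epsilon> - of_real (\<epsilon>\<^sup>2) + of_real (k\<^sup>2)"
        by (simp add: algebra_simps)
      have n: "\<nu>\<^sup>2 = of_real (L\<^sup>2)" by (simp add: \<nu>_def)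
      have "?h x - of_real (k\<^sup>2) * ?u x = (- (\<mu>\<^sup>2) - of_real (k\<^sup>2)) * ?E \<mu> x + (- b * (\<nu>\<^sup>2 + of_real (k\<^sup>2))) * ?E \<nu> x"
        by (simp add: algebra_simps)
      then show "?h x - of_real (k\<^sup>2) * ?u x =
        (2 * \<i> * of_real k * of_real \<epsilon> - of_real (\<epsilon>\<^sup>2)) * ?E \<mu> x + (- b * of_real (L\<^sup>2 + k\<^sup>2)) * ?E \<nu> x"
        unfolding m n by simp
    qed
    also have "l2_norm \<dots> \<le> l2_norm (\<lambda>x. (2 * \<i> * of_real k * of_real \<epsilon> - of_real (\<epsilon>\<^sup>2)) * ?E \<mu> x) +
        l2_norm (\<lambda>x. (- b * of_real (L\<^sup>2 + k\<^sup>2)) * ?E \<nu> x)"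
      by (intro l2_norm_triangle L2_scale exp_L2 re)
    also have "l2_norm (\<lambda>x. (- b * of_real (L\<^sup>2 + k\<^sup>2)) * ?E \<nu> x) = cmod b * (L\<^sup>2 + k\<^sup>2) * N"
      unfolding l2_norm_scale N_def \<nu>_def norm_mult norm_minus_cancel norm_of_real by simp
    also have "l2_norm (\<lambda>x. (2 * \<i> * of_real k * of_real \<epsilon> - of_real (\<epsilon>\<^sup>2)) * ?E \<mu> x) \<le> 2 * \<bar>k\<bar> + 1"
    proof -
      have "cmod (2 * \<i> * of_real k * of_real \<epsilon> - of_real (\<epsilon>\<^sup>2)) \<le>
          cmod (2 * \<i> * of_real k * of_real \<epsilon>) + cmod (of_real (\<epsilon>\<^sup>2) :: complex)" by (rule norm_triangle_ineq4)
      also have "\<dots> = (2 * \<bar>k\<bar> + \<epsilon>) * \<epsilon>"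
        using \<epsilon> unfolding norm_mult norm_of_real by (simp add: power2_eq_square algebra_simps)
      also have "\<dots> \<le> (2 * \<bar>k\<bar> + 1) * \<epsilon>" using \<epsilon> by (intro mult_right_mono) auto
      finally have le: "cmod (2 * \<i> * of_real k * of_real \<epsilon> - of_real (\<epsilon>\<^sup>2)) \<le> (2 * \<bar>k\<bar> + 1) * \<epsilon>" .
      have "2 * \<epsilon> \<le> 1" using \<epsilon> by simp
      have "\<epsilon> * (1 / sqrt (2 * \<epsilon>)) \<le> 1"
      proof -
        have "\<epsilon> * (1 / sqrt (2 * \<epsilon>)) = sqrt (2 * \<epsilon>) / 2"
          using \<epsilon> by (simp add: field_simps)
        also have "sqrt (2 * \<epsilon>) \<le> 1" using \<open>2 * \<epsilon> \<le> 1\<close> by simp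
        then have "sqrt (2 * \<epsilon>) / 2 \<le> 1" by linarith
        finally show ?thesis .
      qed
      then have "(2 * \<bar>k\<bar> + 1) * (\<epsilon> * (1 / sqrt (2 * \<epsilon>))) \<le> (2 * \<bar>k\<bar> + 1) * 1"
        by (intro mult_left_mono) auto
      moreover have "cmod (2 * \<i> * of_real k * of_real \<epsilon> - of_real (\<epsilon>\<^sup>2)) * (1 / sqrt (2 * \<epsilon>)) \<le>
          (2 * \<bar>k\<bar> + 1) * \<epsilon> * (1 / sqrt (2 * \<epsilon>))"
        using le \<epsilon> by (intro mult_right_mono) auto
      ultimately show ?thesis unfolding l2_norm_scale norm\<mu> by (simp only: mult.assoc mult_1_right)
    qed
    finally have "1 / sqrt (2 * \<epsilon>) \<le> C * (2 * \<bar>k\<bar> + 1 + cmod b * (L\<^sup>2 + k\<^sup>2) * N) + cmod b * N"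
      unfolding norm\<mu> using C0 by (simp add: mult_left_mono)
    also have "\<dots> \<le> C * (2 * \<bar>k\<bar> + 1 + B * (L\<^sup>2 + k\<^sup>2) * N) + B * N"
      using bB C0 by (intro add_mono mult_left_mono mult_right_mono order_refl) (auto simp: N_def)
    finally show ?thesis by simp
  qed
  define K where "K = B * N + C * ((2 * \<bar>k\<bar> + 1) + B * (L\<^sup>2 + k\<^sup>2) * N)"
  have K0: "K \<ge> 0"
    unfolding K_def using B0 C0 by (intro add_nonneg_nonneg mult_nonneg_nonneg) (auto simp: N_def)
  \<comment> \<open>Chosen so that 1/sqrt(2\<epsilon>) = K + 1, which exceeds the bound K.\<close>
  define \<epsilon> where "\<epsilon> = 1 / (2 * (K + 1)\<^sup>2)"
  have "(K + 1)\<^sup>2 \<ge> 1" using K0 by (simp add: power2_eq_square algebra_simps)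
  then have "\<epsilon> > 0" "\<epsilon> \<le> 1/2" by (auto simp: \<epsilon>_def divide_simps)
  from main[OF this] have "1 / sqrt (2 * \<epsilon>) \<le> K" by (simp only: K_def)
  moreover have "2 * \<epsilon> = 1 / (K + 1)\<^sup>2" by (simp add: \<epsilon>_def)
  then have "1 / sqrt (2 * \<epsilon>) = K + 1" using K0 by (simp add: real_sqrt_divide)
  ultimately show False by simp
qed

text \<open>For \<gamma> < 0 the function exp(\<gamma>x) is square integrable, satisfies the
  boundary condition and is an eigenfunction, so no lower bound can hold.\<close>

lemma eigenvalue_not_in_resolvent_set:
  assumes z: "- (of_real \<gamma>)\<^sup>2 \<in> resolvent_set (H0 \<gamma>)" and \<gamma>: "\<gamma> < 0"
  shows False
proof -
  obtain C where C: "\<And>u h. (u, h) \<in> H0 \<gamma> \<Longrightarrow> l2_norm u \<le> C * l2_norm (\<lambda>x. h x - (- (of_real \<gamma>)\<^sup>2) * u x)"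
    using resolvent_set_bound[OF z] by metis
  let ?g = "complex_of_real \<gamma>"
  let ?u = "\<lambda>x. 1 * exp (?g * complex_of_real x) + 0 * exp (?g * of_real x)"
  have re: "Re ?g < 0" using \<gamma> by simp
  have "l2_norm ?u \<le> C * l2_norm (\<lambda>x. (- (1 * ?g\<^sup>2) * exp (?g * of_real x) + - (0 * ?g\<^sup>2) * exp (?g * of_real x)) - (- ?g\<^sup>2) * ?u x)"
    by (rule C[OF exp_combination_H0[OF re re]]) simp
  then have "l2_norm (\<lambda>x. exp (?g * of_real x)) \<le> 0" by (simp add: l2_norm_def)
  then show False using l2_norm_exp[OF re] \<gamma> by (simp add: divide_simps split: if_splits)
qed

lemma upper_sqrt_props:
  assumes "z \<notin> of_real ` {0..}"
  shows "(upper_sqrt z)\<^sup>2 = z" "Im (upper_sqrt z) > 0"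
proof -
  have ex: "\<exists>\<zeta>. \<zeta>\<^sup>2 = z \<and> Im \<zeta> > 0"
  proof (cases "Im (csqrt z) = 0")
    case True
    then have "csqrt z = of_real (Re (csqrt z))" by (simp add: complex_eq_iff)
    then have "z = of_real ((Re (csqrt z))\<^sup>2)" by (metis of_real_power power2_csqrt)
    then show ?thesis using assms by (metis atLeast_iff imageI zero_le_power2)
  next
    case False
    define w where "w = csqrt z"
    have "w\<^sup>2 = z" "(- w)\<^sup>2 = z" by (simp_all add: w_def)
    moreover have "Im w \<noteq> 0" using False unfolding w_def .
    then have "Im w > 0 \<or> Im (- w) > 0" by (auto simp: not_less)
    ultimately show ?thesis by blast
  qed
  have uniq: "\<zeta> = \<zeta>'" if "\<zeta>\<^sup>2 = z \<and> Im \<zeta> > 0" "\<zeta>'\<^sup>2 = z \<and> Im \<zeta>' > 0" for \<zeta> \<zeta>'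
  proof -
    have "\<zeta>\<^sup>2 = \<zeta>'\<^sup>2" and im: "Im \<zeta> > 0" "Im \<zeta>' > 0" using that by simp_all
    then have "\<zeta> = \<zeta>' \<or> \<zeta> = - \<zeta>'" by (simp only: power2_eq_iff)
    moreover have "\<zeta> \<noteq> - \<zeta>'" using im by (metis uminus_complex.simps(2) neg_0_less_iff_less less_asym)
    ultimately show ?thesis by blast
  qed
  have "(upper_sqrt z)\<^sup>2 = z \<and> Im (upper_sqrt z) > 0"
    unfolding upper_sqrt_def by (rule theI'[OF ex_ex1I[OF ex uniq]])
  then show "(upper_sqrt z)\<^sup>2 = z" "Im (upper_sqrt z) > 0" by auto
qed

text \<open>Both exclusions from the resolvent set enter: z outside [0,\<infinity>) makes
  \<open>upper_sqrt\<close> well defined, and \<kappa> = \<gamma> would force \<gamma> < 0 and z =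
  -\<gamma>^2.\<close>

lemma resolvent_set_upper_sqrt:
  assumes z: "z \<in> resolvent_set (H0 \<gamma>)"
  defines "\<kappa> \<equiv> \<i> * upper_sqrt z"
  shows "Re \<kappa> < 0" "z = - \<kappa>\<^sup>2" "of_real \<gamma> - \<kappa> \<noteq> 0"
proof -
  have "z \<notin> of_real ` {0..}"
  proof
    assume "z \<in> of_real ` {0..}"
    then obtain r where r: "r \<ge> 0" "z = of_real r" by auto
    then have "z = of_real ((sqrt r)\<^sup>2)" by simp
    with z have "of_real ((sqrt r)\<^sup>2) \<in> resolvent_set (H0 \<gamma>)" by (simp only:)
    then show False by (rule nonneg_real_not_in_resolvent_set)
  qed
  note u = upper_sqrt_props[OF this]
  show "Re \<kappa> < 0" using u(2) by (simp add: \<kappa>_def)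
  show zk: "z = - \<kappa>\<^sup>2" using u(1) by (simp add: \<kappa>_def power_mult_distrib)
  show "of_real \<gamma> - \<kappa> \<noteq> 0"
  proof
    assume "of_real \<gamma> - \<kappa> = 0"
    then have k: "\<kappa> = of_real \<gamma>" by simp
    then have "\<gamma> < 0" using \<open>Re \<kappa> < 0\<close> by simp
    then show False using z eigenvalue_not_in_resolvent_set unfolding zk k by blast
  qed
qed

subsection \<open>The Green function\<close>

lemma L2I_bounded_Icc:
  fixes F :: "real \<Rightarrow> complex"
  assumes F: "continuous_on {0..} F"
    and le: "\<And>T. T \<ge> 0 \<Longrightarrow> (LINT t|lebesgue_on {0..T}. (cmod (F t))\<^sup>2) \<le> K"
  shows "F \<in> L2"
proof -
  have [measurable]: "F \<in> borel_measurable half_line"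
    by (rule continuous_imp_measurable_on_sets_lebesgue[OF continuous_on_subset[OF F]]) auto
  have i: "integrable (lebesgue_on {0..T}) (\<lambda>t. (cmod (F t))\<^sup>2)" for T
    by (rule continuous_imp_integrable_real) (intro continuous_intros continuous_on_subset[OF F], auto)
  have "(\<integral>\<^sup>+x. ennreal ((cmod (F x))\<^sup>2) \<partial>half_line) =
      (\<integral>\<^sup>+x. liminf (\<lambda>n. ennreal (if x \<le> real n then (cmod (F x))\<^sup>2 else 0)) \<partial>half_line)"
  proof (rule nn_integral_cong)
    fix x :: real
    have "\<forall>\<^sub>F n in sequentially. ennreal (if x \<le> real n then (cmod (F x))\<^sup>2 else 0) = ennreal ((cmod (F x))\<^sup>2)"
    proof -
      obtain n0 :: nat where "x \<le> real n0" using real_arch_simple by blast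
      then show ?thesis by (intro eventually_sequentiallyI[of n0]) auto
    qed
    then have "(\<lambda>n. ennreal (if x \<le> real n then (cmod (F x))\<^sup>2 else 0)) \<longlonglongrightarrow> ennreal ((cmod (F x))\<^sup>2)"
      by (rule tendsto_eventually)
    then show "ennreal ((cmod (F x))\<^sup>2) = liminf (\<lambda>n. ennreal (if x \<le> real n then (cmod (F x))\<^sup>2 else 0))"
      by (rule lim_imp_Liminf[OF trivial_limit_sequentially, symmetric])
  qed
  also have "\<dots> \<le> liminf (\<lambda>n. \<integral>\<^sup>+x. ennreal (if x \<le> real n then (cmod (F x))\<^sup>2 else 0) \<partial>half_line)"
    by (rule nn_integral_liminf) measurable
  also have "\<dots> \<le> ennreal K"
  proof (rule Liminf_le)
    show "\<forall>\<^sub>F n in sequentially. (\<integral>\<^sup>+x. ennreal (if x \<le> real n then (cmod (F x))\<^sup>2 else 0) \<partial>half_line) \<le> ennreal K"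
    proof (rule always_eventually, rule allI)
      fix n
      have "(\<integral>\<^sup>+x. ennreal (if x \<le> real n then (cmod (F x))\<^sup>2 else 0) \<partial>half_line) =
          ennreal (LINT x|half_line. (if x \<le> real n then (cmod (F x))\<^sup>2 else 0))"
        by (rule nn_integral_eq_integral[OF integrable_half_line_cutoff[OF i]]) auto
      also have "\<dots> \<le> ennreal K"
        unfolding integral_half_line_cutoff[OF i of_nat_0_le_iff] by (rule ennreal_leI[OF le]) simp
      finally show "(\<integral>\<^sup>+x. ennreal (if x \<le> real n then (cmod (F x))\<^sup>2 else 0) \<partial>half_line) \<le> ennreal K" .
    qed
  qed simp
  finally have fin: "(\<integral>\<^sup>+x. ennreal ((cmod (F x))\<^sup>2) \<partial>half_line) \<le> ennreal K" .
  have "integrable half_line (\<lambda>x. (cmod (F x))\<^sup>2)"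
  proof (rule integrableI_bounded)
    show "(\<integral>\<^sup>+x. ennreal (norm ((cmod (F x))\<^sup>2)) \<partial>half_line) < \<infinity>"
      using fin by (simp add: le_less_trans[OF _ ennreal_less_top])
  qed measurable
  then show ?thesis by (simp add: L2_def)
qed

text \<open>An energy estimate: integrate \<open>(\<bar>F\<bar>\<^sup>2)' = 2 Re \<mu> \<bar>F\<bar>\<^sup>2 + 2 Re (g F\<^sup>*)\<close>.\<close>

lemma ac_deriv_energy_L2:
  assumes F: "ac_deriv F (\<lambda>x. \<mu> * F x + g x)" and g: "g \<in> L2" and \<mu>: "Re \<mu> \<noteq> 0"
    and B: "\<And>x. Re \<mu> > 0 \<Longrightarrow> x \<ge> 0 \<Longrightarrow> cmod (F x) \<le> B"
  shows "F \<in> L2"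
proof (rule L2I_bounded_Icc)
  show cont: "continuous_on {0..} F" by (rule ac_deriv_continuous_on[OF F])
  define \<eta> where "\<eta> = \<bar>Re \<mu>\<bar>"
  define \<sigma> where "\<sigma> = sgn (Re \<mu>)"
  have \<eta>: "\<eta> > 0" using \<mu> by (simp add: \<eta>_def)
  have \<sigma>: "\<sigma> * Re \<mu> = \<eta>" "\<bar>\<sigma>\<bar> = 1" using \<mu> by (auto simp: \<sigma>_def \<eta>_def sgn_if)
  let ?D = "\<lambda>x. 2 * Re \<mu> * (cmod (F x))\<^sup>2 + 2 * Re (g x * cnj (F x))"
  have ac: "ac_deriv (\<lambda>x. of_real ((cmod (F x))\<^sup>2)) (\<lambda>x. of_real (?D x))"
  proof (rule ac_deriv_cong[OF ac_deriv_mult[OF F ac_deriv_cnj[OF F]]])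
    fix x :: real
    show FF: "F x * cnj (F x) = of_real ((cmod (F x))\<^sup>2)" by (rule complex_norm_square[symmetric])
    have "(\<mu> * F x + g x) * cnj (F x) + F x * cnj (\<mu> * F x + g x) =
        (\<mu> + cnj \<mu>) * of_real ((cmod (F x))\<^sup>2) + (g x * cnj (F x) + cnj (g x * cnj (F x)))"
      unfolding FF[symmetric] by (simp add: algebra_simps)
    also have "\<dots> = of_real (?D x)"
      by (simp only: complex_add_cnj of_real_add of_real_mult of_real_numeral)
    finally show "(\<mu> * F x + g x) * cnj (F x) + F x * cnj (\<mu> * F x + g x) = of_real (?D x)" .
  qed
  fix T :: real assume T: "T \<ge> 0"
  define K0 where "K0 = (if Re \<mu> > 0 then B\<^sup>2 else 0) + (cmod (F 0))\<^sup>2 + (l2_norm g)\<^sup>2 / \<eta>"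
  have iF: "integrable (lebesgue_on {0..T}) (\<lambda>t. (cmod (F t))\<^sup>2)"
    by (rule continuous_imp_integrable_real) (intro continuous_intros continuous_on_subset[OF cont], auto)
  have iD: "integrable (lebesgue_on {0..T}) ?D"
    using integrable_Re[OF ac_derivD(1)[OF ac T]] by simp
  have ig: "integrable (lebesgue_on {0..T}) (\<lambda>t. (cmod (g t))\<^sup>2)"
    by (rule integrable_half_line_imp_Icc[OF L2D(2)[OF g] T])
  have eq: "(LINT t|lebesgue_on {0..T}. ?D t) = (cmod (F T))\<^sup>2 - (cmod (F 0))\<^sup>2"
  proof -
    have "complex_of_real ((cmod (F T))\<^sup>2) = of_real ((cmod (F 0))\<^sup>2 + (LINT t|lebesgue_on {0..T}. ?D t))"
      by (subst of_real_add, subst integral_complex_of_real[symmetric]) (rule ac_derivD(2)[OF ac T])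
    then have "(cmod (F T))\<^sup>2 = (cmod (F 0))\<^sup>2 + (LINT t|lebesgue_on {0..T}. ?D t)"
      by (simp only: of_real_eq_iff)
    then show ?thesis by simp
  qed
  have gle: "(LINT t|lebesgue_on {0..T}. (cmod (g t))\<^sup>2) \<le> (l2_norm g)\<^sup>2"
    unfolding l2_norm_power2 integral_Icc_eq_half_line[OF L2D(2)[OF g] T]
    by (rule integral_mono[OF integrable_half_line_cutoff[OF ig T] L2D(2)[OF g]]) auto
  \<comment> \<open>Young's inequality for the mixed term. The factor \<sigma> makes the quadratic
    term positive for either sign of Re \<mu>.\<close>
  have pt: "\<eta> * (cmod (F t))\<^sup>2 \<le> \<sigma> * ?D t + (cmod (g t))\<^sup>2 / \<eta>" for t
  proof -
    have "\<bar>Re (g t * cnj (F t))\<bar> \<le> cmod (g t) * cmod (F t)"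
      using abs_Re_le_cmod[of "g t * cnj (F t)"] by (simp add: norm_mult)
    then have 1: "- (\<sigma> * Re (g t * cnj (F t))) \<le> cmod (g t) * cmod (F t)"
      using \<sigma>(2) by (metis abs_ge_minus_self abs_mult mult_1 order_trans)
    have "0 \<le> (\<eta> * cmod (F t) - cmod (g t))\<^sup>2 / \<eta>" using \<eta> by simp
    also have "\<dots> = \<eta> * (cmod (F t))\<^sup>2 - 2 * (cmod (g t) * cmod (F t)) + (cmod (g t))\<^sup>2 / \<eta>"
      using \<eta> by (simp add: power2_eq_square field_simps)
    finally have 2: "2 * (cmod (g t) * cmod (F t)) \<le> \<eta> * (cmod (F t))\<^sup>2 + (cmod (g t))\<^sup>2 / \<eta>" by simp
    have "\<sigma> * ?D t = 2 * (\<sigma> * Re \<mu>) * (cmod (F t))\<^sup>2 + 2 * (\<sigma> * Re (g t * cnj (F t)))"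
      by (simp only: distrib_left mult_ac)
    then have "\<sigma> * ?D t = 2 * \<eta> * (cmod (F t))\<^sup>2 + 2 * (\<sigma> * Re (g t * cnj (F t)))"
      by (simp only: \<sigma>(1))
    then show ?thesis using 1 2 by linarith
  qed
  have "\<eta> * (LINT t|lebesgue_on {0..T}. (cmod (F t))\<^sup>2) = (LINT t|lebesgue_on {0..T}. \<eta> * (cmod (F t))\<^sup>2)"
    by simp
  also have "\<dots> \<le> (LINT t|lebesgue_on {0..T}. \<sigma> * ?D t + (cmod (g t))\<^sup>2 / \<eta>)"
    by (rule integral_mono) (use iF iD ig pt in \<open>simp_all only: integrable_mult_right Bochner_Integration.integrable_add integrable_divide\<close>)
  also have "\<dots> = \<sigma> * (LINT t|lebesgue_on {0..T}. ?D t) + (LINT t|lebesgue_on {0..T}. (cmod (g t))\<^sup>2) / \<eta>"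
    by (subst Bochner_Integration.integral_add)
      (use iD ig in \<open>simp_all only: integrable_mult_right integrable_divide integral_mult_right_zero integral_divide_zero\<close>)
  also have "\<dots> \<le> K0"
  proof -
    \<comment> \<open>For Re \<mu> > 0 the term |F(T)|^2 survives with a plus sign and is controlled
      by the assumed bound B; for Re \<mu> < 0 it has the favourable sign and is dropped.\<close>
    have "\<sigma> * (LINT t|lebesgue_on {0..T}. ?D t) \<le> (if Re \<mu> > 0 then B\<^sup>2 else 0) + (cmod (F 0))\<^sup>2"
    proof (cases "Re \<mu> > 0")
      case True
      then show ?thesis
        using power_mono[OF B[OF True T] norm_ge_zero, of 2] unfolding eq by (simp add: \<sigma>_def add.commute add_increasing2)
    next
      case False
      then show ?thesis using \<mu> unfolding eq by (simp add: \<sigma>_def sgn_if)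
    qed
    moreover have "(LINT t|lebesgue_on {0..T}. (cmod (g t))\<^sup>2) / \<eta> \<le> (l2_norm g)\<^sup>2 / \<eta>"
      using gle \<eta> by (simp add: divide_right_mono)
    ultimately show ?thesis unfolding K0_def by linarith
  qed
  finally show "(LINT t|lebesgue_on {0..T}. (cmod (F t))\<^sup>2) \<le> ((if Re \<mu> > 0 then B\<^sup>2 else 0) + (cmod (F 0))\<^sup>2 + (l2_norm g)\<^sup>2 / \<eta>) / \<eta>"
    using \<eta> unfolding K0_def by (simp add: field_simps)
qed

text \<open>The integral kernel of the resolvent at \<open>z = \<zeta>\<^sup>2\<close>, where \<open>\<kappa> = i\<zeta>\<close> and \<open>c = 1 / (\<gamma> - i\<zeta>)\<close>.\<close>

definition green :: "complex \<Rightarrow> complex \<Rightarrow> real \<Rightarrow> real \<Rightarrow> complex" where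
  "green \<kappa> c x y = exp (\<kappa> * of_real x) * exp (\<kappa> * of_real y) *
     (c + (1 - exp (- (2 * \<kappa>) * of_real (min x y))) / (2 * \<kappa>))"

lemma cut_exp_L2:
  assumes \<kappa>: "Re \<kappa> < 0" and x: "x \<ge> 0"
  shows "(\<lambda>t. if x < t then exp (\<kappa> * of_real (t - x)) else 0) \<in> L2"
proof (rule L2_bound[OF exp_L2[OF \<kappa>]])
  show "(\<lambda>t. if x < t then exp (\<kappa> * of_real (t - x)) else 0) \<in> borel_measurable half_line"
    by measurable
  show "AE t in half_line. cmod (if x < t then exp (\<kappa> * of_real (t - x)) else 0) \<le>
      exp (- Re \<kappa> * x) * cmod (exp (\<kappa> * of_real t))"
    by (intro AE_I2) (auto simp flip: exp_add simp: algebra_simps)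
qed

text \<open>By translation this is the norm of exp(\<kappa>t), whatever x is; a tail integral
  replaces the change of variables. Uniformity in x gives the pointwise bound on \<beta> in
  \<open>H0_green\<close>.\<close>

lemma cut_exp_norm_le:
  assumes \<kappa>: "Re \<kappa> < 0" and x: "x \<ge> 0"
  shows "l2_norm (\<lambda>t. if x < t then exp (\<kappa> * of_real (t - x)) else 0) \<le> sqrt (1 / (- 2 * Re \<kappa>))"
proof -
  let ?\<kappa> = "complex_of_real (2 * Re \<kappa>)"
  have i: "integrable half_line (\<lambda>t. - (?\<kappa> * exp (?\<kappa> * of_real t)))"
  proof -
    have "integrable half_line (\<lambda>t. complex_of_real (exp (- (- 2 * Re \<kappa>) * t)))"
      using exp_integrable_half_line[of "- 2 * Re \<kappa>"] \<kappa> by (intro integrable_of_real) auto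
    then have "integrable half_line (\<lambda>t. exp (?\<kappa> * of_real t))"
      by (simp add: exp_of_real[symmetric])
    then show ?thesis by simp
  qed
  have lim: "((\<lambda>t. exp (?\<kappa> * of_real t)) \<longlongrightarrow> 0) at_top"
  proof (rule tendsto_norm_zero_cancel)
    have "((\<lambda>t. exp (2 * Re \<kappa> * t)) \<longlongrightarrow> 0) at_top"
      using \<kappa> by (intro filterlim_compose[OF exp_at_bot] filterlim_tendsto_neg_mult_at_bot[OF tendsto_const _ filterlim_ident]) auto
    then show "((\<lambda>t. norm (exp (?\<kappa> * complex_of_real t))) \<longlongrightarrow> 0) at_top" by simp
  qed
  have i': "integrable half_line (\<lambda>t. ?\<kappa> * exp (?\<kappa> * of_real t))" using i by simp
  have "exp (?\<kappa> * of_real x) = 0 - tail_integral (\<lambda>t. ?\<kappa> * exp (?\<kappa> * of_real t)) x"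
    by (rule ac_deriv_eq_tail_integral[OF ac_deriv_exp i' lim x])
  also have "tail_integral (\<lambda>t. ?\<kappa> * exp (?\<kappa> * of_real t)) x =
      (LINT t|half_line. complex_of_real (2 * Re \<kappa> * exp (2 * Re \<kappa> * x) *
        (cmod (if x < t then exp (\<kappa> * of_real (t - x)) else 0))\<^sup>2))"
    unfolding tail_integral_def
  proof (rule Bochner_Integration.integral_cong[OF refl])
    fix t
    have "exp (2 * Re \<kappa> * x) * (cmod (exp (\<kappa> * of_real (t - x))))\<^sup>2 = exp (2 * Re \<kappa> * t)"
      unfolding cmod_exp_power2 by (simp flip: exp_add add: algebra_simps)
    then have 1: "2 * Re \<kappa> * exp (2 * Re \<kappa> * x) * (cmod (exp (\<kappa> * of_real (t - x))))\<^sup>2 = 2 * Re \<kappa> * exp (2 * Re \<kappa> * t)"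
      by (simp only: mult.assoc)
    have 2: "exp (?\<kappa> * of_real t) = of_real (exp (2 * Re \<kappa> * t))"
      by (simp add: exp_of_real[symmetric])
    show "(if x < t then ?\<kappa> * exp (?\<kappa> * of_real t) else 0) = complex_of_real (2 * Re \<kappa> * exp (2 * Re \<kappa> * x) *
        (cmod (if x < t then exp (\<kappa> * of_real (t - x)) else 0))\<^sup>2)"
    proof (cases "x < t")
      case True
      show ?thesis unfolding if_P[OF True] 1 2 by (simp only: of_real_mult)
    qed simp
  qed
  also have "\<dots> = of_real (2 * Re \<kappa> * exp (2 * Re \<kappa> * x) *
      (l2_norm (\<lambda>t. if x < t then exp (\<kappa> * of_real (t - x)) else 0))\<^sup>2)"
    by (simp only: integral_complex_of_real integral_mult_right_zero l2_norm_power2)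
  also have "exp (?\<kappa> * of_real x) = complex_of_real (exp (2 * Re \<kappa> * x))"
    by (simp add: exp_of_real[symmetric])
  finally have "exp (2 * Re \<kappa> * x) = - (2 * Re \<kappa> * exp (2 * Re \<kappa> * x) *
      (l2_norm (\<lambda>t. if x < t then exp (\<kappa> * of_real (t - x)) else 0))\<^sup>2)"
    by (simp only: diff_0 flip: of_real_minus) (simp only: of_real_eq_iff)
  then have "(l2_norm (\<lambda>t. if x < t then exp (\<kappa> * of_real (t - x)) else 0))\<^sup>2 = 1 / (- 2 * Re \<kappa>)"
  proof -
    have *: "n = 1 / (- 2 * k)" if "k < 0" "e = - (2 * k * e * n)" "e > 0" for e k n :: real
    proof -
      have "e * (1 + 2 * k * n) = 0" using that(2) by (simp add: algebra_simps)
      then have "1 + 2 * k * n = 0" using that(3) by simp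
      then show ?thesis using that(1) by (simp add: field_simps)
    qed
    show ?thesis by (rule *[OF \<kappa> \<open>exp (2 * Re \<kappa> * x) = _\<close>]) simp
  qed
  then show ?thesis by (metis l2_norm_nonneg real_sqrt_unique order_refl)
qed

text \<open>The second-order equation is factored into \<beta>' = -\<kappa>\<beta> - f, solved from
  infinity, and v' = \<kappa>v + \<beta>, solved from 0 with v(0) = c \<beta>(0) to meet the
  boundary condition. The energy estimate places \<beta> and v in \<open>L2\<close>; v is then
  identified with the Green integral.\<close>

lemma H0_green:
  assumes \<kappa>: "Re \<kappa> < 0" and w: "of_real \<gamma> - \<kappa> \<noteq> 0" and f: "f \<in> L2"
  defines "u \<equiv> \<lambda>x. LINT y|half_line. green \<kappa> (1 / (of_real \<gamma> - \<kappa>)) x y * f y"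
  shows "(u, \<lambda>x. f x + (- \<kappa>\<^sup>2) * u x) \<in> H0 \<gamma>"
proof -
  define c where "c = 1 / (of_real \<gamma> - \<kappa>)"
  have k0: "\<kappa> \<noteq> 0" using \<kappa> by auto
  let ?e = "\<lambda>x. exp (\<kappa> * complex_of_real x)" and ?n = "\<lambda>x. exp (- \<kappa> * complex_of_real x)"
  have en: "?n x * ?e x = 1" for x by (simp flip: exp_add)
  have ef: "integrable half_line (\<lambda>t. ?e t * f t)" by (intro L2_mult_integrable exp_L2 \<kappa> f)
  define b where "b = tail_integral (\<lambda>t. ?e t * f t)"
  have b: "ac_deriv b (\<lambda>t. - (?e t * f t))" unfolding b_def by (rule ac_deriv_tail_integral[OF ef])
  define \<beta> where "\<beta> x = ?n x * b x" for x
  have \<beta>: "ac_deriv \<beta> (\<lambda>x. (- \<kappa>) * \<beta> x + - f x)"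
  proof (rule ac_deriv_cong[OF ac_deriv_mult[OF ac_deriv_exp[of "- \<kappa>"] b]])
    fix x
    have "?n x * (?e x * f x) = (?n x * ?e x) * f x" by (simp only: mult.assoc)
    then show "- \<kappa> * ?n x * b x + ?n x * - (?e x * f x) = (- \<kappa>) * \<beta> x + - f x"
      by (simp only: en) (simp add: \<beta>_def)
  qed (simp add: \<beta>_def)
  have \<beta>_bound: "cmod (\<beta> x) \<le> sqrt (1 / (- 2 * Re \<kappa>)) * l2_norm (\<lambda>x. cnj (f x))" if x: "x \<ge> 0" for x
  proof -
    have "\<beta> x = (LINT t|half_line. ?n x * (if x < t then ?e t * f t else 0))"
      by (simp add: \<beta>_def b_def tail_integral_def)
    also have "\<dots> = l2_inner (\<lambda>t. if x < t then exp (\<kappa> * of_real (t - x)) else 0) (\<lambda>x. cnj (f x))"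
      unfolding l2_inner_def
      by (rule Bochner_Integration.integral_cong) (auto simp: algebra_simps exp_diff exp_minus field_simps)
    finally show ?thesis
      using l2_inner_abs_le[OF cut_exp_L2[OF \<kappa> x] L2_cnj[OF f]] cut_exp_norm_le[OF \<kappa> x]
      by (simp add: mult_right_mono order_trans)
  qed
  \<comment> \<open>Here the coefficient -\<kappa> has positive real part, the case of the energy
    estimate that consumes a pointwise bound.\<close>
  have \<beta>_L2: "\<beta> \<in> L2"
    by (rule ac_deriv_energy_L2[OF \<beta> _ _ \<beta>_bound]) (use \<kappa> L2_scale[OF f, of "-1"] in auto)
  define I where "I x = (LINT t|lebesgue_on {0..x}. ?n t * \<beta> t)" for x
  have I: "ac_deriv I (\<lambda>t. ?n t * \<beta> t)"
    unfolding ac_deriv_def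
  proof (intro allI impI conjI)
    fix x :: real assume "x \<ge> 0"
    show "integrable (lebesgue_on {0..x}) (\<lambda>t. ?n t * \<beta> t)"
      by (rule continuous_imp_integrable_real)
        (intro continuous_intros continuous_on_subset[OF ac_deriv_continuous_on[OF \<beta>]], auto)
    have "I 0 = 0" unfolding I_def by (rule integral_eq_zero_null_sets) simp
    then show "I x = I 0 + (LINT t|lebesgue_on {0..x}. ?n t * \<beta> t)" by (simp add: I_def)
  qed
  define v where "v x = ?e x * (c * b 0 + I x)" for x
  have v: "ac_deriv v (\<lambda>x. \<kappa> * v x + \<beta> x)"
  proof (rule ac_deriv_cong[OF ac_deriv_mult[OF ac_deriv_exp[of \<kappa>] ac_deriv_add[OF ac_deriv_const[of "c * b 0"] I]]])
    fix x
    have "?e x * (?n x * \<beta> x) = (?n x * ?e x) * \<beta> x" by (simp only: mult_ac)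
    then show "\<kappa> * ?e x * (c * b 0 + I x) + ?e x * (0 + ?n x * \<beta> x) = \<kappa> * v x + \<beta> x"
      by (simp only: en add_0) (simp add: v_def)
  qed (simp add: v_def)
  have v_L2: "v \<in> L2"
    by (rule ac_deriv_energy_L2[OF v \<beta>_L2]) (use \<kappa> in auto)
  define p where "p x = \<kappa> * v x + \<beta> x" for x
  have p: "ac_deriv p (\<lambda>x. - (f x + (- \<kappa>\<^sup>2) * v x))"
    by (rule ac_deriv_cong[OF ac_deriv_add[OF ac_deriv_scale[OF v] \<beta>]])
      (simp_all add: p_def algebra_simps power2_eq_square)
  \<comment> \<open>The primitive of exp(-2\<kappa>t) vanishing at 0. Integrating \<open>I\<close>
    by parts with it produces the dependence of the Green function on min(x,y).\<close>
  define E where "E t = (1 - exp (- (2 * \<kappa>) * of_real t)) / (2 * \<kappa>)" for t :: real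
  have E: "ac_deriv E (\<lambda>t. exp (- (2 * \<kappa>) * of_real t))"
    by (rule ac_deriv_cong[OF ac_deriv_add[OF ac_deriv_const[of "1 / (2 * \<kappa>)"]
            ac_deriv_scale[OF ac_deriv_exp[of "- (2 * \<kappa>)"], of "- 1 / (2 * \<kappa>)"]]])
      (use k0 in \<open>simp_all add: E_def diff_divide_distrib\<close>)
  have u_eq: "u x = v x" if x: "x \<ge> 0" for x
  proof -
    have iE: "integrable (lebesgue_on {0..x}) (\<lambda>t. E t * (?e t * f t))"
    proof -
      have "integrable (lebesgue_on {0..x}) (\<lambda>t. exp (- (2 * \<kappa>) * of_real t) * b t + E t * - (?e t * f t))"
        by (rule ac_derivD(1)[OF ac_deriv_mult[OF E b] x])
      moreover have "integrable (lebesgue_on {0..x}) (\<lambda>t. exp (- (2 * \<kappa>) * of_real t) * b t)"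
        by (rule continuous_imp_integrable_real)
          (intro continuous_intros continuous_on_subset[OF ac_deriv_continuous_on[OF b]], auto)
      ultimately have "integrable (lebesgue_on {0..x}) (\<lambda>t. exp (- (2 * \<kappa>) * of_real t) * b t -
          (exp (- (2 * \<kappa>) * of_real t) * b t + E t * - (?e t * f t)))"
        by (intro Bochner_Integration.integrable_diff)
      then show ?thesis by simp
    qed
    have nb: "?n t * \<beta> t = exp (- (2 * \<kappa>) * of_real t) * b t" for t
    proof -
      have "?n t * ?n t = exp (- (2 * \<kappa>) * of_real t)" by (simp flip: exp_add add: algebra_simps)
      then show ?thesis by (simp add: \<beta>_def mult.assoc[symmetric])
    qed
    have "E x * b x = E 0 * b 0 + (LINT t|lebesgue_on {0..x}. exp (- (2 * \<kappa>) * of_real t) * b t + E t * - (?e t * f t))"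
      by (rule ac_derivD(2)[OF ac_deriv_mult[OF E b] x])
    also have "\<dots> = (LINT t|lebesgue_on {0..x}. ?n t * \<beta> t - E t * (?e t * f t))"
      unfolding nb by (simp add: E_def)
    also have "\<dots> = I x - (LINT t|lebesgue_on {0..x}. E t * (?e t * f t))"
      using ac_derivD(1)[OF I x] iE unfolding I_def by (rule Bochner_Integration.integral_diff)
    finally have Ix: "I x = E x * b x + (LINT t|lebesgue_on {0..x}. E t * (?e t * f t))" by simp
    have cut: "integrable half_line (\<lambda>t. if x < t then ?e t * f t else 0)"
      by (rule integrable_if[OF ef]) simp
    have b0: "b 0 = (LINT t|half_line. ?e t * f t)"
      unfolding b_def tail_integral_def by (rule Bochner_Integration.integral_cong) auto
    have "v x = ?e x * (c * (LINT t|half_line. ?e t * f t) + (E x * (LINT t|half_line. (if x < t then ?e t * f t else 0)) +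
        (LINT t|half_line. (if t \<le> x then E t * (?e t * f t) else 0))))"
      unfolding v_def Ix b0 integral_half_line_cutoff[OF iE x] by (simp add: b_def tail_integral_def)
    also have "\<dots> = (LINT t|half_line. ?e x * (c * (?e t * f t) + (E x * (if x < t then ?e t * f t else 0) +
        (if t \<le> x then E t * (?e t * f t) else 0))))"
      using ef cut integrable_half_line_cutoff[OF iE x] by simp
    also have "\<dots> = u x"
      unfolding u_def
    proof (rule Bochner_Integration.integral_cong[OF refl])
      fix t
      show "?e x * (c * (?e t * f t) + (E x * (if x < t then ?e t * f t else 0) +
        (if t \<le> x then E t * (?e t * f t) else 0))) = green \<kappa> (1 / (of_real \<gamma> - \<kappa>)) x t * f t"
        by (cases "x < t") (simp_all add: green_def c_def[symmetric] E_def min_def algebra_simps)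
    qed
    finally show ?thesis by simp
  qed
  have u_L2: "u \<in> L2"
    by (rule L2_cong_AE[OF v_L2]) (auto intro!: AE_I2 simp: u_eq L2D(1)[OF v_L2] cong: measurable_cong_simp,
        use measurable_cong[of half_line u v] u_eq L2D(1)[OF v_L2] in auto)
  show ?thesis
  proof (rule H0I)
    show "ac_deriv u p" by (rule ac_deriv_cong[OF v]) (simp_all add: u_eq p_def)
    show "ac_deriv p (\<lambda>x. - (f x + (- \<kappa>\<^sup>2) * u x))" by (rule ac_deriv_cong[OF p]) (simp_all add: u_eq)
    show "p \<in> L2" unfolding p_def by (intro L2_add L2_scale v_L2 \<beta>_L2)
    show "(\<lambda>x. f x + (- \<kappa>\<^sup>2) * u x) \<in> L2" by (intro L2_add L2_scale u_L2 f)
    have "I 0 = 0" using ac_derivD(2)[OF I, of 0] by (simp add: I_def)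
    then show "p 0 = of_real \<gamma> * u 0"
      unfolding p_def using w by (simp add: u_eq v_def \<beta>_def c_def divide_simps) (simp add: algebra_simps)
  qed (rule u_L2)
qed

section \<open>Existence of an orthonormal basis\<close>

function gram_schmidt :: "(nat \<Rightarrow> real \<Rightarrow> complex) \<Rightarrow> nat \<Rightarrow> real \<Rightarrow> complex" where
  "gram_schmidt v n = (\<lambda>x. 1 / of_real (l2_norm (\<lambda>x. v n x - (\<Sum>k<n. l2_inner (v n) (gram_schmidt v k) * gram_schmidt v k x))) *
    (v n x - (\<Sum>k<n. l2_inner (v n) (gram_schmidt v k) * gram_schmidt v k x)))"
  by auto
termination by (relation "Wellfounded.measure snd") auto

declare gram_schmidt.simps [simp del]

text \<open>The induction also records that the n-th new vector is a combination of v_0, ..., v_n.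
  Hence each remainder is v_n minus a combination of earlier v_k, and \<open>indep\<close> keeps its
  norm nonzero. Conversely v_n is recovered from the new vectors, which gives the second
  claim.\<close>

lemma gram_schmidt_orthonormal:
  fixes v :: "nat \<Rightarrow> real \<Rightarrow> complex"
  assumes v: "\<And>n. v n \<in> L2"
    and indep: "\<And>n b. l2_norm (\<lambda>x. v n x - (\<Sum>k<n. b k * v k x)) \<noteq> 0"
  shows "orthonormal (gram_schmidt v)"
    and "\<And>u n. u \<in> L2 \<Longrightarrow> (\<And>k. l2_inner u (gram_schmidt v k) = 0) \<Longrightarrow> l2_inner u (v n) = 0"
proof -
  define e where "e = gram_schmidt v"
  define R where "R n x = v n x - (\<Sum>k<n. l2_inner (v n) (e k) * e k x)" for n x
  have e_eq: "e n = (\<lambda>x. 1 / of_real (l2_norm (R n)) * R n x)" for n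
    unfolding e_def R_def[abs_def] by (subst gram_schmidt.simps) simp
  have main: "e n \<in> L2 \<and> (\<exists>a. \<forall>x. e n x = (\<Sum>k\<le>n. a k * v k x)) \<and> l2_norm (R n) \<noteq> 0 \<and>
      l2_inner (e n) (e n) = 1 \<and> (\<forall>j<n. l2_inner (e n) (e j) = 0)" for n
  proof (induction n rule: less_induct)
    case (less n)
    have eL: "e k \<in> L2" if "k < n" for k using less[OF that] by blast
    have delta: "l2_inner (e k) (e j) = (if k = j then 1 else 0)" if "k < n" "j < n" for k j
    proof -
      consider "k = j" | "j < k" | "k < j" by linarith
      then show ?thesis
      proof cases
        case 3
        then have "l2_inner (e j) (e k) = 0" using less[OF that(2)] by blast
        then have "l2_inner (e k) (e j) = 0" using l2_inner_cnj[of "e j" "e k"] by simp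
        then show ?thesis using 3 by simp
      qed (use less[OF that(1)] in auto)
    qed
    let ?c = "\<lambda>k. l2_inner (v n) (e k)"
    have RL: "R n \<in> L2"
      unfolding R_def[abs_def] by (intro L2_diff L2_sum L2_scale v eL) simp
    have Rj: "l2_inner (R n) (e j) = 0" if j: "j < n" for j
    proof -
      have "l2_inner (R n) (e j) = ?c j - l2_inner (\<lambda>x. \<Sum>k<n. ?c k * e k x) (e j)"
        unfolding R_def[abs_def] by (intro l2_inner_diff_left L2_sum L2_scale v eL j) simp
      also have "l2_inner (\<lambda>x. \<Sum>k<n. ?c k * e k x) (e j) = (\<Sum>k<n. ?c k * l2_inner (e k) (e j))"
        by (subst l2_inner_sum_left) (auto intro!: L2_scale eL j simp: l2_inner_scale_left)
      also have "\<dots> = (\<Sum>k<n. if k = j then ?c j else 0)"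
        by (rule sum.cong) (auto simp: delta j)
      also have "\<dots> = ?c j" using j by simp
      finally show ?thesis by simp
    qed
    have "\<exists>A. \<forall>k<n. \<forall>x. e k x = (\<Sum>i\<le>k. A k i * v i x)"
    proof -
      have "\<forall>k. \<exists>a. k < n \<longrightarrow> (\<forall>x. e k x = (\<Sum>i\<le>k. a i * v i x))" using less by blast
      then have "\<exists>A. \<forall>k. k < n \<longrightarrow> (\<forall>x. e k x = (\<Sum>i\<le>k. A k i * v i x))" by (rule choice)
      then show ?thesis by blast
    qed
    then obtain A where A: "\<And>k x. k < n \<Longrightarrow> e k x = (\<Sum>i\<le>k. A k i * v i x)" by blast
    define b where "b i = (\<Sum>k<n. if i \<le> k then ?c k * A k i else 0)" for i
    have Rb: "R n x = v n x - (\<Sum>i<n. b i * v i x)" for x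
    proof -
      have "(\<Sum>k<n. ?c k * e k x) = (\<Sum>k<n. \<Sum>i<n. if i \<le> k then ?c k * A k i * v i x else 0)"
      proof (rule sum.cong[OF refl])
        fix k assume "k \<in> {..<n}"
        then have k: "k < n" by simp
        have "{..<n} \<inter> {i. i \<le> k} = {..k}" using k by auto
        then have "(\<Sum>i<n. if i \<le> k then ?c k * A k i * v i x else 0) = (\<Sum>i\<le>k. ?c k * A k i * v i x)"
          by (simp add: sum.If_cases)
        then show "?c k * e k x = (\<Sum>i<n. if i \<le> k then ?c k * A k i * v i x else 0)"
          by (simp add: A[OF k] sum_distrib_left mult.assoc)
      qed
      also have "\<dots> = (\<Sum>i<n. \<Sum>k<n. if i \<le> k then ?c k * A k i * v i x else 0)"
        by (rule sum.swap)
      also have "\<dots> = (\<Sum>i<n. b i * v i x)"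
        unfolding b_def sum_distrib_right by (intro sum.cong refl) auto
      finally show ?thesis by (simp add: R_def)
    qed
    have N: "l2_norm (R n) \<noteq> 0"
      using indep[of n b] unfolding Rb[abs_def] by simp
    have en: "e n \<in> L2" unfolding e_eq[of n] by (rule L2_scale[OF RL])
    have scale: "l2_inner (e n) f = 1 / of_real (l2_norm (R n)) * l2_inner (R n) f" for f
      by (subst e_eq) (rule l2_inner_scale_left)
    have "l2_inner (R n) (e n) = cnj (1 / of_real (l2_norm (R n)) * l2_inner (R n) (R n))"
      using scale[of "R n"] l2_inner_cnj[of "e n" "R n"] by simp
    also have "\<dots> = of_real (l2_norm (R n))"
      unfolding l2_inner_self using N by (simp add: power2_eq_square)
    finally have "l2_inner (e n) (e n) = 1"
      using scale[of "e n"] N by simp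
    moreover have "\<forall>j<n. l2_inner (e n) (e j) = 0"
      unfolding scale using Rj by simp
    moreover have "\<exists>a. \<forall>x. e n x = (\<Sum>k\<le>n. a k * v k x)"
    proof (intro exI allI)
      fix x
      let ?N = "1 / complex_of_real (l2_norm (R n))"
      have "(\<Sum>k\<le>n. (if k = n then ?N else - (?N * b k)) * v k x) = ?N * v n x + (\<Sum>k<n. - (?N * b k) * v k x)"
        by (simp add: lessThan_Suc_atMost[symmetric])
      also have "(\<Sum>k<n. - (?N * b k) * v k x) = - (?N * (\<Sum>k<n. b k * v k x))"
        by (simp only: sum_distrib_left sum_negf mult.assoc mult_minus_left)
      also have "?N * v n x + - (?N * (\<Sum>k<n. b k * v k x)) = ?N * R n x"
        unfolding Rb[of x] by (simp only: right_diff_distrib add_uminus_conv_diff)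
      also have "\<dots> = e n x" by (simp only: e_eq[of n])
      finally show "e n x = (\<Sum>k\<le>n. (if k = n then ?N else - (?N * b k)) * v k x)" by simp
    qed
    ultimately show ?case using en N by blast
  qed
  have on: "orthonormal e"
    unfolding orthonormal_def
  proof (intro conjI allI)
    show "e n \<in> L2" for n using main by blast
    fix m n :: nat
    consider "m = n" | "n < m" | "m < n" by linarith
    then show "l2_inner (e m) (e n) = (if m = n then 1 else 0)"
    proof cases
      case 3
      then have "l2_inner (e n) (e m) = 0" using main by blast
      then have "l2_inner (e m) (e n) = 0" using l2_inner_cnj[of "e n" "e m"] by simp
      then show ?thesis using 3 by simp
    qed (use main in auto)
  qed
  then show "orthonormal (gram_schmidt v)" by (simp add: e_def)
  fix u n assume u: "u \<in> L2" and perp: "\<And>k. l2_inner u (gram_schmidt v k) = 0"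
  have ek: "l2_inner (e k) u = 0" for k
    using perp[of k] l2_inner_cnj[of u "e k"] by (simp add: e_def)
  have N: "l2_norm (R n) \<noteq> 0" and eL: "e k \<in> L2" for k using main by blast+
  have "v n = (\<lambda>x. of_real (l2_norm (R n)) * e n x + (\<Sum>k<n. l2_inner (v n) (e k) * e k x))"
    unfolding e_eq[of n] using N by (simp add: R_def)
  then have "l2_inner (v n) u = l2_inner (\<lambda>x. of_real (l2_norm (R n)) * e n x + (\<Sum>k<n. l2_inner (v n) (e k) * e k x)) u"
    by (rule arg_cong)
  also have "\<dots> = l2_inner (\<lambda>x. of_real (l2_norm (R n)) * e n x) u + l2_inner (\<lambda>x. \<Sum>k<n. l2_inner (v n) (e k) * e k x) u"
    by (intro l2_inner_add_left L2_sum L2_scale eL u)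
  also have "\<dots> = 0"
    by (subst l2_inner_sum_left) (auto intro!: L2_scale eL u simp: l2_inner_scale_left ek)
  finally show "l2_inner u (v n) = 0" using l2_inner_cnj[of "v n" u] by simp
qed

lemma AE_half_line_ex:
  assumes "AE x in half_line. P x" "0 \<le> a" "a < b"
  shows "\<exists>x. a < x \<and> x < b \<and> P x"
proof (rule ccontr)
  assume "\<not> ?thesis"
  then have "AE x in half_line. \<not> (a < x \<and> x < b)"
    using assms(1) by (auto elim!: eventually_mono)
  then have "emeasure half_line {x \<in> space half_line. a < x \<and> x < b} = 0"
    by (rule emeasure_eq_0_AE)
  also have "{x \<in> space half_line. a < x \<and> x < b} = {a<..<b}" using assms(2) by auto
  also have "emeasure half_line {a<..<b} = emeasure lebesgue {a<..<b}"
    by (rule emeasure_restrict_space) (use assms(2) in auto)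
  also have "\<dots> = ennreal (b - a)" using assms(3) by simp
  finally show False using assms(3) by simp
qed

lemma cutoff_L2:
  assumes "r \<ge> 0"
  shows "(\<lambda>x. if x \<le> r then 1 else (0::complex)) \<in> L2"
proof -
  have "integrable half_line (\<lambda>t. if t \<le> r then (1::real) else 0)"
    by (rule integrable_half_line_cutoff[OF continuous_imp_integrable_real]) (use assms in auto)
  moreover have "(\<lambda>t. (cmod (if t \<le> r then 1 else 0))\<^sup>2) = (\<lambda>t. if t \<le> r then (1::real) else 0)"
    by auto
  moreover have "(\<lambda>x. if x \<le> r then 1 else (0::complex)) \<in> borel_measurable half_line" by measurable
  ultimately show ?thesis by (simp add: L2_def)
qed

text \<open>Gram-Schmidt applied to the indicators of (0,r], r a positive rational. A vector
  orthogonal to all of them has zero integral over (0,r] for rational r, then over [0,x] for every x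
  by continuity, and therefore vanishes almost everywhere.\<close>

lemma orthonormal_basis_exists: "\<exists>e. orthonormal_basis e"
proof -
  define S where "S = \<rat> \<inter> {0<..} - {0::real}"
  have "countable S" unfolding S_def by (intro countable_Diff countable_Int1 countable_rat)
  moreover have "infinite S"
  proof
    assume "finite S"
    moreover have "(\<lambda>n. real (Suc n)) ` UNIV \<subseteq> S" by (auto simp: S_def)
    ultimately have "finite ((\<lambda>n. real (Suc n)) ` UNIV)" by (rule finite_subset[rotated])
    then have "finite (UNIV :: nat set)" by (rule finite_imageD) (auto simp: inj_def)
    then show False by simp
  qed
  ultimately have bij: "bij_betw (from_nat_into S) UNIV S" by (rule bij_betw_from_nat_into)
  define r where "r = from_nat_into S"
  have r_inj: "r m = r n \<longleftrightarrow> m = n" for m n using bij by (auto simp: r_def bij_betw_def inj_def)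
  have r_range: "range r = S" using bij by (simp add: r_def bij_betw_def)
  have r_pos: "r n > 0" for n using r_range by (auto simp: S_def)
  define v :: "nat \<Rightarrow> real \<Rightarrow> complex" where "v n x = (if x \<le> r n then 1 else 0)" for n x
  have v: "v n \<in> L2" for n
    unfolding v_def[abs_def] by (rule cutoff_L2) (use r_pos[of n] in simp)
  have indep: "l2_norm (\<lambda>x. v n x - (\<Sum>k<n. b k * v k x)) \<noteq> 0" for n b
  proof
    assume "l2_norm (\<lambda>x. v n x - (\<Sum>k<n. b k * v k x)) = 0"
    moreover have "(\<lambda>x. v n x - (\<Sum>k<n. b k * v k x)) \<in> L2"
      by (intro L2_diff L2_sum L2_scale v)
    ultimately have AE: "AE x in half_line. v n x - (\<Sum>k<n. b k * v k x) = 0"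
      by (simp add: l2_norm_eq_0_iff)
    \<comment> \<open>Within distance d of \<open>r n\<close> none of the earlier indicators jumps,
      so their combination is constant there while \<open>v n\<close> drops from 1 to 0. Including 0
      keeps the interval inside the half-line.\<close>
    obtain d where d: "d > 0" "\<forall>x\<in>insert 0 (r ` {..<n}). x \<noteq> r n \<longrightarrow> d \<le> dist (r n) x"
      using finite_set_avoid[of "insert 0 (r ` {..<n})" "r n"] by auto
    have d0: "d \<le> r n" using d(2) r_pos[of n] by (auto simp: dist_real_def)
    have dk: "d \<le> \<bar>r n - r k\<bar>" if "k < n" for k
      using d(2) r_inj[of k n] that by (auto simp: dist_real_def)
    define c where "c = (\<Sum>k<n. b k * (if r n < r k then 1 else 0))"
    have near: "(\<Sum>k<n. b k * v k x) = c" if "\<bar>x - r n\<bar> < d" for x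
      unfolding c_def
    proof (rule sum.cong[OF refl])
      fix k assume "k \<in> {..<n}"
      then have "d \<le> \<bar>r n - r k\<bar>" using dk by simp
      then have "x \<le> r k \<longleftrightarrow> r n < r k" using that \<open>d > 0\<close> by (cases "r n < r k") auto
      then show "b k * v k x = b k * (if r n < r k then 1 else 0)" by (simp add: v_def)
    qed
    obtain x where x: "r n - d < x" "x < r n" "v n x - (\<Sum>k<n. b k * v k x) = 0"
      using AE_half_line_ex[OF AE, of "r n - d" "r n"] d0 d(1) by auto
    obtain y where y: "r n < y" "y < r n + d" "v n y - (\<Sum>k<n. b k * v k y) = 0"
      using AE_half_line_ex[OF AE, of "r n" "r n + d"] r_pos[of n] d(1) by auto
    have "v n x = c" "v n y = c" using x y near[of x] near[of y] by auto
    moreover have "v n x = 1" "v n y = 0" using x y by (auto simp: v_def)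
    ultimately show False by simp
  qed
  let ?e = "gram_schmidt v"
  have on: "orthonormal ?e" by (rule gram_schmidt_orthonormal(1)[OF v indep])
  have "AE x in half_line. u x = 0" if u: "u \<in> L2" and perp: "\<And>k. l2_inner u (?e k) = 0" for u
  proof (rule integral_Icc_eq_0_imp_AE_0[OF L2_integrable_Icc[OF u]])
    let ?F = "\<lambda>x. LINT t|lebesgue_on {0..x}. u t"
    have rat: "?F q = 0" if q: "q \<in> S" for q
    proof -
      have "q \<in> range r" using q r_range by simp
      then obtain n where n: "q = r n" by blast
      have "0 = l2_inner u (v n)" by (rule gram_schmidt_orthonormal(2)[OF v indep u perp, symmetric])
      also have "\<dots> = (LINT t|half_line. (if t \<le> q then u t else 0))"
        unfolding l2_inner_def by (rule Bochner_Integration.integral_cong) (auto simp: v_def n)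
      also have "\<dots> = ?F q"
        by (rule integral_half_line_cutoff[OF L2_integrable_Icc[OF u]]) (use r_pos[of n] n in auto)
      finally show ?thesis by simp
    qed
    fix x :: real assume x: "x \<ge> 0"
    have cont: "continuous_on {0..x+1} ?F"
      by (rule indefinite_integral_continuous_real[OF L2_integrable_Icc[OF u]]) (use x in simp)
    have "\<forall>n. \<exists>q. q \<in> \<rat> \<and> x < q \<and> q < x + 1 / real (Suc n)"
      using Rats_dense_in_real[of x] by (metis less_add_same_cancel1 of_nat_0_less_iff zero_less_Suc zero_less_divide_1_iff)
    then obtain q where q: "\<And>n. q n \<in> \<rat>" "\<And>n. x < q n" "\<And>n. q n < x + 1 / real (Suc n)"
      by metis
    have qS: "q n \<in> S" for n using q(1,2)[of n] x by (auto simp: S_def)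
    have "q \<longlonglongrightarrow> x"
    proof (rule real_tendsto_sandwich[of "\<lambda>_. x" _ _ "\<lambda>n. x + 1 / real (Suc n)"])
      show "(\<lambda>n. x + 1 / real (Suc n)) \<longlonglongrightarrow> x"
        using tendsto_add[OF tendsto_const[of x] LIMSEQ_inverse_real_of_nat] by (simp add: inverse_eq_divide)
    qed (use q in \<open>auto intro!: always_eventually less_imp_le\<close>)
    moreover have "q n \<in> {0..x+1}" for n
    proof -
      have "1 / real (Suc n) \<le> 1" by simp
      then have "q n \<le> x + 1" using q(3)[of n] by linarith
      then show ?thesis using q(2)[of n] x by simp
    qed
    ultimately have "(\<lambda>n. ?F (q n)) \<longlonglongrightarrow> ?F x"
      using continuous_on_tendsto_compose[OF cont, of q x sequentially] x by auto
    then show "?F x = 0" by (simp add: rat[OF qS] LIMSEQ_const_iff)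
  qed
  then have "orthonormal_basis ?e"
    using on unfolding orthonormal_basis_def orthonormal_def by blast
  then show ?thesis by blast
qed

section \<open>The Birman--Schwinger operator\<close>

interpretation half_line: sigma_finite_measure half_line
  by (rule sigma_finite_lebesgue_on) simp

lemma green_measurable_pair [measurable]:
  "(\<lambda>p. green \<kappa> c (fst p) (snd p)) \<in> borel_measurable (half_line \<Otimes>\<^sub>M half_line)"
proof -
  have [measurable]: "(\<lambda>p. fst p) \<in> borel_measurable (half_line \<Otimes>\<^sub>M half_line)"
    "(\<lambda>p. snd p) \<in> borel_measurable (half_line \<Otimes>\<^sub>M half_line)"
    by (rule measurable_compose[OF measurable_fst borel_measurable_ident_lebesgue_on],
        rule measurable_compose[OF measurable_snd borel_measurable_ident_lebesgue_on])
  show ?thesis unfolding green_def min_def by measurable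
qed

lemma green_measurable [measurable]: "green \<kappa> c x \<in> borel_measurable half_line"
  unfolding green_def[abs_def] min_def by measurable

text \<open>Multiplied out, every exponent is \<kappa> times x + y or x + y - 2 min(x,y) = |x - y|,
  both nonnegative. The growing factor exp(-2\<kappa> min(x,y)) is thereby absorbed.\<close>

lemma green_bound:
  assumes \<kappa>: "Re \<kappa> < 0" and x: "x \<ge> 0" "y \<ge> 0"
  shows "cmod (green \<kappa> c x y) \<le> cmod c + 1 / cmod \<kappa>"
proof -
  have k0: "\<kappa> \<noteq> 0" using \<kappa> by auto
  let ?a = "exp (\<kappa> * of_real (x + y))" and ?b = "exp (\<kappa> * of_real (x + y - 2 * min x y))"
  have a: "cmod ?a \<le> 1" by (rule norm_exp_le_1) (use \<kappa> x in auto)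
  have b: "cmod ?b \<le> 1" by (rule norm_exp_le_1) (use \<kappa> x in \<open>auto simp: min_def\<close>)
  have "exp (\<kappa> * of_real x) * exp (\<kappa> * of_real y) = ?a" by (simp flip: exp_add add: algebra_simps)
  moreover have "?a * exp (- (2 * \<kappa>) * of_real (min x y)) = ?b"
    by (simp flip: exp_add add: algebra_simps)
  ultimately have eq: "green \<kappa> c x y = c * ?a + (?a - ?b) / (2 * \<kappa>)"
    unfolding green_def using k0 by (simp add: algebra_simps diff_divide_distrib)
  have "cmod (green \<kappa> c x y) \<le> cmod (c * ?a) + cmod ((?a - ?b) / (2 * \<kappa>))"
    unfolding eq by (rule norm_triangle_ineq)
  also have "cmod (c * ?a) \<le> cmod c" unfolding norm_mult using a by (intro mult_left_le) auto
  also have "cmod ((?a - ?b) / (2 * \<kappa>)) \<le> (1 + 1) / (2 * cmod \<kappa>)"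
    unfolding norm_divide norm_mult norm_numeral
    by (rule divide_right_mono[OF order_trans[OF norm_triangle_ineq4 add_mono[OF a b]]]) simp
  finally show ?thesis by simp
qed

definition half_exp :: "complex \<Rightarrow> real \<Rightarrow> real \<Rightarrow> complex" where
  "half_exp \<kappa> x t = (if t < x then exp (\<kappa> * of_real (x - t)) else 0)"

lemma half_exp_measurable_pair [measurable]:
  "(\<lambda>p. half_exp \<kappa> (fst p) (snd p)) \<in> borel_measurable (half_line \<Otimes>\<^sub>M half_line)"
proof -
  have [measurable]: "(\<lambda>p. fst p) \<in> borel_measurable (half_line \<Otimes>\<^sub>M half_line)"
    "(\<lambda>p. snd p) \<in> borel_measurable (half_line \<Otimes>\<^sub>M half_line)"
    by (rule measurable_compose[OF measurable_fst borel_measurable_ident_lebesgue_on],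
        rule measurable_compose[OF measurable_snd borel_measurable_ident_lebesgue_on])
  show ?thesis unfolding half_exp_def by measurable
qed

lemma half_exp_L2:
  assumes \<kappa>: "Re \<kappa> < 0" and x: "x \<ge> 0"
  shows "half_exp \<kappa> x \<in> L2"
proof (rule L2_bound[OF cutoff_L2[OF x]])
  show "half_exp \<kappa> x \<in> borel_measurable half_line" unfolding half_exp_def[abs_def] by measurable
  show "AE t in half_line. cmod (half_exp \<kappa> x t) \<le> 1 * cmod (if t \<le> x then 1 else 0)"
    using norm_exp_le_1[of \<kappa> "x - _"] \<kappa> by (intro AE_I2) (auto simp: half_exp_def)
qed

text \<open>Two exponents are kept apart because both cases occur: \<mu> = \<nu> = \<kappa> gives
  the Green function, while \<mu> = \<kappa> with \<nu> its conjugate gives a squared norm.\<close>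

lemma integral_half_exp:
  assumes "\<mu> + \<nu> \<noteq> 0" and x: "x \<ge> 0" "y \<ge> 0"
  shows "(LINT t|half_line. half_exp \<mu> x t * half_exp \<nu> y t) =
    exp (\<mu> * of_real x) * exp (\<nu> * of_real y) * ((1 - exp (- (\<mu> + \<nu>) * of_real (min x y))) / (\<mu> + \<nu>))"
proof -
  let ?m = "min x y" and ?l = "- (\<mu> + \<nu>)"
  let ?c = "exp (\<mu> * of_real x) * exp (\<nu> * of_real y) / ?l"
  have m: "?m \<ge> 0" using x by simp
  note E = ac_derivD[OF ac_deriv_exp[of ?l] m]
  have "(LINT t|half_line. half_exp \<mu> x t * half_exp \<nu> y t) =
      (LINT t|half_line. ?c * (if t \<le> ?m then ?l * exp (?l * of_real t) else 0))"
  proof (rule integral_cong_AE)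
    show "AE t in half_line. half_exp \<mu> x t * half_exp \<nu> y t =
        ?c * (if t \<le> ?m then ?l * exp (?l * of_real t) else 0)"
    proof (rule eventually_mono[OF AE_lebesgue_on_neq[of "{0<..}" ?m]])
      show "{0<..} \<in> sets (lebesgue :: real measure)" by simp
      fix t assume t: "t \<noteq> ?m"
      show "half_exp \<mu> x t * half_exp \<nu> y t = ?c * (if t \<le> ?m then ?l * exp (?l * of_real t) else 0)"
      proof (cases "t < ?m")
        case True
        have "exp (\<mu> * of_real (x - t)) * exp (\<nu> * of_real (y - t)) =
            exp (\<mu> * of_real x) * exp (\<nu> * of_real y) * exp (?l * of_real t)"
          by (simp flip: exp_add add: algebra_simps)
        moreover have "?l \<noteq> 0" using assms(1) by (metis neg_equal_0_iff_equal)
        ultimately show ?thesis using True by (simp add: half_exp_def)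
      next
        case False
        then show ?thesis using t by (auto simp: half_exp_def)
      qed
    qed
    show "(\<lambda>t. half_exp \<mu> x t * half_exp \<nu> y t) \<in> borel_measurable half_line"
      unfolding half_exp_def by measurable
  qed measurable
  also have "\<dots> = ?c * (LINT t|half_line. (if t \<le> ?m then ?l * exp (?l * of_real t) else 0))"
    by (rule integral_mult_right_zero)
  also have "(LINT t|half_line. (if t \<le> ?m then ?l * exp (?l * of_real t) else 0)) = exp (?l * of_real ?m) - 1"
    unfolding integral_half_line_cutoff[OF E(1) m] using E(2) by simp
  also have "?c * (exp (?l * of_real ?m) - 1) =
      exp (\<mu> * of_real x) * exp (\<nu> * of_real y) * ((1 - exp (?l * of_real ?m)) / (\<mu> + \<nu>))"
  proof -
    have "e / (- s) * (g - 1) = e * ((1 - g) / s)" for e s g :: complex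
      by (simp add: minus_divide_right[symmetric] algebra_simps diff_divide_distrib)
    then show ?thesis .
  qed
  finally show ?thesis .
qed

text \<open>The kernel is complex symmetric rather than Hermitian; the conjugate in the second slot
  cancels the one in \<open>l2_inner\<close> and leaves the bilinear integral.\<close>

lemma green_eq_inner:
  assumes \<kappa>: "Re \<kappa> < 0" and x: "x \<ge> 0" "y \<ge> 0"
  shows "green \<kappa> c x y = c * exp (\<kappa> * of_real x) * exp (\<kappa> * of_real y) +
    l2_inner (half_exp \<kappa> x) (\<lambda>t. cnj (half_exp \<kappa> y t))"
proof -
  have "\<kappa> + \<kappa> \<noteq> 0" using \<kappa> by auto
  then show ?thesis
    using integral_half_exp[of \<kappa> \<kappa> x y] x by (simp add: green_def l2_inner_def algebra_simps)
qed

lemma half_exp_norm_le: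
  assumes \<kappa>: "Re \<kappa> < 0" and x: "x \<ge> 0"
  shows "(l2_norm (half_exp \<kappa> x))\<^sup>2 \<le> 1 / (- 2 * Re \<kappa>)"
proof -
  have s: "\<kappa> + cnj \<kappa> = of_real (2 * Re \<kappa>)" by (rule complex_add_cnj)
  have s0: "\<kappa> + cnj \<kappa> \<noteq> 0" unfolding s using \<kappa> by simp
  have "complex_of_real ((l2_norm (half_exp \<kappa> x))\<^sup>2) = (LINT t|half_line. half_exp \<kappa> x t * half_exp (cnj \<kappa>) x t)"
    unfolding l2_inner_self[symmetric] l2_inner_def
    by (rule Bochner_Integration.integral_cong) (auto simp: half_exp_def exp_cnj)
  also have "\<dots> = exp (\<kappa> * of_real x) * exp (cnj \<kappa> * of_real x) * ((1 - exp (- (\<kappa> + cnj \<kappa>) * of_real (min x x))) / (\<kappa> + cnj \<kappa>))"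
    by (rule integral_half_exp[OF s0 x x])
  also have "\<dots> = (exp ((\<kappa> + cnj \<kappa>) * of_real x) - 1) / (\<kappa> + cnj \<kappa>)"
  proof -
    have "exp (\<kappa> * of_real x) * exp (cnj \<kappa> * of_real x) = exp ((\<kappa> + cnj \<kappa>) * of_real x)"
      by (simp flip: exp_add add: algebra_simps)
    moreover have "exp ((\<kappa> + cnj \<kappa>) * of_real x) * exp (- (\<kappa> + cnj \<kappa>) * of_real x) = 1"
      by (simp only: minus_mult_left[symmetric] exp_minus_inverse)
    ultimately show ?thesis by (simp add: algebra_simps diff_divide_distrib)
  qed
  also have "\<dots> = complex_of_real ((exp (2 * Re \<kappa> * x) - 1) / (2 * Re \<kappa>))"
    unfolding s by (simp add: exp_of_real[symmetric])
  finally have "(l2_norm (half_exp \<kappa> x))\<^sup>2 = (exp (2 * Re \<kappa> * x) - 1) / (2 * Re \<kappa>)"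
    by (simp only: of_real_eq_iff)
  also have "\<dots> = (1 - exp (2 * Re \<kappa> * x)) / (- 2 * Re \<kappa>)"
    using \<kappa> by (simp add: field_simps)
  also have "\<dots> \<le> 1 / (- 2 * Re \<kappa>)"
    using \<kappa> by (intro divide_right_mono) auto
  finally show ?thesis .
qed

section \<open>The bounded extension and its integral kernel\<close>

locale birman_schwinger_setting = jost_setting V \<kappa> for V \<kappa> +
  fixes \<gamma> :: real and z :: complex
  assumes z_res: "z \<in> resolvent_set (H0 \<gamma>)" and z_eq: "z = - \<kappa>\<^sup>2" and w_nz: "of_real \<gamma> - \<kappa> \<noteq> 0"
begin

definition c :: complex where "c = 1 / (of_real \<gamma> - \<kappa>)"

abbreviation "sV \<equiv> sqrt_abs V"
abbreviation "gV \<equiv> signed_sqrt V"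
abbreviation "G \<equiv> green \<kappa> c"

lemma V_factor: "gV x * sV x = of_real (V x)"
  by (simp add: signed_sqrt_def sqrt_abs_def mult.assoc flip: of_real_mult) (simp add: sgn_if)

lemma cmod_sV: "(cmod (sV x))\<^sup>2 = \<bar>V x\<bar>" and cmod_gV: "cmod (gV x) = cmod (sV x)"
  by (auto simp: signed_sqrt_def sqrt_abs_def sgn_if)

lemma sV_measurable [measurable]: "sV \<in> borel_measurable half_line"
  and gV_measurable [measurable]: "gV \<in> borel_measurable half_line"
  unfolding sqrt_abs_def[abs_def] signed_sqrt_def[abs_def] sgn_if by measurable

lemma sV_L2: "sV \<in> L2" and gV_L2: "gV \<in> L2"
  using V by (simp_all add: L2_def cmod_sV cmod_gV)

definition B :: real where "B = cmod c + 1 / cmod \<kappa>"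

lemma B_nonneg: "B \<ge> 0" by (simp add: B_def)

lemma G_bound: "x \<ge> 0 \<Longrightarrow> y \<ge> 0 \<Longrightarrow> cmod (G x y) \<le> B"
  unfolding B_def by (rule green_bound[OF \<kappa>])

lemma sVf_integrable: "f \<in> L2 \<Longrightarrow> integrable half_line (\<lambda>y. sV y * f y)"
  by (rule L2_mult_integrable[OF sV_L2])

lemma G_integrable:
  assumes f: "f \<in> L2" and x: "x \<ge> 0"
  shows "integrable half_line (\<lambda>y. G x y * (sV y * f y))"
proof (rule Bochner_Integration.integrable_bound)
  note [measurable] = L2D(1)[OF f]
  show "integrable half_line (\<lambda>y. B * norm (sV y * f y))"
    by (rule integrable_mult_right[OF integrable_norm[OF sVf_integrable[OF f]]])
  show "(\<lambda>y. G x y * (sV y * f y)) \<in> borel_measurable half_line" by measurable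
  show "AE y in half_line. norm (G x y * (sV y * f y)) \<le> norm (B * norm (sV y * f y))"
    using G_bound[OF x] B_nonneg
    by (intro AE_I2) (auto simp: norm_mult[of "G x _"] abs_mult intro!: mult_right_mono)
qed

text \<open>G is bounded and \<open>sV\<close> times an \<open>L2\<close> function is integrable, so
  the formula makes sense on all of \<open>L2\<close>. It is the explicit form of the extension that
  \<open>birman_schwinger\<close> obtains by choice.\<close>

definition K0 :: "(real \<Rightarrow> complex) \<Rightarrow> real \<Rightarrow> complex" where
  "K0 f x = gV x * (LINT y|half_line. G x y * (sV y * f y))"

lemma K0_bound:
  assumes f: "f \<in> L2" and x: "x \<ge> 0"
  shows "cmod (K0 f x) \<le> B * l2_norm sV * l2_norm f * cmod (gV x)"
proof -
  have "cmod (LINT y|half_line. G x y * (sV y * f y)) \<le> (LINT y|half_line. B * (cmod (sV y) * cmod (f y)))"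
    using G_bound[OF x] B_nonneg
    by (intro Bochner_Integration.integral_norm_bound_integral G_integrable f x integrable_mult_right
        L2_abs_mult_integrable sV_L2) (auto simp: norm_mult intro!: mult_right_mono)
  also have "\<dots> \<le> B * (l2_norm sV * l2_norm f)"
    using L2_abs_mult_integral_le[OF sV_L2 f] B_nonneg by (simp add: mult_left_mono)
  finally have "cmod (gV x) * cmod (LINT y|half_line. G x y * (sV y * f y)) \<le> cmod (gV x) * (B * (l2_norm sV * l2_norm f))"
    by (rule mult_left_mono) simp
  then show ?thesis unfolding K0_def norm_mult by (simp only: mult_ac)
qed

lemma K0_measurable:
  assumes f: "f \<in> L2"
  shows "K0 f \<in> borel_measurable half_line"
proof -
  note [measurable] = L2D(1)[OF f]
  have "(\<lambda>x. LINT y|half_line. G x y * (sV y * f y)) \<in> borel_measurable half_line"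
  proof (rule half_line.borel_measurable_lebesgue_integral)
    have "(\<lambda>p. G (fst p) (snd p) * (sV (snd p) * f (snd p))) \<in> borel_measurable (half_line \<Otimes>\<^sub>M half_line)"
      by measurable
    then show "(\<lambda>(x, y). G x y * (sV y * f y)) \<in> borel_measurable (half_line \<Otimes>\<^sub>M half_line)"
      by (simp add: case_prod_beta')
  qed
  then show ?thesis unfolding K0_def[abs_def] by measurable
qed

lemma K0_L2:
  assumes f: "f \<in> L2"
  shows "K0 f \<in> L2"
  by (rule L2_bound[OF gV_L2 K0_measurable[OF f], of "B * l2_norm sV * l2_norm f"]) (use K0_bound[OF f] in auto)

lemma K0_norm_le:
  assumes f: "f \<in> L2"
  shows "l2_norm (K0 f) \<le> (B * l2_norm sV * l2_norm gV) * l2_norm f"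
proof -
  let ?b = "B * l2_norm sV * l2_norm f"
  have b0: "?b \<ge> 0" using B_nonneg by simp
  have "(l2_norm (K0 f))\<^sup>2 \<le> (LINT x|half_line. ?b\<^sup>2 * (cmod (gV x))\<^sup>2)"
    unfolding l2_norm_power2
  proof (rule integral_mono[OF L2D(2)[OF K0_L2[OF f]] integrable_mult_right[OF L2D(2)[OF gV_L2]]])
    fix x assume "x \<in> space half_line"
    then have "(cmod (K0 f x))\<^sup>2 \<le> (?b * cmod (gV x))\<^sup>2"
      by (intro power_mono K0_bound[OF f]) auto
    then show "(cmod (K0 f x))\<^sup>2 \<le> ?b\<^sup>2 * (cmod (gV x))\<^sup>2" by (simp only: power_mult_distrib)
  qed
  also have "\<dots> = (?b * l2_norm gV)\<^sup>2"
    by (simp only: integral_mult_right_zero l2_norm_power2 power_mult_distrib)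
  finally have "l2_norm (K0 f) \<le> ?b * l2_norm gV"
    by (rule power2_le_imp_le) (use b0 in simp)
  then show ?thesis by (simp add: mult_ac)
qed

lemma K0_linear:
  assumes "f \<in> L2" "g \<in> L2" "x \<ge> 0"
  shows "K0 (\<lambda>t. a * f t + b * g t) x = a * K0 f x + b * K0 g x"
proof -
  have "(LINT y|half_line. G x y * (sV y * (a * f y + b * g y))) =
      (LINT y|half_line. a * (G x y * (sV y * f y)) + b * (G x y * (sV y * g y)))"
    by (rule Bochner_Integration.integral_cong) (auto simp: algebra_simps)
  also have "\<dots> = a * (LINT y|half_line. G x y * (sV y * f y)) + b * (LINT y|half_line. G x y * (sV y * g y))"
    using assms by (simp add: G_integrable)
  finally show ?thesis unfolding K0_def by (simp add: algebra_simps)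
qed

lemma K0_bounded: "bounded_operator K0"
  unfolding bounded_operator_def
proof (intro conjI ballI allI)
  show "K0 f \<in> L2" if "f \<in> L2" for f by (rule K0_L2[OF that])
  show "AE x in half_line. K0 (\<lambda>t. a * f t + b * g t) x = a * K0 f x + b * K0 g x"
    if "f \<in> L2" "g \<in> L2" for f g a b
    using K0_linear[OF that] by (intro AE_I2) auto
  show "\<exists>C. \<forall>f\<in>L2. l2_norm (K0 f) \<le> C * l2_norm f" using K0_norm_le by blast
qed

definition bs_spec :: "((real \<Rightarrow> complex) \<Rightarrow> real \<Rightarrow> complex) \<Rightarrow> bool" where
  "bs_spec K \<longleftrightarrow> bounded_operator K \<and>
     (\<forall>f\<in>L2. (\<lambda>x. sqrt_abs V x * f x) \<in> L2 \<longrightarrow>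
        (AE x in half_line.
           K f x = signed_sqrt V x * resolvent (H0 \<gamma>) z (\<lambda>t. sqrt_abs V t * f t) x))"

lemma K0_eq_resolvent:
  assumes f: "(\<lambda>x. sV x * f x) \<in> L2"
  shows "AE x in half_line. K0 f x = gV x * resolvent (H0 \<gamma>) z (\<lambda>t. sV t * f t) x"
proof -
  let ?g = "\<lambda>t. sV t * f t"
  let ?u = "\<lambda>x. LINT y|half_line. G x y * ?g y"
  have u: "(?u, \<lambda>x. ?g x + z * ?u x) \<in> H0 \<gamma>"
    unfolding z_eq c_def by (rule H0_green[OF \<kappa> w_nz f])
  have r: "(resolvent (H0 \<gamma>) z ?g, \<lambda>x. ?g x + z * resolvent (H0 \<gamma>) z ?g x) \<in> H0 \<gamma>"
    unfolding resolvent_def by (rule someI[of "\<lambda>u. (u, \<lambda>x. ?g x + z * u x) \<in> H0 \<gamma>", OF u])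
  from resolvent_unique_AE[OF z_res u r] show ?thesis
    by eventually_elim (simp add: K0_def)
qed

lemma bs_spec_K0: "bs_spec K0"
  unfolding bs_spec_def using K0_bounded K0_eq_resolvent by blast

text \<open>Truncating f to the set |V| \<le> n puts it into the domain on which
  \<open>bs_spec\<close> prescribes K, and the remainder tends to 0 in norm. Boundedness of both
  operators does the rest.\<close>

lemma bs_spec_unique:
  assumes K: "bs_spec K" and f: "f \<in> L2"
  shows "AE x in half_line. K f x = K0 f x"
proof -
  have Kb: "bounded_operator K" using K by (simp add: bs_spec_def)
  then obtain C where C: "\<And>f. f \<in> L2 \<Longrightarrow> l2_norm (K f) \<le> C * l2_norm f"
    unfolding bounded_operator_def by blast
  have KL: "g \<in> L2 \<Longrightarrow> K g \<in> L2" for g using Kb unfolding bounded_operator_def by blast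
  note [measurable] = L2D(1)[OF f]
  define fn where "fn n x = (if \<bar>V x\<bar> \<le> real n then f x else 0)" for n :: nat and x
  define r where "r n x = f x - fn n x" for n :: nat and x
  have fn: "fn n \<in> L2" for n
  proof (rule L2_bound[OF f, of _ 1])
    show "fn n \<in> borel_measurable half_line" unfolding fn_def[abs_def] by measurable
  qed (auto simp: fn_def)
  have r: "r n \<in> L2" for n unfolding r_def[abs_def] by (rule L2_diff[OF f fn])
  have sfn: "(\<lambda>x. sV x * fn n x) \<in> L2" for n
  proof (rule L2_bound[OF f, of _ "sqrt (real n)"])
    show "(\<lambda>x. sV x * fn n x) \<in> borel_measurable half_line"
      using L2D(1)[OF fn[of n]] by measurable
    have "cmod (sV x * fn n x) \<le> sqrt (real n) * cmod (f x)" for x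
      by (auto simp: fn_def sqrt_abs_def norm_mult intro!: mult_right_mono)
    then show "AE x in half_line. cmod (sV x * fn n x) \<le> sqrt (real n) * cmod (f x)" by simp
  qed
  have eq_fn: "AE x in half_line. K (fn n) x = K0 (fn n) x" for n
  proof -
    have "AE x in half_line. K (fn n) x = gV x * resolvent (H0 \<gamma>) z (\<lambda>t. sV t * fn n t) x"
      using K fn sfn unfolding bs_spec_def by blast
    then show ?thesis using K0_eq_resolvent[OF sfn[of n]] by eventually_elim simp
  qed
  have split: "AE x in half_line. L f x = L (fn n) x + L (r n) x" if L: "bounded_operator L" for L n
  proof -
    have "AE x in half_line. L (\<lambda>t. 1 * fn n t + 1 * r n t) x = 1 * L (fn n) x + 1 * L (r n) x"
      using L fn[of n] r[of n] unfolding bounded_operator_def by blast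
    moreover have "(\<lambda>t. 1 * fn n t + 1 * r n t) = f" by (auto simp: r_def)
    ultimately show ?thesis by simp
  qed
  have le: "l2_norm (\<lambda>x. K f x - K0 f x) \<le> (C + B * l2_norm sV * l2_norm gV) * l2_norm (r n)" for n
  proof -
    have "AE x in half_line. K f x - K0 f x = K (r n) x - K0 (r n) x"
      using split[OF Kb, of n] split[OF K0_bounded, of n] eq_fn[of n] by eventually_elim simp
    then have "l2_norm (\<lambda>x. K f x - K0 f x) = l2_norm (\<lambda>x. K (r n) x - K0 (r n) x)"
      by (intro l2_norm_cong_AE L2D(1)[OF L2_diff] KL K0_L2 f r)
    also have "\<dots> \<le> l2_norm (K (r n)) + l2_norm (K0 (r n))"
      using l2_norm_triangle[OF KL[OF r[of n]] L2_scale[OF K0_L2[OF r[of n]], of "-1"]] l2_norm_scale[of "-1" "K0 (r n)"]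
      by simp
    also have "\<dots> \<le> (C + B * l2_norm sV * l2_norm gV) * l2_norm (r n)"
      using C[OF r[of n]] K0_norm_le[OF r[of n]] by (simp add: distrib_right)
    finally show ?thesis .
  qed
  have "(\<lambda>n. l2_norm (r n)) \<longlonglongrightarrow> 0"
  proof (rule l2_norm_dominated_convergence[OF L2D(1)[OF r] f])
    show "cmod (r n x) \<le> cmod (f x)" for n x by (simp add: r_def fn_def)
    show "(\<lambda>n. r n x) \<longlonglongrightarrow> 0" for x
    proof (rule tendsto_eventually)
      obtain n0 :: nat where "\<bar>V x\<bar> \<le> real n0" using real_arch_simple by blast
      then show "\<forall>\<^sub>F n in sequentially. r n x = 0"
        by (intro eventually_sequentiallyI[of n0]) (auto simp: r_def fn_def)
    qed
  qed
  from tendsto_mult_right_zero[OF this] have lim: "(\<lambda>n. (C + B * l2_norm sV * l2_norm gV) * l2_norm (r n)) \<longlonglongrightarrow> 0" .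
  have "l2_norm (\<lambda>x. K f x - K0 f x) \<le> 0"
    by (rule LIMSEQ_le_const[OF lim]) (use le in blast)
  then have "l2_norm (\<lambda>x. K f x - K0 f x) = 0" using l2_norm_nonneg[of "\<lambda>x. K f x - K0 f x"] by linarith
  then have "AE x in half_line. K f x - K0 f x = 0"
    by (subst (asm) l2_norm_eq_0_iff) (intro L2_diff KL K0_L2 f)
  then show ?thesis by simp
qed

abbreviation "K \<equiv> birman_schwinger \<gamma> V z"

lemma bs_spec_K: "bs_spec K"
proof -
  have "K = (SOME K. bs_spec K)" unfolding birman_schwinger_def bs_spec_def ..
  then show ?thesis using someI[of bs_spec, OF bs_spec_K0] by simp
qed

lemma K_AE: "f \<in> L2 \<Longrightarrow> AE x in half_line. K f x = K0 f x"
  by (rule bs_spec_unique[OF bs_spec_K])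

lemma K_bounded: "bounded_operator K"
  using bs_spec_K by (simp add: bs_spec_def)

lemma K_L2: "f \<in> L2 \<Longrightarrow> K f \<in> L2"
  using K_bounded by (simp add: bounded_operator_def)

subsection \<open>A nuclear decomposition\<close>

definition h :: "nat \<Rightarrow> real \<Rightarrow> complex" where "h = (SOME e. orthonormal_basis e)"

lemma h: "orthonormal_basis h"
  unfolding h_def using orthonormal_basis_exists by (rule someI_ex)

lemmas h_on = orthonormal_basis_orthonormal[OF h]

text \<open>Index 0 carries the rank-one part c exp(\<kappa>(x+y)) of the Green function, index j+1
  the component along the basis vector \<open>h j\<close>. The potential is shared out as
  \<open>gV\<close> on this side and \<open>sV\<close> in \<open>nucF\<close>.\<close>

definition nucG :: "nat \<Rightarrow> real \<Rightarrow> complex" where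
  "nucG n x = gV x * (case n of 0 \<Rightarrow> c * exp (\<kappa> * of_real x) | Suc j \<Rightarrow> l2_inner (half_exp \<kappa> x) (h j))"

definition nucF :: "nat \<Rightarrow> real \<Rightarrow> complex" where
  "nucF n y = sV y * (case n of 0 \<Rightarrow> cnj (exp (\<kappa> * of_real y)) | Suc j \<Rightarrow> l2_inner (\<lambda>t. cnj (half_exp \<kappa> y t)) (h j))"

text \<open>A common majorant of |c|^2 + 1/(-2 Re \<kappa>) and 1 + 1/(-2 Re \<kappa>), the
  pointwise Bessel bounds for the two families.\<close>

definition B2 :: real where "B2 = cmod c + (cmod c)\<^sup>2 + 1 + 1 / (- 2 * Re \<kappa>)"

lemma cnj_norm: "l2_norm (\<lambda>t. cnj (f t)) = l2_norm f"
  by (simp add: l2_norm_def)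

lemma inner_measurable:
  "(\<lambda>x. l2_inner (half_exp \<kappa> x) (h j)) \<in> borel_measurable half_line"
  "(\<lambda>x. l2_inner (\<lambda>t. cnj (half_exp \<kappa> x t)) (h j)) \<in> borel_measurable half_line"
proof -
  have [measurable]: "(\<lambda>t. cnj (h j t)) \<in> borel_measurable half_line" "h j \<in> borel_measurable half_line"
    using L2D(1)[OF orthonormal_L2[OF h_on, of j]] by (auto intro: borel_measurable_cnj)
  have 1: "(\<lambda>p. half_exp \<kappa> (fst p) (snd p) * cnj (h j (snd p))) \<in> borel_measurable (half_line \<Otimes>\<^sub>M half_line)"
    by measurable
  have 2: "(\<lambda>p. cnj (half_exp \<kappa> (fst p) (snd p)) * cnj (h j (snd p))) \<in> borel_measurable (half_line \<Otimes>\<^sub>M half_line)"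
    using borel_measurable_cnj[OF half_exp_measurable_pair[of \<kappa>]] by measurable
  show "(\<lambda>x. l2_inner (half_exp \<kappa> x) (h j)) \<in> borel_measurable half_line"
    unfolding l2_inner_def using 1
    by (intro half_line.borel_measurable_lebesgue_integral) (simp add: case_prod_beta')
  show "(\<lambda>x. l2_inner (\<lambda>t. cnj (half_exp \<kappa> x t)) (h j)) \<in> borel_measurable half_line"
    unfolding l2_inner_def using 2
    by (intro half_line.borel_measurable_lebesgue_integral) (simp add: case_prod_beta')
qed

lemma nuc_measurable: "nucG n \<in> borel_measurable half_line" "nucF n \<in> borel_measurable half_line"
proof -
  note [measurable] = inner_measurable
  have [measurable]: "(\<lambda>y. cnj (exp (\<kappa> * complex_of_real y))) \<in> borel_measurable half_line"
    by (rule borel_measurable_cnj) measurable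
  show "nucG n \<in> borel_measurable half_line"
    unfolding nucG_def[abs_def] by (cases n) simp_all
  show "nucF n \<in> borel_measurable half_line"
    unfolding nucF_def[abs_def] by (cases n) simp_all
qed

lemma sum_Suc_split: "(\<Sum>n<N. f n) = (if N = 0 then 0 else f 0 + (\<Sum>j<N - 1. f (Suc j)))"
  for f :: "nat \<Rightarrow> 'a::comm_monoid_add"
  by (cases N) (simp, simp del: sum.lessThan_Suc add: sum.lessThan_Suc_shift)

text \<open>Bessel's inequality at each fixed x. The right side is a constant times |V(x)|, so
  integrating it bounds the sum of the squared norms: each of the two families defines a
  Hilbert-Schmidt factor, and the product of the factors is nuclear.\<close>

lemma nucG_square_sum:
  assumes x: "x \<ge> 0"
  shows "(\<Sum>n<N. (cmod (nucG n x))\<^sup>2) \<le> B2 * (cmod (gV x))\<^sup>2"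
proof -
  have "(\<Sum>j<k. (cmod (l2_inner (half_exp \<kappa> x) (h j)))\<^sup>2) \<le> 1 / (- 2 * Re \<kappa>)" for k
    using Bessel[OF h_on half_exp_L2[OF \<kappa> x], of "{..<k}"] half_exp_norm_le[OF \<kappa> x] by simp
  then have s: "(\<Sum>j<k. (cmod (nucG (Suc j) x))\<^sup>2) \<le> (cmod (gV x))\<^sup>2 * (1 / (- 2 * Re \<kappa>))" for k
    unfolding nucG_def nat.case norm_mult power_mult_distrib sum_distrib_left[symmetric]
    by (rule mult_left_mono) simp
  have "cmod (exp (\<kappa> * of_real x)) \<le> 1" by (rule norm_exp_le_1) (use \<kappa> x in auto)
  then have "(cmod (c * exp (\<kappa> * of_real x)))\<^sup>2 \<le> (cmod c)\<^sup>2"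
    unfolding norm_mult by (intro power_mono mult_left_le) auto
  then have 0: "(cmod (nucG 0 x))\<^sup>2 \<le> (cmod (gV x))\<^sup>2 * (cmod c)\<^sup>2"
    unfolding nucG_def nat.case norm_mult[of "gV x"] power_mult_distrib by (rule mult_left_mono) simp
  have "(\<Sum>n<N. (cmod (nucG n x))\<^sup>2) \<le> (cmod (gV x))\<^sup>2 * (cmod c)\<^sup>2 + (cmod (gV x))\<^sup>2 * (1 / (- 2 * Re \<kappa>))"
  proof (cases "N = 0")
    case True
    have "0 \<le> (cmod (gV x))\<^sup>2 * (cmod c)\<^sup>2 + (cmod (gV x))\<^sup>2 * (1 / (- 2 * Re \<kappa>))"
      by (intro add_nonneg_nonneg mult_nonneg_nonneg[OF zero_le_power2]) (use \<kappa> in \<open>auto simp: divide_le_0_iff\<close>)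
    then show ?thesis using True by simp
  next
    case False
    then show ?thesis using add_mono[OF 0 s[of "N - 1"]] by (subst sum_Suc_split) simp
  qed
  also have "\<dots> \<le> (cmod (gV x))\<^sup>2 * B2"
    unfolding distrib_left[symmetric] B2_def by (rule mult_left_mono) auto
  finally show ?thesis by (simp add: mult.commute)
qed

lemma nucF_square_sum:
  assumes x: "x \<ge> 0"
  shows "(\<Sum>n<N. (cmod (nucF n x))\<^sup>2) \<le> B2 * (cmod (gV x))\<^sup>2"
proof -
  have "(\<Sum>j<k. (cmod (l2_inner (\<lambda>t. cnj (half_exp \<kappa> x t)) (h j)))\<^sup>2) \<le> 1 / (- 2 * Re \<kappa>)" for k
    using Bessel[OF h_on L2_cnj[OF half_exp_L2[OF \<kappa> x]], of "{..<k}"] half_exp_norm_le[OF \<kappa> x]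
    by (simp add: cnj_norm)
  then have s: "(\<Sum>j<k. (cmod (nucF (Suc j) x))\<^sup>2) \<le> (cmod (gV x))\<^sup>2 * (1 / (- 2 * Re \<kappa>))" for k
    unfolding nucF_def nat.case norm_mult power_mult_distrib sum_distrib_left[symmetric] cmod_gV
    by (rule mult_left_mono) simp
  have "cmod (exp (\<kappa> * of_real x)) \<le> 1" by (rule norm_exp_le_1) (use \<kappa> x in auto)
  then have "(cmod (cnj (exp (\<kappa> * of_real x))))\<^sup>2 \<le> 1"
    by (simp only: complex_mod_cnj power_le_one norm_ge_zero)
  then have 0: "(cmod (nucF 0 x))\<^sup>2 \<le> (cmod (gV x))\<^sup>2 * 1"
    unfolding nucF_def nat.case norm_mult[of "sV x"] power_mult_distrib cmod_gV by (rule mult_left_mono) simp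
  have "(\<Sum>n<N. (cmod (nucF n x))\<^sup>2) \<le> (cmod (gV x))\<^sup>2 * 1 + (cmod (gV x))\<^sup>2 * (1 / (- 2 * Re \<kappa>))"
  proof (cases "N = 0")
    case True
    have "0 \<le> (cmod (gV x))\<^sup>2 * 1 + (cmod (gV x))\<^sup>2 * (1 / (- 2 * Re \<kappa>))"
      by (intro add_nonneg_nonneg mult_nonneg_nonneg[OF zero_le_power2]) (use \<kappa> in \<open>auto simp: divide_le_0_iff\<close>)
    then show ?thesis using True by simp
  next
    case False
    then show ?thesis using add_mono[OF 0 s[of "N - 1"]] by (subst sum_Suc_split) simp
  qed
  also have "\<dots> \<le> (cmod (gV x))\<^sup>2 * B2"
    unfolding distrib_left[symmetric] B2_def by (rule mult_left_mono) auto
  finally show ?thesis by (simp add: mult.commute)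
qed

lemma B2_nonneg: "B2 \<ge> 0"
  unfolding B2_def using \<kappa> by (intro add_nonneg_nonneg divide_nonneg_nonneg) auto

lemma nuc_square_summable:
  assumes meas: "\<And>n. f n \<in> borel_measurable half_line"
    and le: "\<And>x N. x \<ge> 0 \<Longrightarrow> (\<Sum>n<N. (cmod (f n x))\<^sup>2) \<le> B2 * (cmod (gV x))\<^sup>2"
  shows "f n \<in> L2" "summable (\<lambda>n. (l2_norm (f n))\<^sup>2)"
proof -
  show fL: "f n \<in> L2" for n
  proof (rule L2_bound[OF gV_L2 meas])
    have "cmod (f n x) \<le> sqrt B2 * cmod (gV x)" if "x > 0" for x
    proof (rule power2_le_imp_le)
      have "(cmod (f n x))\<^sup>2 \<le> (\<Sum>k<Suc n. (cmod (f k x))\<^sup>2)"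
        by (rule member_le_sum) auto
      also have "\<dots> \<le> B2 * (cmod (gV x))\<^sup>2" by (rule le) (use that in simp)
      finally show "(cmod (f n x))\<^sup>2 \<le> (sqrt B2 * cmod (gV x))\<^sup>2"
        using B2_nonneg by (simp add: power_mult_distrib)
    qed (use B2_nonneg in simp)
    then show "AE x in half_line. cmod (f n x) \<le> sqrt B2 * cmod (gV x)" by auto
  qed
  show "summable (\<lambda>n. (l2_norm (f n))\<^sup>2)"
  proof (rule summableI_nonneg_bounded)
    fix N
    have "(\<Sum>n<N. (l2_norm (f n))\<^sup>2) = (LINT x|half_line. (\<Sum>n<N. (cmod (f n x))\<^sup>2))"
      unfolding l2_norm_power2 by (rule Bochner_Integration.integral_sum[symmetric]) (rule L2D(2)[OF fL])
    also have "\<dots> \<le> (LINT x|half_line. B2 * (cmod (gV x))\<^sup>2)"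
      using le by (intro integral_mono Bochner_Integration.integrable_sum integrable_mult_right L2D(2) fL gV_L2) auto
    finally show "(\<Sum>n<N. (l2_norm (f n))\<^sup>2) \<le> (LINT x|half_line. B2 * (cmod (gV x))\<^sup>2)" .
  qed simp
qed

lemmas nucG_L2 = nuc_square_summable(1)[OF nuc_measurable(1) nucG_square_sum]
  and nucF_L2 = nuc_square_summable(1)[OF nuc_measurable(2) nucF_square_sum]

lemma nuc_summable: "summable (\<lambda>n. l2_norm (nucF n) * l2_norm (nucG n))"
proof (rule summable_comparison_test'[OF summable_add[OF
      nuc_square_summable(2)[OF nuc_measurable(2) nucF_square_sum]
      nuc_square_summable(2)[OF nuc_measurable(1) nucG_square_sum]], of 0])
  fix n
  have "a * b \<le> a\<^sup>2 + b\<^sup>2" if "a \<ge> 0" "b \<ge> 0" for a b :: real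
    using sum_squares_bound[of a b] mult_nonneg_nonneg[OF that] by linarith
  then show "norm (l2_norm (nucF n) * l2_norm (nucG n)) \<le> (l2_norm (nucF n))\<^sup>2 + (l2_norm (nucG n))\<^sup>2"
    by simp
qed

text \<open>Cauchy-Schwarz in the summation index. The bound is free of N and yields the dominating
  function whenever partial kernels are replaced by the full one.\<close>

lemma nuc_kernel_bound:
  assumes "x \<ge> 0" "y \<ge> 0"
  shows "cmod (\<Sum>n<N. nucG n x * cnj (nucF n y)) \<le> B2 * cmod (gV x) * cmod (gV y)"
proof -
  have "cmod (\<Sum>n<N. nucG n x * cnj (nucF n y)) \<le> (\<Sum>n<N. cmod (nucG n x) * cmod (nucF n y))"
    by (rule order_trans[OF norm_sum]) (simp add: norm_mult)
  also have "\<dots> \<le> B2 * cmod (gV x) * cmod (gV y)"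
  proof (rule power2_le_imp_le)
    have "(\<Sum>n<N. cmod (nucG n x) * cmod (nucF n y))\<^sup>2 \<le> (\<Sum>n<N. (cmod (nucG n x))\<^sup>2) * (\<Sum>n<N. (cmod (nucF n y))\<^sup>2)"
      by (rule Cauchy_Schwarz_ineq_sum)
    also have "\<dots> \<le> (B2 * (cmod (gV x))\<^sup>2) * (B2 * (cmod (gV y))\<^sup>2)"
      using B2_nonneg by (intro mult_mono nucG_square_sum nucF_square_sum assms mult_nonneg_nonneg sum_nonneg) auto
    also have "\<dots> = (B2 * cmod (gV x) * cmod (gV y))\<^sup>2" by (simp add: power2_eq_square)
    finally show "(\<Sum>n<N. cmod (nucG n x) * cmod (nucF n y))\<^sup>2 \<le> (B2 * cmod (gV x) * cmod (gV y))\<^sup>2" .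
  qed (use B2_nonneg in simp)
  finally show ?thesis .
qed

text \<open>Parseval for each fixed pair (x,y), so the identity holds at every point and in
  particular on the diagonal, a null set on which the trace integrals evaluate the kernel.\<close>

lemma nuc_kernel_sums:
  assumes x: "x \<ge> 0" "y \<ge> 0"
  shows "(\<lambda>n. nucG n x * cnj (nucF n y)) sums (gV x * G x y * sV y)"
proof -
  have cs: "cnj (sV y) = sV y" by (simp add: sqrt_abs_def)
  have "(\<lambda>n. l2_inner (half_exp \<kappa> x) (h n) * l2_inner (h n) (\<lambda>t. cnj (half_exp \<kappa> y t))) sums
      l2_inner (half_exp \<kappa> x) (\<lambda>t. cnj (half_exp \<kappa> y t))"
    by (intro Parseval_sums h L2_cnj half_exp_L2 \<kappa> x)
  from sums_mult[OF this, of "gV x * sV y"]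
  have "(\<lambda>n. nucG (Suc n) x * cnj (nucF (Suc n) y)) sums
      (gV x * sV y * l2_inner (half_exp \<kappa> x) (\<lambda>t. cnj (half_exp \<kappa> y t)))"
    by (simp add: nucG_def nucF_def l2_inner_cnj cs mult_ac)
  from sums_Suc[OF this] show ?thesis
    unfolding green_eq_inner[OF \<kappa> x] by (simp add: nucG_def nucF_def cs algebra_simps)
qed

text \<open>Dominated convergence twice: in y for each fixed x, giving pointwise convergence of the
  partial sums, then in x with a multiple of |\<open>gV\<close>| as majorant, giving convergence in
  norm.\<close>

lemma K_nuclear_limit:
  assumes u: "u \<in> L2"
  shows "(\<lambda>N. l2_norm (\<lambda>x. K u x - (\<Sum>n<N. l2_inner u (nucF n) * nucG n x))) \<longlonglongrightarrow> 0"
proof -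
  note [measurable] = L2D(1)[OF u]
  define kN where "kN N x y = (\<Sum>n<N. nucG n x * cnj (nucF n y))" for N x y
  have iF: "integrable half_line (\<lambda>y. u y * cnj (nucF n y))" for n
    by (rule l2_inner_integrable[OF u nucF_L2])
  have S: "(\<Sum>n<N. l2_inner u (nucF n) * nucG n x) = (LINT y|half_line. kN N x y * u y)" for N x
  proof -
    have "(\<Sum>n<N. l2_inner u (nucF n) * nucG n x) = (\<Sum>n<N. LINT y|half_line. nucG n x * (u y * cnj (nucF n y)))"
      unfolding l2_inner_def by (simp add: mult.commute)
    also have "\<dots> = (LINT y|half_line. (\<Sum>n<N. nucG n x * (u y * cnj (nucF n y))))"
      by (rule Bochner_Integration.integral_sum[symmetric]) (rule integrable_mult_right[OF iF])
    also have "\<dots> = (LINT y|half_line. kN N x y * u y)"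
      unfolding kN_def sum_distrib_right by (rule Bochner_Integration.integral_cong) (auto simp: mult_ac)
    finally show ?thesis .
  qed
  have kN_meas: "(\<lambda>y. kN N x y * u y) \<in> borel_measurable half_line" for N x
    unfolding kN_def by (intro borel_measurable_times borel_measurable_sum borel_measurable_const
        borel_measurable_cnj nuc_measurable L2D(1)[OF u])
  have dom: "integrable half_line (\<lambda>y. B2 * cmod (gV x) * (cmod (gV y) * cmod (u y)))" for x
    by (intro integrable_mult_right L2_abs_mult_integrable gV_L2 u)
  have kle: "norm (kN N x y * u y) \<le> B2 * cmod (gV x) * (cmod (gV y) * cmod (u y))" if "x > 0" "y > 0" for N x y
    unfolding norm_mult mult.assoc[symmetric] kN_def
    by (intro mult_right_mono nuc_kernel_bound) (use that in auto)
  have lim: "(\<lambda>N. \<Sum>n<N. l2_inner u (nucF n) * nucG n x) \<longlonglongrightarrow> K0 u x" if x: "x > 0" for x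
  proof -
    have "(\<lambda>N. LINT y|half_line. kN N x y * u y) \<longlonglongrightarrow> (LINT y|half_line. gV x * (G x y * (sV y * u y)))"
    proof (rule integral_dominated_convergence[OF _ kN_meas dom])
      show "(\<lambda>y. gV x * (G x y * (sV y * u y))) \<in> borel_measurable half_line" by measurable
      show "AE y in half_line. (\<lambda>N. kN N x y * u y) \<longlonglongrightarrow> gV x * (G x y * (sV y * u y))"
      proof (rule AE_I2)
        fix y :: real assume "y \<in> space half_line"
        then have "(\<lambda>N. kN N x y) \<longlonglongrightarrow> gV x * G x y * sV y"
          using nuc_kernel_sums[of x y] x unfolding sums_def kN_def by auto
        from tendsto_mult_right[OF this, of "u y"]
        show "(\<lambda>N. kN N x y * u y) \<longlonglongrightarrow> gV x * (G x y * (sV y * u y))" by (simp only: mult.assoc)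
      qed
      show "AE y in half_line. norm (kN N x y * u y) \<le> B2 * cmod (gV x) * (cmod (gV y) * cmod (u y))" for N
        using kle[OF x] by auto
    qed
    then show ?thesis unfolding S K0_def by (simp only: integral_mult_right_zero)
  qed
  define D where "D = B2 * (LINT y|half_line. cmod (gV y) * cmod (u y)) + B * l2_norm sV * l2_norm u"
  have SL: "(\<lambda>x. \<Sum>n<N. l2_inner u (nucF n) * nucG n x) \<in> L2" for N
    by (intro L2_sum L2_scale nucG_L2)
  have "(\<lambda>N. l2_norm (\<lambda>x. K0 u x - (\<Sum>n<N. l2_inner u (nucF n) * nucG n x))) \<longlonglongrightarrow> 0"
  proof (rule l2_norm_dominated_convergence[OF L2D(1)[OF L2_diff[OF K0_L2[OF u] SL]] L2_scale[OF gV_L2, of "of_real D"]])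
    fix N and x :: real assume x: "x > 0"
    have "cmod (\<Sum>n<N. l2_inner u (nucF n) * nucG n x) \<le> (LINT y|half_line. B2 * cmod (gV x) * (cmod (gV y) * cmod (u y)))"
      unfolding S
      by (rule Bochner_Integration.integral_norm_bound_integral[OF Bochner_Integration.integrable_bound[OF dom kN_meas] dom])
        (use kle[OF x] in \<open>auto intro!: AE_I2 order_trans[OF _ abs_ge_self]\<close>)
    also have "\<dots> = B2 * (LINT y|half_line. cmod (gV y) * cmod (u y)) * cmod (gV x)" by simp
    finally have "cmod (K0 u x - (\<Sum>n<N. l2_inner u (nucF n) * nucG n x)) \<le> D * cmod (gV x)"
      using norm_triangle_ineq4[of "K0 u x" "\<Sum>n<N. l2_inner u (nucF n) * nucG n x"] K0_bound[OF u, of x] x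
      by (simp add: D_def distrib_right)
    also have "\<dots> \<le> cmod (of_real D * gV x)"
      unfolding norm_mult norm_of_real by (intro mult_right_mono) auto
    finally show "cmod (K0 u x - (\<Sum>n<N. l2_inner u (nucF n) * nucG n x)) \<le> cmod (of_real D * gV x)" .
  next
    fix x :: real assume x: "x > 0"
    from tendsto_diff[OF tendsto_const[of "K0 u x"] lim[OF x]]
    show "(\<lambda>N. K0 u x - (\<Sum>n<N. l2_inner u (nucF n) * nucG n x)) \<longlonglongrightarrow> 0" by simp
  qed
  moreover have "l2_norm (\<lambda>x. K u x - (\<Sum>n<N. l2_inner u (nucF n) * nucG n x)) =
      l2_norm (\<lambda>x. K0 u x - (\<Sum>n<N. l2_inner u (nucF n) * nucG n x))" for N
    by (rule l2_norm_cong_AE[OF L2D(1)[OF L2_diff[OF K_L2[OF u] SL]] L2D(1)[OF L2_diff[OF K0_L2[OF u] SL]]])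
      (use K_AE[OF u] in \<open>auto elim: eventually_mono\<close>)
  ultimately show ?thesis by simp
qed

lemma K_trace_class: "trace_class K"
  unfolding trace_class_def
  using K_bounded nucF_L2 nucG_L2 nuc_summable K_nuclear_limit by blast

end

section \<open>Exterior traces of nuclear operators\<close>

no_notation Infinite_Set_Sum.abs_summable_on (infix \<open>abs'_summable'_on\<close> 50)

abbreviation tuples :: "nat \<Rightarrow> (nat \<Rightarrow> nat) set" where
  "tuples k \<equiv> {..<k} \<rightarrow>\<^sub>E UNIV"

text \<open>A finite set of choice functions lies in the box spanned by its projections. Over the
  box the sum of products factors into a product of finite sums, each bounded by the corresponding
  infinite sum.\<close>

lemma
  fixes f :: "'a \<Rightarrow> 'b \<Rightarrow> 'c::{banach, real_normed_div_algebra, comm_semiring_1}"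
  assumes A: "finite A" and f: "\<And>x. x \<in> A \<Longrightarrow> f x abs_summable_on B x"
  shows abs_summable_on_prod_PiE_finite: "(\<lambda>g. \<Prod>x\<in>A. f x (g x)) abs_summable_on (PiE A B)"
proof (rule nonneg_bdd_above_summable_on)
  let ?s = "\<lambda>x. infsum (\<lambda>y. norm (f x y)) (B x)"
  show "bdd_above (sum (\<lambda>g. norm (\<Prod>x\<in>A. f x (g x))) ` {F. F \<subseteq> PiE A B \<and> finite F})"
  proof (rule bdd_aboveI2)
    fix P assume "P \<in> {F. F \<subseteq> PiE A B \<and> finite F}"
    then have P: "P \<subseteq> PiE A B" "finite P" by auto
    let ?B = "\<lambda>x. (\<lambda>g. g x) ` P"
    have "(\<Sum>g\<in>P. norm (\<Prod>x\<in>A. f x (g x))) \<le> (\<Sum>g\<in>PiE A ?B. norm (\<Prod>x\<in>A. f x (g x)))"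
      using P A by (intro sum_mono2 finite_PiE) (auto simp: PiE_iff)
    also have "\<dots> = (\<Sum>g\<in>PiE A ?B. \<Prod>x\<in>A. norm (f x (g x)))"
      by (simp add: prod_norm)
    also have "\<dots> = (\<Prod>x\<in>A. \<Sum>y\<in>?B x. norm (f x y))"
      using A P by (intro prod_sum_PiE[symmetric]) auto
    also have "\<dots> \<le> (\<Prod>x\<in>A. ?s x)"
    proof (intro prod_mono conjI sum_nonneg norm_ge_zero)
      fix x assume x: "x \<in> A"
      show "(\<Sum>y\<in>?B x. norm (f x y)) \<le> ?s x"
        by (rule finite_sum_le_infsum[OF f[OF x]]) (use P x in \<open>auto simp: PiE_iff\<close>)
    qed
    finally show "(\<Sum>g\<in>P. norm (\<Prod>x\<in>A. f x (g x))) \<le> (\<Prod>x\<in>A. ?s x)" .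
  qed
qed simp

lemma has_sum_finite_sum:
  fixes f :: "'i \<Rightarrow> 'a \<Rightarrow> 'b::{topological_comm_monoid_add}"
  assumes "finite P" "\<And>p. p \<in> P \<Longrightarrow> (f p has_sum s p) A"
  shows "((\<lambda>x. \<Sum>p\<in>P. f p x) has_sum (\<Sum>p\<in>P. s p)) A"
  using assms by (induction P rule: finite_induct) (auto intro: has_sum_add)

subsection \<open>Sums of minors over subsets and over tuples\<close>

definition tuple_minor :: "('a \<Rightarrow> 'a \<Rightarrow> complex) \<Rightarrow> nat \<Rightarrow> (nat \<Rightarrow> 'a) \<Rightarrow> complex" where
  "tuple_minor M k f = (\<Sum>p | p permutes {..<k}. of_int (sign p) * (\<Prod>i<k. M (f i) (f (p i))))"

definition set_minor :: "(nat \<Rightarrow> nat \<Rightarrow> complex) \<Rightarrow> nat set \<Rightarrow> complex" where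
  "set_minor M I = (\<Sum>p | p permutes I. of_int (sign p) * (\<Prod>i\<in>I. M i (p i)))"

text \<open>Composing with the transposition of a and b reverses every sign and keeps every product.
  Columns are reached through g, so that the lemma covers repeated points in a tuple as well as the
  column operation in \<open>leibniz_last_column\<close>.\<close>

lemma leibniz_repeated_column:
  fixes M :: "nat \<Rightarrow> 'a \<Rightarrow> complex"
  assumes ab: "a < k" "b < k" "a \<noteq> b" "g a = g b"
  shows "(\<Sum>p | p permutes {..<k}. of_int (sign p) * (\<Prod>i<k. M i (g (p i)))) = 0" (is "?D = 0")
proof -
  let ?t = "Transposition.transpose a b"
  have t: "?t permutes {..<k}" using ab by (intro permutes_swap_id) auto
  have gt: "g (?t j) = g j" for j using ab(4) by (auto simp: Transposition.transpose_def)
  have "?D = (\<Sum>p | p permutes {..<k}. of_int (sign (?t \<circ> p)) * (\<Prod>i<k. M i (g ((?t \<circ> p) i))))"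
    by (rule setum_permutations_compose_left[OF t])
  also have "\<dots> = (\<Sum>p | p permutes {..<k}. - (of_int (sign p) * (\<Prod>i<k. M i (g (p i)))))"
  proof (rule sum.cong[OF refl])
    fix p assume "p \<in> {p. p permutes {..<k}}"
    then have "permutation p" by (auto intro: permutes_imp_permutation)
    then have "sign (?t \<circ> p) = - sign p"
      using ab(3) by (simp add: sign_compose permutation_swap_id sign_swap_id)
    then show "of_int (sign (?t \<circ> p)) * (\<Prod>i<k. M i (g ((?t \<circ> p) i))) =
        - (of_int (sign p) * (\<Prod>i<k. M i (g (p i))))"
      by (simp add: gt)
  qed
  also have "\<dots> = - ?D" by (simp add: sum_negf)
  finally show ?thesis by simp
qed

lemma tuple_minor_not_inj:
  assumes "\<not> inj_on f {..<k}"
  shows "tuple_minor M k f = 0"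
proof -
  obtain a b where "a < k" "b < k" "a \<noteq> b" "f a = f b"
    using assms by (auto simp: inj_on_def)
  then show ?thesis
    unfolding tuple_minor_def by (rule leibniz_repeated_column)
qed

text \<open>Minors over I and over {..<k} involve permutations of different sets. A permutation of
  the whole type that carries one set to the other makes conjugation possible; it exists because
  both sets have complements of equal size in their union.\<close>

lemma bij_extends_to_permutation:
  assumes f: "bij_betw f {..<k} (I :: nat set)"
  obtains \<pi> where "permutation \<pi>" "\<And>i. i < k \<Longrightarrow> \<pi> i = f i" "\<pi> ` {..<k} = I"
proof -
  have fin: "finite I" using f bij_betw_finite by blast
  let ?U = "{..<k} \<union> I"
  have "card {..<k} = card I" by (rule bij_betw_same_card[OF f])
  then have "card (?U - {..<k}) = card (?U - I)"
    using fin by (simp add: card_Diff_subset)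
  then obtain g where g: "bij_betw g (?U - {..<k}) (?U - I)"
    using fin by (metis finite_Diff finite_Un finite_lessThan finite_same_card_bij)
  define \<pi> where "\<pi> i = (if i < k then f i else if i \<in> I then g i else i)" for i
  have 1: "bij_betw \<pi> {..<k} I"
    using f by (rule bij_betw_cong[THEN iffD1, rotated]) (simp add: \<pi>_def)
  have 2: "bij_betw \<pi> (?U - {..<k}) (?U - I)"
    using g by (rule bij_betw_cong[THEN iffD1, rotated]) (auto simp: \<pi>_def)
  have "bij_betw \<pi> ({..<k} \<union> (?U - {..<k})) (I \<union> (?U - I))"
    by (rule bij_betw_combine[OF 1 2]) auto
  then have "bij_betw \<pi> ?U ?U" by (simp add: Un_Diff_cancel Un_commute Un_left_commute)
  then have "\<pi> permutes ?U"
    by (rule bij_imp_permutes) (auto simp: \<pi>_def)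
  then have "permutation \<pi>" by (rule permutes_imp_permutation[rotated]) (use fin in simp)
  then show ?thesis
    by (rule that) (use 1 in \<open>auto simp: \<pi>_def bij_betw_def\<close>)
qed

text \<open>Conjugation by the extended permutation carries the permutations of {..<k} to those of I
  and preserves signs.\<close>

lemma tuple_minor_bij:
  assumes f: "bij_betw f {..<k} I"
  shows "tuple_minor M k f = set_minor M I"
proof -
  obtain \<pi> where \<pi>: "permutation \<pi>" "\<And>i. i < k \<Longrightarrow> \<pi> i = f i" "\<pi> ` {..<k} = I"
    using bij_extends_to_permutation[OF f] by blast
  have bij: "bij \<pi>" by (rule permutation_bijective[OF \<pi>(1)])
  have inj: "inj_on \<pi> {..<k}" using bij by (auto simp: bij_def intro: inj_on_subset)
  have inv1 [simp]: "inv \<pi> (\<pi> i) = i" "\<pi> (inv \<pi> i) = i" for i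
    using bij by (auto simp: bij_def surj_f_inv_f)
  have conj: "\<pi> \<circ> p \<circ> inv \<pi> permutes \<pi> ` S" if p: "p permutes S" for p S
  proof (rule bij_imp_permutes)
    have "bij_betw (inv \<pi>) (\<pi> ` S) S"
      using bij by (auto simp: bij_betw_def inj_on_def image_image)
    moreover have "bij_betw p S S" by (rule permutes_imp_bij[OF p])
    moreover have "bij_betw \<pi> S (\<pi> ` S)" using bij by (auto simp: bij_betw_def bij_def intro: inj_on_subset)
    ultimately show "bij_betw (\<pi> \<circ> p \<circ> inv \<pi>) (\<pi> ` S) (\<pi> ` S)"
      unfolding comp_assoc by (blast intro: bij_betw_trans)
    fix x assume "x \<notin> \<pi> ` S"
    then have "inv \<pi> x \<notin> S" by (metis imageI inv1(2))
    then show "(\<pi> \<circ> p \<circ> inv \<pi>) x = x" using p by (simp add: permutes_not_in)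
  qed
  have conj_inv: "inv \<pi> \<circ> q \<circ> \<pi> permutes {..<k}" if q: "q permutes I" for q
  proof (rule bij_imp_permutes)
    have "bij_betw \<pi> {..<k} I" using inj \<pi>(3) by (simp add: bij_betw_def)
    moreover have "bij_betw q I I" by (rule permutes_imp_bij[OF q])
    moreover have "bij_betw (inv \<pi>) I {..<k}"
      using bij \<pi>(3) by (auto simp: bij_betw_def inj_on_def image_image)
    ultimately show "bij_betw (inv \<pi> \<circ> q \<circ> \<pi>) {..<k} {..<k}"
      unfolding comp_assoc by (blast intro: bij_betw_trans)
    fix x assume "x \<notin> {..<k}"
    then have "\<pi> x \<notin> I" using \<pi>(3) by (metis imageE inv1(1))
    then show "(inv \<pi> \<circ> q \<circ> \<pi>) x = x" using q by (simp add: permutes_not_in)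
  qed
  have perm_inv: "permutation (inv \<pi>)" using \<pi>(1) by (rule permutation_inverse)
  show ?thesis
    unfolding tuple_minor_def set_minor_def
  proof (rule sum.reindex_bij_witness[where i="\<lambda>q. inv \<pi> \<circ> q \<circ> \<pi>" and j="\<lambda>p. \<pi> \<circ> p \<circ> inv \<pi>"])
    fix p assume "p \<in> {p. p permutes {..<k}}"
    then have p: "p permutes {..<k}" by simp
    show "inv \<pi> \<circ> (\<pi> \<circ> p \<circ> inv \<pi>) \<circ> \<pi> = p" by (auto simp: fun_eq_iff)
    show "\<pi> \<circ> p \<circ> inv \<pi> \<in> {p. p permutes I}" using conj[OF p] \<pi>(3) by simp
    have "permutation p" using p by (auto intro: permutes_imp_permutation)
    then have s: "sign (\<pi> \<circ> p \<circ> inv \<pi>) = sign p"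
      using \<pi>(1) perm_inv by (simp add: sign_compose permutation_compose sign_inverse)
    have "(\<Prod>i\<in>I. M i ((\<pi> \<circ> p \<circ> inv \<pi>) i)) = (\<Prod>i\<in>\<pi> ` {..<k}. M i ((\<pi> \<circ> p \<circ> inv \<pi>) i))"
      by (simp only: \<pi>(3))
    also have "\<dots> = (\<Prod>i<k. M (\<pi> i) (\<pi> (p i)))"
      by (subst prod.reindex[OF inj]) simp
    also have "\<dots> = (\<Prod>i<k. M (f i) (f (p i)))"
      by (rule prod.cong[OF refl]) (use permutes_in_image[OF p] \<pi>(2) in auto)
    finally show "of_int (sign (\<pi> \<circ> p \<circ> inv \<pi>)) * (\<Prod>i\<in>I. M i ((\<pi> \<circ> p \<circ> inv \<pi>) i)) =
        of_int (sign p) * (\<Prod>i<k. M (f i) (f (p i)))"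
      by (simp only: s)
  next
    fix q assume "q \<in> {q. q permutes I}"
    then have q: "q permutes I" by simp
    show "\<pi> \<circ> (inv \<pi> \<circ> q \<circ> \<pi>) \<circ> inv \<pi> = q" by (auto simp: fun_eq_iff)
    show "inv \<pi> \<circ> q \<circ> \<pi> \<in> {p. p permutes {..<k}}" using conj_inv[OF q] by simp
  qed
qed

lemma card_bij_tuples:
  assumes I: "finite I" "card I = k"
  shows "finite {f \<in> tuples k. bij_betw f {..<k} I}" "card {f \<in> tuples k. bij_betw f {..<k} I} = fact k"
proof -
  have eq: "{f \<in> tuples k. bij_betw f {..<k} I} = {f \<in> {..<k} \<rightarrow>\<^sub>E I. inj_on f {..<k}}"
  proof (intro equalityI subsetI)
    fix f assume "f \<in> {f \<in> {..<k} \<rightarrow>\<^sub>E I. inj_on f {..<k}}"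
    then have f: "f \<in> {..<k} \<rightarrow>\<^sub>E I" "inj_on f {..<k}" by auto
    then have "f ` {..<k} = I"
      using I by (intro card_subset_eq) (auto simp: card_image)
    then show "f \<in> {f \<in> tuples k. bij_betw f {..<k} I}"
      using f by (auto simp: bij_betw_def PiE_iff)
  qed (auto simp: bij_betw_def PiE_iff)
  show "finite {f \<in> tuples k. bij_betw f {..<k} I}"
    unfolding eq using I by (intro finite_subset[OF _ finite_PiE[of "{..<k}" "\<lambda>_. I"]]) auto
  show "card {f \<in> tuples k. bij_betw f {..<k} I} = fact k"
    unfolding eq using card_inj_on_subset_funcset[of "{..<k}" I "{..<k}"] I by (simp add: fact_prod_rev)
qed

text \<open>Each k-element set is the image of k! injective tuples, all with the same minor, and a
  tuple with a repetition contributes 0. The point of the change is that tuples form a product set,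
  on which sums of products factor.\<close>

lemma infsum_set_minor:
  assumes sm: "tuple_minor M k summable_on tuples k"
  shows "(\<Sum>\<^sub>\<infinity>I\<in>{I. finite I \<and> card I = k}. set_minor M I) = (\<Sum>\<^sub>\<infinity>f\<in>tuples k. tuple_minor M k f) / fact k"
proof -
  let ?D = "tuple_minor M k" and ?S = "{I :: nat set. finite I \<and> card I = k}"
  let ?F = "\<lambda>I. {f \<in> tuples k. bij_betw f {..<k} I}"
  let ?T = "{f \<in> tuples k. inj_on f {..<k}}"
  have bij: "bij_betw snd (Sigma ?S ?F) ?T"
  proof (rule bij_betw_imageI)
    show "inj_on snd (Sigma ?S ?F)"
    proof (rule inj_onI)
      fix p q assume p: "p \<in> Sigma ?S ?F" and q: "q \<in> Sigma ?S ?F" and "snd p = snd q"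
      have img: "fst r = snd r ` {..<k}" if "r \<in> Sigma ?S ?F" for r
        using that by (cases r) (auto dest: bij_betw_imp_surj_on)
      have "fst p = snd p ` {..<k}" "fst q = snd p ` {..<k}"
        using img[OF p] img[OF q] \<open>snd p = snd q\<close> by simp_all
      then show "p = q" using \<open>snd p = snd q\<close> by (simp add: prod_eq_iff)
    qed
    show "snd ` Sigma ?S ?F = ?T"
    proof (intro equalityI subsetI)
      fix f assume f: "f \<in> ?T"
      then have "(f ` {..<k}, f) \<in> Sigma ?S ?F" by (simp add: bij_betw_def card_image)
      then show "f \<in> snd ` Sigma ?S ?F" by (rule image_eqI[rotated]) simp
    qed (auto simp: bij_betw_def)
  qed
  have smT: "?D summable_on ?T"
    using sm by (rule summable_on_subset_banach) auto
  then have smS: "(\<lambda>p. ?D (snd p)) summable_on (Sigma ?S ?F)"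
    by (subst summable_on_reindex_bij_betw[OF bij])
  have "(\<Sum>\<^sub>\<infinity>f\<in>tuples k. ?D f) = (\<Sum>\<^sub>\<infinity>f\<in>?T. ?D f)"
    by (rule infsum_cong_neutral) (auto simp: tuple_minor_not_inj)
  also have "\<dots> = (\<Sum>\<^sub>\<infinity>p\<in>Sigma ?S ?F. ?D (snd p))"
    by (rule infsum_reindex_bij_betw[OF bij, symmetric])
  also have "\<dots> = (\<Sum>\<^sub>\<infinity>I\<in>?S. \<Sum>\<^sub>\<infinity>f\<in>?F I. ?D f)"
    using infsum_Sigma'_banach[of "\<lambda>I f. ?D f" ?S ?F] smS by (simp add: case_prod_beta')
  also have "\<dots> = (\<Sum>\<^sub>\<infinity>I\<in>?S. fact k * set_minor M I)"
  proof (rule infsum_cong)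
    fix I assume "I \<in> ?S"
    then have I: "finite I" "card I = k" by auto
    have "(\<Sum>\<^sub>\<infinity>f\<in>?F I. ?D f) = (\<Sum>f\<in>?F I. ?D f)"
      by (rule infsum_finite[OF card_bij_tuples(1)[OF I]])
    also have "\<dots> = (\<Sum>f\<in>?F I. set_minor M I)"
      by (rule sum.cong[OF refl]) (auto intro: tuple_minor_bij)
    also have "\<dots> = fact k * set_minor M I"
      by (simp add: card_bij_tuples(2)[OF I])
    finally show "(\<Sum>\<^sub>\<infinity>f\<in>?F I. ?D f) = fact k * set_minor M I" .
  qed
  also have "\<dots> = fact k * (\<Sum>\<^sub>\<infinity>I\<in>?S. set_minor M I)"
    by (rule infsum_cmult_right')
  finally show ?thesis by simp
qed

subsection \<open>Independence of the orthonormal basis\<close>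

locale nuclear =
  fixes K :: "(real \<Rightarrow> complex) \<Rightarrow> real \<Rightarrow> complex" and F G :: "nat \<Rightarrow> real \<Rightarrow> complex"
  assumes F_L2: "\<And>n. F n \<in> L2" and G_L2: "\<And>n. G n \<in> L2" and K_L2: "\<And>u. u \<in> L2 \<Longrightarrow> K u \<in> L2"
    and FG_summable: "summable (\<lambda>n. l2_norm (F n) * l2_norm (G n))"
    and K_limit: "\<And>u. u \<in> L2 \<Longrightarrow> (\<lambda>N. l2_norm (\<lambda>x. K u x - (\<Sum>n<N. l2_inner u (F n) * G n x))) \<longlonglongrightarrow> 0"
begin

lemma FG_abs_summable: "(\<lambda>n. l2_norm (F n) * l2_norm (G n)) summable_on A"
proof -
  have "(\<lambda>n. l2_norm (F n) * l2_norm (G n)) summable_on UNIV"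
    by (rule norm_summable_imp_summable_on) (use FG_summable in simp)
  then show ?thesis by (rule summable_on_subset_banach) simp
qed

lemma matrix_entry_abs_summable:
  assumes "u \<in> L2" "v \<in> L2"
  shows "(\<lambda>n. l2_inner u (F n) * l2_inner (G n) v) abs_summable_on A"
proof (rule Infinite_Sum.abs_summable_on_comparison_test'[OF summable_on_cmult_right[OF FG_abs_summable, of "l2_norm u * l2_norm v"]])
  fix n
  have "norm (l2_inner u (F n) * l2_inner (G n) v) \<le> (l2_norm u * l2_norm (F n)) * (l2_norm (G n) * l2_norm v)"
    unfolding norm_mult by (intro mult_mono l2_inner_abs_le assms F_L2 G_L2) auto
  then show "norm (l2_inner u (F n) * l2_inner (G n) v) \<le> l2_norm u * l2_norm v * (l2_norm (F n) * l2_norm (G n))"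
    by (simp add: mult_ac)
qed

lemma matrix_entry:
  assumes u: "u \<in> L2" and v: "v \<in> L2"
  shows "(\<Sum>\<^sub>\<infinity>n. l2_inner u (F n) * l2_inner (G n) v) = l2_inner (K u) v"
proof -
  let ?S = "\<lambda>N x. \<Sum>n<N. l2_inner u (F n) * G n x"
  have S: "?S N \<in> L2" for N by (intro L2_sum L2_scale G_L2)
  have "(\<lambda>N. l2_inner (\<lambda>x. K u x - ?S N x) v) \<longlonglongrightarrow> 0"
    by (rule Lim_null_comparison[OF _ tendsto_mult_left_zero[OF K_limit[OF u], of "l2_norm v"]])
      (intro always_eventually allI l2_inner_abs_le L2_diff K_L2 u S v)
  moreover have "l2_inner (\<lambda>x. K u x - ?S N x) v = l2_inner (K u) v - (\<Sum>n<N. l2_inner u (F n) * l2_inner (G n) v)" for N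
    by (subst l2_inner_diff_left[OF K_L2[OF u] S v], subst l2_inner_sum_left)
      (auto simp: l2_inner_scale_left v intro!: L2_scale G_L2)
  ultimately have "(\<lambda>N. l2_inner (K u) v - (\<Sum>n<N. l2_inner u (F n) * l2_inner (G n) v)) \<longlonglongrightarrow> 0"
    by simp
  from tendsto_diff[OF tendsto_const[of "l2_inner (K u) v"] this]
  have 1: "(\<lambda>n. l2_inner u (F n) * l2_inner (G n) v) sums l2_inner (K u) v"
    by (simp add: sums_def)
  have "(\<lambda>n. l2_inner u (F n) * l2_inner (G n) v) summable_on UNIV"
    by (rule abs_summable_summable[OF matrix_entry_abs_summable[OF u v]])
  then have "((\<lambda>n. l2_inner u (F n) * l2_inner (G n) v) has_sum (\<Sum>\<^sub>\<infinity>n. l2_inner u (F n) * l2_inner (G n) v)) UNIV"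
    by (rule has_sum_infsum)
  from has_sum_imp_sums[OF this] 1 show ?thesis by (rule sums_unique2)
qed

text \<open>If K is regarded as a product AB through a sequence space, this is the matrix of BA up
  to transposition. Passing from K to it removes the orthonormal basis from the traces.\<close>

definition gram :: "nat \<Rightarrow> nat \<Rightarrow> complex" where "gram m n = l2_inner (G m) (F n)"

definition gram_tuple :: "nat \<Rightarrow> (nat \<Rightarrow> nat) \<Rightarrow> (nat \<Rightarrow> nat) \<Rightarrow> complex" where
  "gram_tuple k q n = (\<Prod>i<k. gram (n i) (n (q i)))"

lemma prod_permuted_norms:
  assumes q: "q permutes {..<k}"
  shows "(\<Prod>i<k. l2_norm (G (n i)) * l2_norm (F (n (q i)))) = (\<Prod>i<k. l2_norm (F (n i)) * l2_norm (G (n i)))"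
proof -
  have "(\<Prod>i<k. l2_norm (F (n (q i)))) = (\<Prod>i<k. l2_norm (F (n i)))"
    using prod.permute[OF q, of "\<lambda>i. l2_norm (F (n i))"] by (simp add: o_def)
  then show ?thesis by (simp add: prod.distrib mult.commute)
qed

lemma norm_prod_summable: "(\<lambda>n. \<Prod>i<k. l2_norm (F (n i)) * l2_norm (G (n i))) summable_on tuples k"
proof -
  have "(\<lambda>n. \<Prod>i<k. l2_norm (F (n i)) * l2_norm (G (n i))) abs_summable_on tuples k"
    by (rule abs_summable_on_prod_PiE_finite) (use FG_abs_summable in simp_all)
  then show ?thesis by (rule abs_summable_summable)
qed

lemma gram_tuple_abs_summable:
  assumes q: "q permutes {..<k}"
  shows "gram_tuple k q abs_summable_on tuples k"
proof (rule Infinite_Sum.abs_summable_on_comparison_test'[OF norm_prod_summable])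
  fix n
  have "norm (gram_tuple k q n) = (\<Prod>i<k. cmod (gram (n i) (n (q i))))"
    by (simp add: gram_tuple_def prod_norm)
  also have "\<dots> \<le> (\<Prod>i<k. l2_norm (G (n i)) * l2_norm (F (n (q i))))"
    unfolding gram_def by (intro prod_mono conjI norm_ge_zero l2_inner_abs_le F_L2 G_L2)
  finally show "norm (gram_tuple k q n) \<le> (\<Prod>i<k. l2_norm (F (n i)) * l2_norm (G (n i)))"
    unfolding prod_permuted_norms[OF q] .
qed

context
  fixes e assumes e: "orthonormal_basis e"
begin

definition mat_entry :: "nat \<Rightarrow> nat \<Rightarrow> complex" where "mat_entry i j = l2_inner (K (e j)) (e i)"

lemma e_on: "orthonormal e" using e by (rule orthonormal_basis_orthonormal)

lemma e_L2: "e n \<in> L2" by (rule orthonormal_L2[OF e_on])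

text \<open>Absolute convergence of the double sum over \<open>f\<close> (basis indices) and \<open>n\<close> (nuclear indices)
  allows to evaluate the trace of a cycle in either order.\<close>

lemma cycle_sum:
  assumes p: "p permutes {..<k}"
  shows "(\<lambda>f. \<Prod>i<k. mat_entry (f i) (f (p i))) summable_on tuples k"
    and "(\<Sum>\<^sub>\<infinity>f\<in>tuples k. \<Prod>i<k. mat_entry (f i) (f (p i))) = (\<Sum>\<^sub>\<infinity>n\<in>tuples k. gram_tuple k (inv p) n)"
proof -
  let ?q = "inv p"
  have q: "?q permutes {..<k}" by (rule permutes_inv[OF p])
  define t where "t n f = (\<Prod>i<k. l2_inner (e (f (p i))) (F (n i)) * l2_inner (G (n i)) (e (f i)))" for n f
  \<comment> \<open>By definition \<open>t\<close> factors over the nuclear indices n for fixed f;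
    reindexing by p makes it factor over the basis indices f for fixed n. This is where the inverse
    of p comes from.\<close>
  have t_eq: "t n f = (\<Prod>i<k. l2_inner (G (n i)) (e (f i)) * l2_inner (e (f i)) (F (n (?q i))))" for n f
  proof -
    have "(\<Prod>i<k. l2_inner (e (f (p i))) (F (n i))) = (\<Prod>i<k. l2_inner (e (f i)) (F (n (?q i))))"
      using prod.permute[OF p, of "\<lambda>i. l2_inner (e (f i)) (F (n (?q i)))"] permutes_inverses[OF p]
      by (simp add: o_def)
    then show ?thesis by (simp add: t_def prod.distrib mult.commute)
  qed
  have cm: "cmod (l2_inner (e j) (F m)) = cmod (l2_inner (F m) (e j))" for j m
    by (metis l2_inner_cnj complex_mod_cnj)
  have abs1: "(\<lambda>j. l2_inner (G a) (e j) * l2_inner (e j) (F b)) abs_summable_on UNIV" for a b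
    using Bessel_mult_summable[OF e_on G_L2 F_L2] by (simp add: norm_mult cm)
  have sum1: "(\<Sum>\<^sub>\<infinity>j. l2_inner (G a) (e j) * l2_inner (e j) (F b)) = gram a b" for a b
    unfolding gram_def by (rule infsumI[OF Parseval_has_sum[OF e G_L2 F_L2]])
  have norm1: "(\<Sum>\<^sub>\<infinity>j. norm (l2_inner (G a) (e j) * l2_inner (e j) (F b))) \<le> l2_norm (G a) * l2_norm (F b)" for a b
  proof (rule infsum_le_finite_sums[OF abs1])
    show "(\<Sum>j\<in>I. norm (l2_inner (G a) (e j) * l2_inner (e j) (F b))) \<le> l2_norm (G a) * l2_norm (F b)"
      if "finite I" for I
      using Bessel_mult[OF e_on G_L2 F_L2 that] by (simp add: norm_mult cm)
  qed
  have row_abs: "(\<lambda>f. t n f) abs_summable_on tuples k" for n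
    unfolding t_eq by (rule abs_summable_on_prod_PiE_finite) (simp_all add: abs1)
  have row: "(\<Sum>\<^sub>\<infinity>f\<in>tuples k. t n f) = gram_tuple k ?q n" for n
    unfolding t_eq gram_tuple_def
    by (subst infsum_prod_PiE_abs) (simp_all add: abs1 sum1)
  have row_norm: "(\<Sum>\<^sub>\<infinity>f\<in>tuples k. norm (t n f)) \<le> (\<Prod>i<k. l2_norm (F (n i)) * l2_norm (G (n i)))" for n
  proof -
    let ?a = "\<lambda>i j. norm (l2_inner (G (n i)) (e j) * l2_inner (e j) (F (n (?q i))))"
    have "(\<Sum>\<^sub>\<infinity>f\<in>tuples k. norm (t n f)) = (\<Sum>\<^sub>\<infinity>f\<in>tuples k. \<Prod>i<k. ?a i (f i))"
      unfolding t_eq by (simp add: prod_norm)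
    also have "\<dots> = (\<Prod>i<k. \<Sum>\<^sub>\<infinity>j. ?a i j)"
      by (rule infsum_prod_PiE_abs) (use abs1 in simp_all)
    also have "\<dots> \<le> (\<Prod>i<k. l2_norm (G (n i)) * l2_norm (F (n (?q i))))"
      by (intro prod_mono conjI norm1 infsum_nonneg) simp
    finally show ?thesis unfolding prod_permuted_norms[OF q] .
  qed
  have "(\<lambda>(n, f). t n f) abs_summable_on (tuples k \<times> tuples k)"
    unfolding Infinite_Sum.abs_summable_on_Sigma_iff
  proof (intro conjI ballI)
    fix n show "(\<lambda>f. case (n, f) of (n, f) \<Rightarrow> t n f) abs_summable_on tuples k"
      using row_abs by simp
  next
    have "(\<lambda>n. norm (\<Sum>\<^sub>\<infinity>f\<in>tuples k. norm (t n f))) summable_on tuples k"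
    proof (rule Infinite_Sum.abs_summable_on_comparison_test'[OF norm_prod_summable])
      fix n
      have "0 \<le> (\<Sum>\<^sub>\<infinity>f\<in>tuples k. norm (t n f))" by (rule infsum_nonneg) simp
      then show "norm (\<Sum>\<^sub>\<infinity>f\<in>tuples k. norm (t n f)) \<le> (\<Prod>i<k. l2_norm (F (n i)) * l2_norm (G (n i)))"
        using row_norm[of n] by simp
    qed
    then show "(\<lambda>n. \<Sum>\<^sub>\<infinity>f\<in>tuples k. norm (case (n, f) of (n, f) \<Rightarrow> t n f)) abs_summable_on tuples k"
      by simp
  qed
  then have sm: "(\<lambda>(n, f). t n f) summable_on (tuples k \<times> tuples k)"
    by (rule abs_summable_summable)
  have col: "(\<Sum>\<^sub>\<infinity>n\<in>tuples k. t n f) = (\<Prod>i<k. mat_entry (f i) (f (p i)))" for f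
  proof -
    have "(\<Sum>\<^sub>\<infinity>n\<in>tuples k. t n f) = (\<Prod>i<k. \<Sum>\<^sub>\<infinity>m. l2_inner (e (f (p i))) (F m) * l2_inner (G m) (e (f i)))"
      unfolding t_def
      by (rule infsum_prod_PiE_abs[of "{..<k}" "\<lambda>i m. l2_inner (e (f (p i))) (F m) * l2_inner (G m) (e (f i))"])
        (auto intro: matrix_entry_abs_summable e_L2)
    also have "\<dots> = (\<Prod>i<k. mat_entry (f i) (f (p i)))"
      by (simp add: matrix_entry[OF e_L2 e_L2] mat_entry_def)
    finally show ?thesis .
  qed
  have "(\<lambda>(f, n). t n f) summable_on (tuples k \<times> tuples k)"
    using sm by (subst (asm) summable_on_swap) simp
  then have "(\<lambda>f. \<Sum>\<^sub>\<infinity>n\<in>tuples k. t n f) summable_on tuples k"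
    by (rule summable_on_Sigma_banach)
  then show "(\<lambda>f. \<Prod>i<k. mat_entry (f i) (f (p i))) summable_on tuples k"
    by (simp only: col)
  show "(\<Sum>\<^sub>\<infinity>f\<in>tuples k. \<Prod>i<k. mat_entry (f i) (f (p i))) = (\<Sum>\<^sub>\<infinity>n\<in>tuples k. gram_tuple k ?q n)"
    using infsum_swap_banach[OF sm] by (simp only: col row)
qed

text \<open>Nothing on the right depends on \<open>e\<close>, which is the independence of the
  basis. The inverses left by \<open>cycle_sum\<close> disappear because inversion permutes the
  permutations and preserves signs.\<close>

lemma exterior_trace_eq:
  "exterior_trace e K k = (\<Sum>q | q permutes {..<k}. of_int (sign q) * (\<Sum>\<^sub>\<infinity>n\<in>tuples k. gram_tuple k q n)) / fact k"
proof -
  have entry: "exterior_entry e K I = set_minor mat_entry I" for I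
    by (simp add: exterior_entry_def set_minor_def mat_entry_def)
  have fin: "finite {p. p permutes {..<k}}" by (rule finite_permutations) simp
  let ?t = "\<lambda>p f. of_int (sign p) * (\<Prod>i<k. mat_entry (f i) (f (p i)))"
  have hs: "(?t p has_sum of_int (sign p) * (\<Sum>\<^sub>\<infinity>n\<in>tuples k. gram_tuple k (inv p) n)) (tuples k)"
    if "p permutes {..<k}" for p
    using has_sum_cmult_right[OF has_sum_infsum[OF cycle_sum(1)[OF that]], of "of_int (sign p)"]
    by (simp only: cycle_sum(2)[OF that])
  have "((\<lambda>f. \<Sum>p | p permutes {..<k}. ?t p f) has_sum
      (\<Sum>p | p permutes {..<k}. of_int (sign p) * (\<Sum>\<^sub>\<infinity>n\<in>tuples k. gram_tuple k (inv p) n))) (tuples k)"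
    by (rule has_sum_finite_sum[OF fin]) (use hs in auto)
  then have tm: "(tuple_minor mat_entry k has_sum
      (\<Sum>p | p permutes {..<k}. of_int (sign p) * (\<Sum>\<^sub>\<infinity>n\<in>tuples k. gram_tuple k (inv p) n))) (tuples k)"
    by (simp only: tuple_minor_def[abs_def])
  have "exterior_trace e K k = (\<Sum>\<^sub>\<infinity>f\<in>tuples k. tuple_minor mat_entry k f) / fact k"
    unfolding exterior_trace_def entry by (rule infsum_set_minor[OF has_sum_imp_summable[OF tm]])
  also have "(\<Sum>\<^sub>\<infinity>f\<in>tuples k. tuple_minor mat_entry k f) =
      (\<Sum>p | p permutes {..<k}. of_int (sign p) * (\<Sum>\<^sub>\<infinity>n\<in>tuples k. gram_tuple k (inv p) n))"
    by (rule infsumI[OF tm])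
  also have "\<dots> = (\<Sum>q | q permutes {..<k}. of_int (sign q) * (\<Sum>\<^sub>\<infinity>n\<in>tuples k. gram_tuple k q n))"
    by (subst sum_permutations_inverse, rule sum.cong)
      (auto simp: permutes_inv_inv sign_inverse permutes_imp_permutation[OF finite_lessThan])
  finally show ?thesis .
qed

end

text \<open>Boxes are cofinal among the finite sets of tuples. The unordered sum thereby becomes the
  limit of a sequence, the form to which dominated convergence applies.\<close>

lemma gram_tuple_box_limit:
  assumes q: "q permutes {..<k}"
  shows "(\<lambda>N. \<Sum>n\<in>{..<k} \<rightarrow>\<^sub>E {..<N}. gram_tuple k q n) \<longlonglongrightarrow> (\<Sum>\<^sub>\<infinity>n\<in>tuples k. gram_tuple k q n)"
proof -
  have "(gram_tuple k q has_sum (\<Sum>\<^sub>\<infinity>n\<in>tuples k. gram_tuple k q n)) (tuples k)"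
    by (rule has_sum_infsum[OF abs_summable_summable[OF gram_tuple_abs_summable[OF q]]])
  then have "(sum (gram_tuple k q) \<longlongrightarrow> (\<Sum>\<^sub>\<infinity>n\<in>tuples k. gram_tuple k q n)) (finite_subsets_at_top (tuples k))"
    by (simp add: has_sum_def)
  moreover have "filterlim (\<lambda>N. {..<k} \<rightarrow>\<^sub>E {..<N}) (finite_subsets_at_top (tuples k)) sequentially"
    unfolding filterlim_iff eventually_finite_subsets_at_top
  proof (intro allI impI)
    fix P assume "\<exists>X. finite X \<and> X \<subseteq> tuples k \<and> (\<forall>Y. finite Y \<and> X \<subseteq> Y \<and> Y \<subseteq> tuples k \<longrightarrow> P Y)"
    then obtain X where X: "finite X" "X \<subseteq> tuples k"
      and XP: "\<forall>Y. finite Y \<and> X \<subseteq> Y \<and> Y \<subseteq> tuples k \<longrightarrow> P Y" by (elim exE conjE)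
    \<comment> \<open>A crude common bound for all entries of all tuples in X.\<close>
    define N0 where "N0 = Suc (\<Sum>f\<in>X. \<Sum>i<k. f i)"
    have le: "f i < N0" if "f \<in> X" "i < k" for f i
    proof -
      have "f i \<le> (\<Sum>i<k. f i)" by (rule member_le_sum) (use that in auto)
      also have "\<dots> \<le> (\<Sum>f\<in>X. \<Sum>i<k. f i)" by (rule member_le_sum) (use that X in auto)
      finally show ?thesis by (simp add: N0_def)
    qed
    show "\<forall>\<^sub>F N in sequentially. P ({..<k} \<rightarrow>\<^sub>E {..<N})"
      using eventually_ge_at_top[of N0]
    proof eventually_elim
      case (elim N)
      show ?case
      proof (rule XP[THEN spec, THEN mp], intro conjI)
        show "finite ({..<k} \<rightarrow>\<^sub>E {..<N})" by (intro finite_PiE) auto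
        show "X \<subseteq> {..<k} \<rightarrow>\<^sub>E {..<N}"
        proof
          fix f assume f: "f \<in> X"
          then have "f \<in> extensional {..<k}" using X(2) by (auto simp: PiE_iff)
          then show "f \<in> {..<k} \<rightarrow>\<^sub>E {..<N}" using le[OF f] elim by (auto simp: PiE_iff intro: less_le_trans)
        qed
        show "{..<k} \<rightarrow>\<^sub>E {..<N} \<subseteq> tuples k" by (auto simp: PiE_iff)
      qed
    qed
  qed
  ultimately show ?thesis by (rule filterlim_compose)
qed

end

subsection \<open>Sorting\<close>

text \<open>Only neighbours are compared, matching the factors of the telescoped determinant. For k
  = 0 the truncated \<open>k - 1\<close> leaves the condition empty.\<close>

definition increasing :: "nat \<Rightarrow> (nat \<Rightarrow> real) \<Rightarrow> bool" where
  "increasing k x \<longleftrightarrow> (\<forall>i\<in>{..<k - 1}. x i < x (Suc i))"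

lemma increasing_less:
  assumes "increasing k x" "i < j" "j < k"
  shows "x i < x j"
  using assms(2,3)
proof (induction j)
  case (Suc j)
  have "x j < x (Suc j)" using assms(1) Suc.prems by (auto simp: increasing_def)
  then show ?case using Suc by (cases "i = j") auto
qed simp

lemma increasing_imp_inj: "increasing k x \<Longrightarrow> inj_on x {..<k}"
  unfolding inj_on_def by (metis increasing_less lessThan_iff less_irrefl linorder_neqE_nat)

text \<open>Existence comes from the sorted list of the values; uniqueness holds because two
  increasing rearrangements list the same set in sorted order and x is injective.\<close>

lemma sorting_permutation:
  fixes x :: "nat \<Rightarrow> real"
  assumes "inj_on x {..<k}"
  shows "\<exists>!\<sigma>. \<sigma> permutes {..<k} \<and> increasing k (x \<circ> \<sigma>)"
proof (rule ex_ex1I)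
  let ?xs = "sorted_list_of_set (x ` {..<k})"
  have len: "length ?xs = k" using assms by (simp add: card_image)
  define \<sigma> where "\<sigma> i = (if i < k then inv_into {..<k} x (?xs ! i) else i)" for i
  have mem: "?xs ! i \<in> x ` {..<k}" if "i < k" for i
    using nth_mem[of i ?xs] that len by simp
  have x\<sigma>: "x (\<sigma> i) = ?xs ! i" and \<sigma>_in: "\<sigma> i \<in> {..<k}" if "i < k" for i
    using that mem[OF that] by (simp_all add: \<sigma>_def f_inv_into_f inv_into_into del: lessThan_iff)
  have sorted: "?xs ! i < ?xs ! j" if "i < j" "j < k" for i j
    using that len strict_sorted_list_of_set[of "x ` {..<k}"] sorted_wrt_nth_less by metis
  have "inj_on \<sigma> {..<k}"
  proof (rule inj_onI)
    fix i j assume ij: "i \<in> {..<k}" "j \<in> {..<k}" "\<sigma> i = \<sigma> j"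
    then have "?xs ! i = ?xs ! j" using x\<sigma>[of i] x\<sigma>[of j] by auto
    then show "i = j" using sorted[of i j] sorted[of j i] ij by (cases i j rule: linorder_cases) auto
  qed
  moreover have "\<sigma> ` {..<k} \<subseteq> {..<k}" using \<sigma>_in by blast
  ultimately have "bij_betw \<sigma> {..<k} {..<k}"
    by (simp add: bij_betw_def endo_inj_surj)
  then have "\<sigma> permutes {..<k}" by (rule bij_imp_permutes) (simp add: \<sigma>_def)
  moreover have "increasing k (x \<circ> \<sigma>)" using x\<sigma> sorted by (auto simp: increasing_def)
  ultimately show "\<exists>\<sigma>. \<sigma> permutes {..<k} \<and> increasing k (x \<circ> \<sigma>)" by blast
next
  fix \<sigma> \<tau> assume \<sigma>: "\<sigma> permutes {..<k} \<and> increasing k (x \<circ> \<sigma>)" and \<tau>: "\<tau> permutes {..<k} \<and> increasing k (x \<circ> \<tau>)"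
  have list: "map (x \<circ> \<rho>) [0..<k] = sorted_list_of_set (x ` {..<k})"
    if "\<rho> permutes {..<k}" "increasing k (x \<circ> \<rho>)" for \<rho>
  proof (rule sorted_distinct_set_unique)
    show "sorted (map (x \<circ> \<rho>) [0..<k])"
      unfolding sorted_iff_nth_mono_less using increasing_less[OF that(2)] by (auto intro: less_imp_le)
    have "inj_on (x \<circ> \<rho>) {..<k}" by (rule increasing_imp_inj[OF that(2)])
    then show "distinct (map (x \<circ> \<rho>) [0..<k])" by (simp add: distinct_map lessThan_atLeast0)
    show "set (map (x \<circ> \<rho>) [0..<k]) = set (sorted_list_of_set (x ` {..<k}))"
    proof -
      have "(x \<circ> \<rho>) ` {..<k} = x ` {..<k}"
        unfolding image_comp[symmetric] permutes_image[OF that(1)] ..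
      then show ?thesis by (simp add: lessThan_atLeast0)
    qed
  qed simp_all
  show "\<sigma> = \<tau>"
  proof
    fix i
    show "\<sigma> i = \<tau> i"
    proof (cases "i < k")
      case True
      have "map (x \<circ> \<sigma>) [0..<k] = map (x \<circ> \<tau>) [0..<k]" using list \<sigma> \<tau> by simp
      from arg_cong[OF this, of "\<lambda>l. l ! i"] have "x (\<sigma> i) = x (\<tau> i)" using True by simp
      then show ?thesis
        using assms True permutes_in_image[of \<sigma> "{..<k}" i] permutes_in_image[of \<tau> "{..<k}" i] \<sigma> \<tau>
        by (auto dest: inj_onD)
    next
      case False
      then show ?thesis using \<sigma> \<tau> permutes_not_in[of \<sigma> "{..<k}" i] permutes_not_in[of \<tau> "{..<k}" i] by simp
    qed
  qed
qed

section \<open>Minors of the Green kernel at ordered points\<close>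

lemma tuple_minor_permute:
  assumes \<sigma>: "\<sigma> permutes {..<k}"
  shows "tuple_minor M k (f \<circ> \<sigma>) = tuple_minor M k f"
proof -
  have inv: "inv \<sigma> permutes {..<k}" by (rule permutes_inv[OF \<sigma>])
  have perm: "permutation \<rho>" if "\<rho> permutes {..<k}" for \<rho>
    using that by (rule permutes_imp_permutation[OF finite_lessThan])
  let ?g = "\<lambda>p. of_int (sign p) * (\<Prod>i<k. M (f i) (f (p i)))"
  have "tuple_minor M k (f \<circ> \<sigma>) = (\<Sum>p | p permutes {..<k}. ?g (\<sigma> \<circ> p \<circ> inv \<sigma>))"
    unfolding tuple_minor_def
  proof (rule sum.cong[OF refl])
    fix p assume "p \<in> {p. p permutes {..<k}}"
    then have p: "p permutes {..<k}" by simp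
    have s: "sign (\<sigma> \<circ> p \<circ> inv \<sigma>) = sign p"
      using perm[OF \<sigma>] perm[OF p] perm[OF inv] by (simp add: sign_compose permutation_compose sign_inverse)
    have "(\<Prod>i<k. M (f i) (f ((\<sigma> \<circ> p \<circ> inv \<sigma>) i))) = (\<Prod>i<k. M (f (\<sigma> i)) (f ((\<sigma> \<circ> p \<circ> inv \<sigma>) (\<sigma> i))))"
      using prod.permute[OF \<sigma>, of "\<lambda>i. M (f i) (f ((\<sigma> \<circ> p \<circ> inv \<sigma>) i))"] by (simp add: o_def)
    also have "\<dots> = (\<Prod>i<k. M (f (\<sigma> i)) (f (\<sigma> (p i))))"
      using permutes_inverses[OF \<sigma>] by simp
    finally show "of_int (sign p) * (\<Prod>i<k. M ((f \<circ> \<sigma>) i) ((f \<circ> \<sigma>) (p i))) = ?g (\<sigma> \<circ> p \<circ> inv \<sigma>)"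
      by (simp only: s o_apply)
  qed
  also have "\<dots> = (\<Sum>p | p permutes {..<k}. ?g (\<sigma> \<circ> p))"
    using sum_permutations_compose_right[OF inv, of "\<lambda>p. ?g (\<sigma> \<circ> p)"] by (simp only: comp_assoc)
  also have "\<dots> = (\<Sum>p | p permutes {..<k}. ?g p)"
    by (rule setum_permutations_compose_left[OF \<sigma>, symmetric])
  finally show ?thesis by (simp add: tuple_minor_def)
qed

text \<open>Column operation on the last column, followed by expansion along it.\<close>

lemma leibniz_last_column:
  fixes A :: "nat \<Rightarrow> nat \<Rightarrow> complex"
  assumes col: "\<And>i. i \<le> k \<Longrightarrow> A i (Suc k) = r * A i k"
  shows "(\<Sum>p | p permutes {..<Suc (Suc k)}. of_int (sign p) * (\<Prod>i<Suc (Suc k). A i (p i))) =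
    (A (Suc k) (Suc k) - r * A (Suc k) k) *
    (\<Sum>p | p permutes {..<Suc k}. of_int (sign p) * (\<Prod>i<Suc k. A i (p i)))"
proof -
  let ?l = "Suc k" and ?n = "Suc (Suc k)"
  let ?g = "\<lambda>j. if j = ?l then k else j"
  let ?P = "{p. p permutes {..<?n}}"
  define d where "d = A ?l ?l - r * A ?l k"
  have fin: "finite ?P" by (rule finite_permutations) simp
  \<comment> \<open>Each product is compared with r times the one in which the last column is
    replaced by the column before it. Above the last row the two agree by \<open>col\<close>, so a
    difference remains only when p fixes the last index. The replaced determinant has a repeated
    column and vanishes in the sum.\<close>
  have split: "(\<Prod>i<?n. A i (p i)) = (if p ?l = ?l then d * (\<Prod>i<?l. A i (p i)) else 0) + r * (\<Prod>i<?n. A i (?g (p i)))"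
    if p: "p permutes {..<?n}" for p
  proof -
    define i0 where "i0 = inv p ?l"
    have i0: "p i0 = ?l" using permutes_inverses(1)[OF p] by (simp add: i0_def)
    then have i0n: "i0 \<in> {..<?n}" using permutes_in_image[OF p, of i0] by simp
    have other: "p i \<noteq> ?l" if "i \<noteq> i0" for i
      using that i0 permutes_inj[OF p] by (metis injD)
    have rest: "(\<Prod>i\<in>{..<?n} - {i0}. A i (?g (p i))) = (\<Prod>i\<in>{..<?n} - {i0}. A i (p i))"
      by (rule prod.cong) (use other in auto)
    have "r * (\<Prod>i<?n. A i (?g (p i))) = r * (A i0 (?g (p i0)) * (\<Prod>i\<in>{..<?n} - {i0}. A i (?g (p i))))"
      by (subst prod.remove[OF _ i0n]) simp_all
    also have "\<dots> = r * A i0 k * (\<Prod>i\<in>{..<?n} - {i0}. A i (p i))"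
      unfolding rest by (simp add: i0)
    finally have R: "r * (\<Prod>i<?n. A i (?g (p i))) = r * A i0 k * (\<Prod>i\<in>{..<?n} - {i0}. A i (p i))" .
    have L: "(\<Prod>i<?n. A i (p i)) = A i0 ?l * (\<Prod>i\<in>{..<?n} - {i0}. A i (p i))"
      by (subst prod.remove[OF _ i0n]) (simp_all add: i0)
    show ?thesis
    proof (cases "p ?l = ?l")
      case True
      then have "i0 = ?l" using other by metis
      moreover have "{..<?n} - {?l} = {..<?l}" by auto
      ultimately show ?thesis unfolding R L using True by (simp add: d_def algebra_simps)
    next
      case False
      then have "i0 \<noteq> ?l" using i0 by auto
      then have "i0 \<le> k" using i0n by auto
      then show ?thesis unfolding R L using False col by simp
    qed
  qed
  have "(\<Sum>p\<in>?P. of_int (sign p) * (\<Prod>i<?n. A i (p i))) =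
      (\<Sum>p\<in>?P. (if p ?l = ?l then of_int (sign p) * (d * (\<Prod>i<?l. A i (p i))) else 0) +
         r * (of_int (sign p) * (\<Prod>i<?n. A i (?g (p i)))))"
    by (rule sum.cong[OF refl]) (use split in \<open>auto simp: algebra_simps\<close>)
  also have "\<dots> = (\<Sum>p\<in>?P. if p ?l = ?l then of_int (sign p) * (d * (\<Prod>i<?l. A i (p i))) else 0) +
      r * (\<Sum>p\<in>?P. of_int (sign p) * (\<Prod>i<?n. A i (?g (p i))))"
    by (simp only: sum.distrib sum_distrib_left)
  also have "(\<Sum>p\<in>?P. of_int (sign p) * (\<Prod>i<?n. A i (?g (p i)))) = 0"
    by (rule leibniz_repeated_column[of k _ ?l]) simp_all
  also have "(\<Sum>p\<in>?P. if p ?l = ?l then of_int (sign p) * (d * (\<Prod>i<?l. A i (p i))) else 0) =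
      (\<Sum>p\<in>{p \<in> ?P. p ?l = ?l}. of_int (sign p) * (d * (\<Prod>i<?l. A i (p i))))"
    using fin by (rule sum.inter_filter[symmetric])
  also have "{p \<in> ?P. p ?l = ?l} = {p. p permutes {..<?l}}"
  proof (intro equalityI subsetI)
    fix p assume p: "p \<in> {p \<in> ?P. p ?l = ?l}"
    then show "p \<in> {p. p permutes {..<?l}}"
      by (auto intro!: permutes_superset[of p "{..<?n}"] simp: less_Suc_eq)
  next
    fix p assume p: "p \<in> {p. p permutes {..<?l}}"
    then have "p permutes {..<?n}" by (auto intro: permutes_subset)
    moreover have "p ?l = ?l" using p by (auto intro: permutes_not_in)
    ultimately show "p \<in> {p \<in> ?P. p ?l = ?l}" by simp
  qed
  also have "(\<Sum>p | p permutes {..<?l}. of_int (sign p) * (d * (\<Prod>i<?l. A i (p i)))) =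
      d * (\<Sum>p | p permutes {..<?l}. of_int (sign p) * (\<Prod>i<?l. A i (p i)))"
    by (simp add: sum_distrib_left mult_ac)
  finally show ?thesis by (simp add: d_def)
qed

text \<open>For i \<le> k the minimum of x_i and the last point equals that of x_i and the point
  before it. So above the corner the last column is r times the preceding one, r being the
  exponential of \<kappa> times the last gap, and the corner is left with exactly the Volterra
  kernel of that gap.\<close>

lemma green_minor_increasing:
  assumes \<kappa>: "\<kappa> \<noteq> 0" and inc: "increasing (Suc k) x"
  shows "tuple_minor (green \<kappa> c) (Suc k) x = green \<kappa> c (x 0) (x 0) * (\<Prod>i<k. volterra_kernel \<kappa> (x (Suc i) - x i))"
  using inc
proof (induction k)
  case 0
  have "{p. p permutes {..<Suc 0}} = {id}"
  proof (intro equalityI subsetI)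
    fix p :: "nat \<Rightarrow> nat" assume "p \<in> {p. p permutes {..<Suc 0}}"
    then have p: "p permutes {..<Suc 0}" by simp
    have "p i = i" for i
      using permutes_in_image[OF p, of i] permutes_not_in[OF p, of i] by (cases "i = 0") auto
    then show "p \<in> {id}" by (simp add: fun_eq_iff)
  qed (simp add: permutes_id)
  then show ?case by (simp add: tuple_minor_def)
next
  case (Suc k)
  let ?l = "Suc k"
  define A where "A i j = green \<kappa> c (x i) (x j)" for i j
  define r where "r = exp (\<kappa> * of_real (x ?l - x k))"
  have lt: "x i < x j" if "i < j" "j < Suc ?l" for i j using increasing_less[OF Suc.prems] that by simp
  have col: "A i ?l = r * A i k" if "i \<le> k" for i
  proof -
    have "x i \<le> x k" using lt[of i k] that by (cases "i = k") auto
    moreover have "x k < x ?l" using lt[of k ?l] by simp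
    ultimately have "min (x i) (x ?l) = min (x i) (x k)" by simp
    moreover have "exp (\<kappa> * of_real (x ?l)) = r * exp (\<kappa> * of_real (x k))"
      unfolding r_def by (simp flip: exp_add add: algebra_simps)
    ultimately show ?thesis unfolding A_def green_def by (simp add: mult_ac)
  qed
  have d: "A ?l ?l - r * A ?l k = volterra_kernel \<kappa> (x ?l - x k)"
  proof -
    let ?a = "exp (\<kappa> * of_real (x ?l))"
    have m: "min (x ?l) (x k) = x k" using lt[of k ?l] by simp
    have e: "?a = r * exp (\<kappa> * of_real (x k))"
      unfolding r_def by (simp flip: exp_add add: algebra_simps)
    have "r * A ?l k = ?a * ?a * (c + (1 - exp (- (2 * \<kappa>) * of_real (x k))) / (2 * \<kappa>))"
      unfolding A_def green_def m by (subst (2) e) (simp add: mult_ac)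
    moreover have "A ?l ?l = ?a * ?a * (c + (1 - exp (- (2 * \<kappa>) * of_real (x ?l))) / (2 * \<kappa>))"
      unfolding A_def green_def by simp
    ultimately have "A ?l ?l - r * A ?l k =
        (?a * ?a * exp (- (2 * \<kappa>) * of_real (x k)) - ?a * ?a * exp (- (2 * \<kappa>) * of_real (x ?l))) / (2 * \<kappa>)"
      using \<kappa> by (simp add: field_simps)
    also have "?a * ?a * exp (- (2 * \<kappa>) * of_real (x ?l)) = 1"
      by (simp flip: exp_add add: algebra_simps)
    also have "?a * ?a * exp (- (2 * \<kappa>) * of_real (x k)) = exp (2 * \<kappa> * of_real (x ?l - x k))"
      by (simp flip: exp_add add: algebra_simps)
    finally show ?thesis by (simp add: volterra_kernel_def)
  qed
  have "tuple_minor (green \<kappa> c) (Suc ?l) x = volterra_kernel \<kappa> (x ?l - x k) * tuple_minor (green \<kappa> c) ?l x"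
    using leibniz_last_column[of k A r, OF col] unfolding d by (simp only: tuple_minor_def A_def)
  also have "tuple_minor (green \<kappa> c) ?l x = green \<kappa> c (x 0) (x 0) * (\<Prod>i<k. volterra_kernel \<kappa> (x (Suc i) - x i))"
    by (rule Suc.IH) (use Suc.prems in \<open>auto simp: increasing_def\<close>)
  finally show ?case by (simp add: mult_ac)
qed

subsection \<open>Integrals over the ordered simplex\<close>

interpretation half_lines: product_sigma_finite "\<lambda>_::nat. half_line"
  by standard

abbreviation half_space :: "nat \<Rightarrow> (nat \<Rightarrow> real) measure" where
  "half_space k \<equiv> Pi\<^sub>M {..<k} (\<lambda>_. half_line)"

lemma permute_coordinates_measurable:
  assumes "\<sigma> permutes {..<k}"
  shows "(\<lambda>x. x \<circ> \<sigma>) \<in> measurable (half_space k) (half_space k)"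
proof (rule measurable_PiM_single')
  fix i assume "i \<in> {..<k}"
  then have "\<sigma> i \<in> {..<k}" using permutes_in_image[OF assms] by simp
  then show "(\<lambda>x. (x \<circ> \<sigma>) i) \<in> measurable (half_space k) half_line"
    unfolding o_apply by (rule measurable_component_singleton)
next
  show "(\<lambda>x. x \<circ> \<sigma>) \<in> space (half_space k) \<rightarrow> {..<k} \<rightarrow>\<^sub>E space half_line"
    using permutes_in_image[OF assms] permutes_not_in[OF assms]
    by (auto simp: space_PiM PiE_iff extensional_def)
qed

text \<open>The two measures agree on boxes, where permuting the coordinates only reorders a finite
  product.\<close>

lemma distr_permute_coordinates:
  assumes \<sigma>: "\<sigma> permutes {..<k}"
  shows "distr (half_space k) (half_space k) (\<lambda>x. x \<circ> \<sigma>) = half_space k"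
proof (rule half_lines.PiM_eqI)
  fix A assume A: "\<And>i. i \<in> {..<k} \<Longrightarrow> A i \<in> sets half_line"
  have inv: "inv \<sigma> permutes {..<k}" by (rule permutes_inv[OF \<sigma>])
  have A': "A (inv \<sigma> i) \<in> sets half_line" if "i \<in> {..<k}" for i
    using A permutes_in_image[OF inv, of i] that by simp
  have vim: "(\<lambda>x. x \<circ> \<sigma>) -` Pi\<^sub>E {..<k} A \<inter> space (half_space k) = Pi\<^sub>E {..<k} (\<lambda>i. A (inv \<sigma> i))"
  proof (intro equalityI subsetI)
    fix x assume x: "x \<in> (\<lambda>x. x \<circ> \<sigma>) -` Pi\<^sub>E {..<k} A \<inter> space (half_space k)"
    have "x i \<in> A (inv \<sigma> i)" if "i \<in> {..<k}" for i
    proof -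
      have "inv \<sigma> i \<in> {..<k}" using permutes_in_image[OF inv, of i] that by simp
      then have "(x \<circ> \<sigma>) (inv \<sigma> i) \<in> A (inv \<sigma> i)" using x by (auto simp: PiE_iff)
      then show ?thesis using permutes_inverses(1)[OF \<sigma>] by simp
    qed
    then show "x \<in> Pi\<^sub>E {..<k} (\<lambda>i. A (inv \<sigma> i))" using x by (auto simp: space_PiM PiE_iff)
  next
    fix x assume x: "x \<in> Pi\<^sub>E {..<k} (\<lambda>i. A (inv \<sigma> i))"
    have "x (\<sigma> i) \<in> A i" if "i \<in> {..<k}" for i
    proof -
      have "\<sigma> i \<in> {..<k}" using permutes_in_image[OF \<sigma>, of i] that by simp
      then have "x (\<sigma> i) \<in> A (inv \<sigma> (\<sigma> i))" using x by (auto simp: PiE_iff)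
      then show ?thesis using permutes_inverses(2)[OF \<sigma>] by simp
    qed
    moreover have "x \<in> space (half_space k)"
      using x A'[THEN sets.sets_into_space] by (auto simp: space_PiM PiE_iff)
    moreover have "(x \<circ> \<sigma>) i = undefined" if "i \<notin> {..<k}" for i
      using x permutes_not_in[OF \<sigma> that] that by (auto simp: PiE_iff extensional_def)
    ultimately show "x \<in> (\<lambda>x. x \<circ> \<sigma>) -` Pi\<^sub>E {..<k} A \<inter> space (half_space k)"
      by (auto simp: PiE_iff extensional_def)
  qed
  have "emeasure (distr (half_space k) (half_space k) (\<lambda>x. x \<circ> \<sigma>)) (Pi\<^sub>E {..<k} A) =
      emeasure (half_space k) (Pi\<^sub>E {..<k} (\<lambda>i. A (inv \<sigma> i)))"
    by (subst emeasure_distr[OF permute_coordinates_measurable[OF \<sigma>] sets_PiM_I_finite[OF finite_lessThan A]])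
      (simp_all only: vim)
  also have "\<dots> = (\<Prod>i<k. emeasure half_line (A (inv \<sigma> i)))"
    by (rule half_lines.emeasure_PiM) (use A' in auto)
  also have "\<dots> = (\<Prod>i<k. emeasure half_line (A i))"
    using prod.permute[OF inv, of "\<lambda>i. emeasure half_line (A i)"] by (simp add: o_def)
  finally show "emeasure (distr (half_space k) (half_space k) (\<lambda>x. x \<circ> \<sigma>)) (Pi\<^sub>E {..<k} A) =
      (\<Prod>i<k. emeasure half_line (A i))" .
qed simp_all

lemma component_measurable:
  assumes "i < k"
  shows "(\<lambda>x. x i) \<in> measurable (half_space k) half_line" "(\<lambda>x. x i) \<in> borel_measurable (half_space k)"
proof -
  show 1: "(\<lambda>x. x i) \<in> measurable (half_space k) half_line"
    by (rule measurable_component_singleton) (use assms in simp)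
  show "(\<lambda>x. x i) \<in> borel_measurable (half_space k)"
    by (rule measurable_compose[OF 1 borel_measurable_ident_lebesgue_on])
qed

lemma increasing_measurable:
  shows "Measurable.pred (half_space k) (increasing k)"
proof -
  have [measurable]: "(\<lambda>x. x i) \<in> borel_measurable (half_space k)" if "i < k" for i
    by (rule component_measurable(2)[OF that])
  have "Measurable.pred (half_space k) (\<lambda>x. x i < x (Suc i))" if "i \<in> {..<k - 1}" for i
  proof -
    have "i < k" "Suc i < k" using that by auto
    then show ?thesis using component_measurable(2)[of i k] component_measurable(2)[of "Suc i" k]
      by (intro borel_measurable_pred_less)
  qed
  then show ?thesis unfolding increasing_def[abs_def] by (intro pred_intros_finite) auto
qed

text \<open>F is the sum over \<sigma> of its restriction to the ordered region, pulled back by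
  \<sigma>: off ties exactly one summand survives, at ties both sides are 0. All summands have the
  same integral because permuting coordinates preserves the product measure.\<close>

lemma integral_symmetrize:
  fixes F :: "(nat \<Rightarrow> real) \<Rightarrow> complex"
  assumes F: "integrable (half_space k) F"
    and sym: "\<And>\<sigma> x. \<sigma> permutes {..<k} \<Longrightarrow> F (x \<circ> \<sigma>) = F x"
    and ties: "\<And>x. \<not> inj_on x {..<k} \<Longrightarrow> F x = 0"
  shows "(LINT x|half_space k. F x) = fact k * (LINT x|half_space k. (if increasing k x then F x else 0))"
proof -
  let ?P = "{\<sigma>. \<sigma> permutes {..<k}}"
  let ?H = "\<lambda>x. if increasing k x then F x else 0"
  have fin: "finite ?P" by (rule finite_permutations) simp
  have H: "integrable (half_space k) ?H"
    by (rule integrable_if[OF F]) (use increasing_measurable[of k] in \<open>simp add: pred_def\<close>)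
  have eq: "F x = (\<Sum>\<sigma>\<in>?P. ?H (x \<circ> \<sigma>))" for x
  proof (cases "inj_on x {..<k}")
    case True
    then obtain \<tau> where \<tau>: "\<tau> permutes {..<k}" "increasing k (x \<circ> \<tau>)"
      and uniq: "\<And>\<sigma>. \<sigma> permutes {..<k} \<Longrightarrow> increasing k (x \<circ> \<sigma>) \<Longrightarrow> \<sigma> = \<tau>"
      using sorting_permutation by metis
    have "(\<Sum>\<sigma>\<in>?P. ?H (x \<circ> \<sigma>)) = (\<Sum>\<sigma>\<in>?P. if \<sigma> = \<tau> then F x else 0)"
    proof (rule sum.cong[OF refl])
      fix \<sigma> assume "\<sigma> \<in> ?P"
      then have \<sigma>: "\<sigma> permutes {..<k}" by simp
      show "?H (x \<circ> \<sigma>) = (if \<sigma> = \<tau> then F x else 0)"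
        using uniq[OF \<sigma>] \<tau>(2) sym[OF \<sigma>, of x] by (cases "\<sigma> = \<tau>") auto
    qed
    then show ?thesis using fin \<tau>(1) by simp
  next
    case False
    have "\<not> increasing k (x \<circ> \<sigma>)" if "\<sigma> permutes {..<k}" for \<sigma>
    proof
      assume "increasing k (x \<circ> \<sigma>)"
      then have "inj_on (x \<circ> \<sigma>) {..<k}" by (rule increasing_imp_inj)
      then have "inj_on x (\<sigma> ` {..<k})" by (rule inj_on_imageI)
      then show False using False permutes_image[OF that] by simp
    qed
    then show ?thesis using ties[OF False] by simp
  qed
  have perm: "integrable (half_space k) (\<lambda>x. ?H (x \<circ> \<sigma>))"
    "(LINT x|half_space k. ?H (x \<circ> \<sigma>)) = (LINT x|half_space k. ?H x)" if "\<sigma> \<in> ?P" for \<sigma>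
  proof -
    have \<sigma>: "\<sigma> permutes {..<k}" using that by simp
    have "integrable (distr (half_space k) (half_space k) (\<lambda>x. x \<circ> \<sigma>)) ?H"
      using H by (simp only: distr_permute_coordinates[OF \<sigma>])
    then show "integrable (half_space k) (\<lambda>x. ?H (x \<circ> \<sigma>))"
      by (rule integrable_distr[OF permute_coordinates_measurable[OF \<sigma>]])
    have "(LINT x|half_space k. ?H x) = (LINT x|distr (half_space k) (half_space k) (\<lambda>x. x \<circ> \<sigma>). ?H x)"
      by (simp only: distr_permute_coordinates[OF \<sigma>])
    also have "\<dots> = (LINT x|half_space k. ?H (x \<circ> \<sigma>))"
      by (rule integral_distr[OF permute_coordinates_measurable[OF \<sigma>] borel_measurable_integrable[OF H]])
    finally show "(LINT x|half_space k. ?H (x \<circ> \<sigma>)) = (LINT x|half_space k. ?H x)" by simp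
  qed
  have "(LINT x|half_space k. F x) = (LINT x|half_space k. (\<Sum>\<sigma>\<in>?P. ?H (x \<circ> \<sigma>)))"
    by (rule Bochner_Integration.integral_cong[OF refl eq])
  also have "\<dots> = (\<Sum>\<sigma>\<in>?P. LINT x|half_space k. ?H (x \<circ> \<sigma>))"
    by (rule Bochner_Integration.integral_sum[OF perm(1)])
  also have "\<dots> = (\<Sum>\<sigma>\<in>?P. LINT x|half_space k. ?H x)"
    by (rule sum.cong[OF refl perm(2)])
  also have "\<dots> = fact k * (LINT x|half_space k. ?H x)"
    using card_permutations[of "{..<k}" k] by simp
  finally show ?thesis .
qed

section \<open>Exterior traces of the Birman-Schwinger operator as Volterra iterates\<close>

context birman_schwinger_setting
begin

sublocale nuc: nuclear K nucF nucG
proof unfold_locales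
  show "nucF n \<in> L2" for n by (rule nucF_L2)
  show "nucG n \<in> L2" for n by (rule nucG_L2)
qed (rule nuc_summable K_L2 K_nuclear_limit; assumption?)+

abbreviation Vprod :: "nat \<Rightarrow> (nat \<Rightarrow> real) \<Rightarrow> complex" where
  "Vprod k x \<equiv> (\<Prod>i<k. of_real (V (x i)))"

lemma Vprod_integrable: "integrable (half_space k) (Vprod k)"
  by (rule half_lines.product_integrable_prod) (use V in auto)

lemma gV_prod_integrable: "integrable (half_space k) (\<lambda>x. \<Prod>i<k. (cmod (gV (x i)))\<^sup>2)"
  by (rule half_lines.product_integrable_prod) (use L2D(2)[OF gV_L2] in auto)

lemma half_space_component: "x \<in> space (half_space k) \<Longrightarrow> i < k \<Longrightarrow> x i > 0"
  by (auto simp: space_PiM PiE_iff)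

lemma measurable_component_fun:
  assumes "f \<in> borel_measurable half_line" "i < k"
  shows "(\<lambda>x. f (x i)) \<in> borel_measurable (half_space k)"
  by (rule measurable_compose[OF component_measurable(1)[OF assms(2)] assms(1)])

lemma measurable_component_green:
  assumes "i < k" "j < k"
  shows "(\<lambda>x. G (x i) (x j)) \<in> borel_measurable (half_space k)"
proof -
  have "(\<lambda>x. (x i, x j)) \<in> measurable (half_space k) (half_line \<Otimes>\<^sub>M half_line)"
    by (intro measurable_Pair component_measurable(1) assms)
  from measurable_compose[OF this green_measurable_pair] show ?thesis by simp
qed

text \<open>A product of one-dimensional integrals is an integral over the product space. Moving the
  permutation from the index of \<open>nucF\<close> to its argument gives both factors the index
  \<open>n i\<close>, so that the sum over n will factor.\<close>

lemma gram_tuple_integral: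
  assumes q: "q permutes {..<k}"
  shows "integrable (half_space k) (\<lambda>x. \<Prod>i<k. nucG (n i) (x i) * cnj (nucF (n i) (x (inv q i))))"
    and "nuc.gram_tuple k q n = (LINT x|half_space k. (\<Prod>i<k. nucG (n i) (x i) * cnj (nucF (n i) (x (inv q i)))))"
proof -
  have int: "integrable half_line (\<lambda>x. nucG (n i) x * cnj (nucF (n (q i)) x))" for i
    by (rule l2_inner_integrable[OF nucG_L2 nucF_L2])
  have eq: "(\<Prod>i<k. nucG (n i) (x i) * cnj (nucF (n (q i)) (x i))) =
      (\<Prod>i<k. nucG (n i) (x i) * cnj (nucF (n i) (x (inv q i))))" for x
  proof -
    have "(\<Prod>i<k. cnj (nucF (n (q i)) (x i))) = (\<Prod>i<k. cnj (nucF (n i) (x (inv q i))))"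
      using prod.permute[OF q, of "\<lambda>i. cnj (nucF (n i) (x (inv q i)))"] permutes_inverses[OF q]
      by (simp add: o_def)
    then show ?thesis by (simp add: prod.distrib)
  qed
  have "integrable (half_space k) (\<lambda>x. \<Prod>i<k. nucG (n i) (x i) * cnj (nucF (n (q i)) (x i)))"
    by (rule half_lines.product_integrable_prod) (auto intro: int)
  then show "integrable (half_space k) (\<lambda>x. \<Prod>i<k. nucG (n i) (x i) * cnj (nucF (n i) (x (inv q i))))"
    by (simp only: eq)
  have "nuc.gram_tuple k q n = (\<Prod>i<k. LINT x|half_line. nucG (n i) x * cnj (nucF (n (q i)) x))"
    by (simp add: nuc.gram_tuple_def nuc.gram_def l2_inner_def)
  also have "\<dots> = (LINT x|half_space k. (\<Prod>i<k. nucG (n i) (x i) * cnj (nucF (n (q i)) (x i))))"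
    by (rule half_lines.product_integral_prod[symmetric]) (auto intro: int)
  finally show "nuc.gram_tuple k q n = (LINT x|half_space k. (\<Prod>i<k. nucG (n i) (x i) * cnj (nucF (n i) (x (inv q i)))))"
    by (simp only: eq)
qed

text \<open>Over a box the sum over n factors into partial kernels under a single integral. These
  converge pointwise with majorant B2^k times the product of the |V(x_i)|. In the limit the factors
  \<open>sV\<close>, taken at permuted points, are reordered to combine with \<open>gV\<close> into
  V.\<close>

lemma infsum_gram_tuple:
  assumes q: "q permutes {..<k}"
  shows "integrable (half_space k) (\<lambda>x. Vprod k x * (\<Prod>i<k. G (x i) (x (inv q i))))"
    and "(\<Sum>\<^sub>\<infinity>n\<in>tuples k. nuc.gram_tuple k q n) =
      (LINT x|half_space k. Vprod k x * (\<Prod>i<k. G (x i) (x (inv q i))))"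
proof -
  have inv: "inv q permutes {..<k}" by (rule permutes_inv[OF q])
  have ik: "inv q i < k" if "i < k" for i using permutes_in_image[OF inv, of i] that by simp
  define kN where "kN N x y = (\<Sum>m<N. nucG m x * cnj (nucF m y))" for N x y
  let ?f = "\<lambda>x. Vprod k x * (\<Prod>i<k. G (x i) (x (inv q i)))"
  let ?s = "\<lambda>N x. \<Prod>i<k. kN N (x i) (x (inv q i))"
  let ?w = "\<lambda>x. B2 ^ k * (\<Prod>i<k. (cmod (gV (x i)))\<^sup>2)"
  have perm_s: "(\<Prod>i<k. g (x (inv q i))) = (\<Prod>i<k. g (x i))" for g :: "real \<Rightarrow> 'b::comm_monoid_mult" and x :: "nat \<Rightarrow> real"
    using prod.permute[OF inv, of "\<lambda>i. g (x i)"] by (simp add: o_def)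
  have f_eq: "?f x = (\<Prod>i<k. gV (x i) * G (x i) (x (inv q i)) * sV (x (inv q i)))" for x
  proof -
    have "Vprod k x = (\<Prod>i<k. gV (x i)) * (\<Prod>i<k. sV (x i))"
      by (simp add: V_factor flip: prod.distrib)
    also have "(\<Prod>i<k. sV (x i)) = (\<Prod>i<k. sV (x (inv q i)))" by (rule perm_s[symmetric])
    finally show ?thesis by (simp add: prod.distrib mult_ac)
  qed
  have box: "(\<Sum>n\<in>{..<k} \<rightarrow>\<^sub>E {..<N}. nuc.gram_tuple k q n) = (LINT x|half_space k. ?s N x)" for N
  proof -
    have "(\<Sum>n\<in>{..<k} \<rightarrow>\<^sub>E {..<N}. nuc.gram_tuple k q n) =
        (LINT x|half_space k. (\<Sum>n\<in>{..<k} \<rightarrow>\<^sub>E {..<N}. \<Prod>i<k. nucG (n i) (x i) * cnj (nucF (n i) (x (inv q i)))))"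
      unfolding gram_tuple_integral(2)[OF q]
      by (rule Bochner_Integration.integral_sum[symmetric]) (rule gram_tuple_integral(1)[OF q])
    also have "\<dots> = (LINT x|half_space k. ?s N x)"
      unfolding kN_def by (subst prod_sum_PiE) simp_all
    finally show ?thesis .
  qed
  have s_meas: "?s N \<in> borel_measurable (half_space k)" for N
    unfolding kN_def
    by (intro borel_measurable_prod borel_measurable_sum borel_measurable_times borel_measurable_cnj
        measurable_component_fun nuc_measurable) (auto intro: ik)
  have f_meas: "?f \<in> borel_measurable (half_space k)"
    by (intro borel_measurable_times borel_measurable_integrable[OF Vprod_integrable] borel_measurable_prod
        measurable_component_green) (auto intro: ik)
  have w: "integrable (half_space k) ?w"
    by (intro integrable_mult_right gV_prod_integrable)
  have dom: "norm (?s N x) \<le> ?w x" if x: "x \<in> space (half_space k)" for N x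
  proof -
    have "norm (?s N x) = (\<Prod>i<k. cmod (kN N (x i) (x (inv q i))))" by (simp add: prod_norm)
    also have "\<dots> \<le> (\<Prod>i<k. B2 * cmod (gV (x i)) * cmod (gV (x (inv q i))))"
    proof (rule prod_mono)
      fix i assume "i \<in> {..<k}"
      then have "x i \<ge> 0" "x (inv q i) \<ge> 0"
        using half_space_component[OF x] ik[of i] by (auto intro: less_imp_le)
      then show "0 \<le> cmod (kN N (x i) (x (inv q i))) \<and>
          cmod (kN N (x i) (x (inv q i))) \<le> B2 * cmod (gV (x i)) * cmod (gV (x (inv q i)))"
        unfolding kN_def by (intro conjI norm_ge_zero nuc_kernel_bound)
    qed
    also have "\<dots> = B2 ^ k * ((\<Prod>i<k. cmod (gV (x i))) * (\<Prod>i<k. cmod (gV (x (inv q i)))))"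
      by (simp add: prod.distrib mult_ac)
    also have "(\<Prod>i<k. cmod (gV (x (inv q i)))) = (\<Prod>i<k. cmod (gV (x i)))"
      by (rule perm_s[of "\<lambda>y. cmod (gV y)"])
    also have "B2 ^ k * ((\<Prod>i<k. cmod (gV (x i))) * (\<Prod>i<k. cmod (gV (x i)))) = ?w x"
      by (simp add: power2_eq_square prod.distrib)
    finally show ?thesis .
  qed
  have lim: "(\<lambda>N. ?s N x) \<longlonglongrightarrow> ?f x" if x: "x \<in> space (half_space k)" for x
    unfolding f_eq
  proof (rule tendsto_prod)
    fix i assume "i \<in> {..<k}"
    then have "x i \<ge> 0" "x (inv q i) \<ge> 0"
      using half_space_component[OF x] ik[of i] by (auto intro: less_imp_le)
    then show "(\<lambda>N. kN N (x i) (x (inv q i))) \<longlonglongrightarrow> gV (x i) * G (x i) (x (inv q i)) * sV (x (inv q i))"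
      using nuc_kernel_sums unfolding sums_def kN_def by blast
  qed
  have "(\<lambda>N. LINT x|half_space k. ?s N x) \<longlonglongrightarrow> (LINT x|half_space k. ?f x)"
    by (rule integral_dominated_convergence[OF f_meas s_meas w])
      (use lim dom in \<open>auto intro!: AE_I2\<close>)
  then have "(\<lambda>N. \<Sum>n\<in>{..<k} \<rightarrow>\<^sub>E {..<N}. nuc.gram_tuple k q n) \<longlonglongrightarrow> (LINT x|half_space k. ?f x)"
    by (simp only: box)
  then show "(\<Sum>\<^sub>\<infinity>n\<in>tuples k. nuc.gram_tuple k q n) = (LINT x|half_space k. ?f x)"
    by (rule LIMSEQ_unique[OF nuc.gram_tuple_box_limit[OF q]])
  show "integrable (half_space k) ?f"
    by (rule integrable_dominated_convergence[OF f_meas s_meas w, of id, unfolded id_apply])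
      (use lim dom in \<open>auto intro!: AE_I2\<close>)
qed

lemma exterior_trace_integral:
  assumes e: "orthonormal_basis e"
  shows "integrable (half_space k) (\<lambda>x. Vprod k x * tuple_minor G k x)"
    and "exterior_trace e K k = (LINT x|half_space k. Vprod k x * tuple_minor G k x) / fact k"
proof -
  let ?P = "{q. q permutes {..<k}}"
  let ?f = "\<lambda>q x. Vprod k x * (\<Prod>i<k. G (x i) (x (inv q i)))"
  have minor: "Vprod k x * tuple_minor G k x = (\<Sum>q\<in>?P. of_int (sign q) * ?f q x)" for x
  proof -
    have "tuple_minor G k x = (\<Sum>q\<in>?P. of_int (sign (inv q)) * (\<Prod>i<k. G (x i) (x (inv q i))))"
      unfolding tuple_minor_def by (rule sum_permutations_inverse)
    also have "\<dots> = (\<Sum>q\<in>?P. of_int (sign q) * (\<Prod>i<k. G (x i) (x (inv q i))))"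
      by (rule sum.cong[OF refl]) (simp add: sign_inverse permutes_imp_permutation[OF finite_lessThan])
    finally show ?thesis by (simp add: sum_distrib_left mult_ac)
  qed
  have int: "integrable (half_space k) (\<lambda>x. of_int (sign q) * ?f q x)" if "q \<in> ?P" for q
    using infsum_gram_tuple(1)[of q k] that by (intro integrable_mult_right) simp
  show "integrable (half_space k) (\<lambda>x. Vprod k x * tuple_minor G k x)"
    unfolding minor by (rule Bochner_Integration.integrable_sum[OF int])
  have "(LINT x|half_space k. Vprod k x * tuple_minor G k x) = (\<Sum>q\<in>?P. LINT x|half_space k. of_int (sign q) * ?f q x)"
    unfolding minor by (rule Bochner_Integration.integral_sum[OF int])
  also have "\<dots> = (\<Sum>q\<in>?P. of_int (sign q) * (\<Sum>\<^sub>\<infinity>n\<in>tuples k. nuc.gram_tuple k q n))"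
    by (rule sum.cong[OF refl]) (simp add: infsum_gram_tuple(2))
  finally show "exterior_trace e K k = (LINT x|half_space k. Vprod k x * tuple_minor G k x) / fact k"
    using nuc.exterior_trace_eq[OF e, of k] by simp
qed

text \<open>The integrand on the ordered simplex, extended by 0, with the ordering condition
  distributed over the factors. Each factor then involves only neighbouring variables, and the last
  variable can be integrated out alone.\<close>

definition chain :: "nat \<Rightarrow> (nat \<Rightarrow> real) \<Rightarrow> complex" where
  "chain j x = of_real (V (x 0)) * G (x 0) (x 0) *
     (\<Prod>i<j. if x i < x (Suc i) then volterra_kernel \<kappa> (x (Suc i) - x i) * of_real (V (x (Suc i))) else 0)"

lemma chain_Suc: "chain (Suc j) x = chain j x *
    (if x j < x (Suc j) then volterra_kernel \<kappa> (x (Suc j) - x j) * of_real (V (x (Suc j))) else 0)"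
  by (simp add: chain_def mult.assoc)

lemma chain_cong: "(\<And>i. i \<le> j \<Longrightarrow> x i = y i) \<Longrightarrow> chain j x = chain j y"
  unfolding chain_def by (intro arg_cong2[where f="(*)"] prod.cong) auto

lemma chain_measurable: "chain j \<in> borel_measurable (half_space (Suc j))"
proof -
  have Vm: "(\<lambda>x. complex_of_real (V (x i))) \<in> borel_measurable (half_space (Suc j))" if "i < Suc j" for i
    using measurable_compose[OF component_measurable(1)[OF that] V_measurable] by measurable
  have "(\<lambda>x. if x i < x (Suc i) then volterra_kernel \<kappa> (x (Suc i) - x i) * complex_of_real (V (x (Suc i))) else 0)
      \<in> borel_measurable (half_space (Suc j))" if i: "i < j" for i
  proof -
    have [measurable]: "(\<lambda>x. x i) \<in> borel_measurable (half_space (Suc j))"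
      "(\<lambda>x. x (Suc i)) \<in> borel_measurable (half_space (Suc j))"
      "(\<lambda>x. complex_of_real (V (x (Suc i)))) \<in> borel_measurable (half_space (Suc j))"
      using i by (auto intro: component_measurable(2) Vm)
    show ?thesis unfolding volterra_kernel_def by measurable
  qed
  then show ?thesis
    unfolding chain_def[abs_def]
    by (intro borel_measurable_times borel_measurable_prod Vm measurable_component_green) auto
qed

lemma chain_bound:
  assumes "\<And>i. i < Suc j \<Longrightarrow> x i \<ge> 0"
  shows "cmod (chain j x) \<le> B * (1 / cmod \<kappa>) ^ j * (\<Prod>i<Suc j. \<bar>V (x i)\<bar>)"
  using assms
proof (induction j)
  case 0
  then have "cmod (G (x 0) (x 0)) \<le> B" by (intro G_bound) auto
  then have "\<bar>V (x 0)\<bar> * cmod (G (x 0) (x 0)) \<le> \<bar>V (x 0)\<bar> * B" by (rule mult_left_mono) simp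
  then show ?case by (simp add: chain_def norm_mult mult.commute)
next
  case (Suc j)
  let ?t = "if x j < x (Suc j) then volterra_kernel \<kappa> (x (Suc j) - x j) * complex_of_real (V (x (Suc j))) else 0"
  have t: "cmod ?t \<le> (1 / cmod \<kappa>) * \<bar>V (x (Suc j))\<bar>"
  proof (cases "x j < x (Suc j)")
    case True
    then have "cmod (volterra_kernel \<kappa> (x (Suc j) - x j)) \<le> 1 / cmod \<kappa>" by (intro kernel_bound) simp
    from mult_right_mono[OF this abs_ge_zero[of "V (x (Suc j))"]] show ?thesis
      by (simp only: True if_True norm_mult norm_of_real)
  qed simp
  have IH: "cmod (chain j x) \<le> B * (1 / cmod \<kappa>) ^ j * (\<Prod>i<Suc j. \<bar>V (x i)\<bar>)"
    by (rule Suc.IH) (use Suc.prems in simp)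
  have "cmod (chain j x) * cmod ?t \<le>
      (B * (1 / cmod \<kappa>) ^ j * (\<Prod>i<Suc j. \<bar>V (x i)\<bar>)) * ((1 / cmod \<kappa>) * \<bar>V (x (Suc j))\<bar>)"
    by (rule mult_mono[OF IH t]) (intro mult_nonneg_nonneg B_nonneg zero_le_power prod_nonneg, auto)
  then show ?case unfolding chain_Suc norm_mult by (simp add: mult_ac)
qed

lemma chain_integrable:
  assumes \<phi>: "bdd_meas \<phi>"
  shows "integrable (half_space (Suc j)) (\<lambda>x. chain j x * \<phi> (x j))"
proof -
  obtain b where b: "\<And>x. x > 0 \<Longrightarrow> cmod (\<phi> x) \<le> b" and meas: "\<phi> \<in> borel_measurable half_line"
    using \<phi> unfolding bdd_meas_def by blast
  let ?w = "\<lambda>x. (B * (1 / cmod \<kappa>) ^ j * b) * (\<Prod>i<Suc j. \<bar>V (x i)\<bar>)"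
  show ?thesis
  proof (rule Bochner_Integration.integrable_bound)
    show "integrable (half_space (Suc j)) ?w"
      by (rule integrable_mult_right, rule half_lines.product_integrable_prod) (use V in auto)
    show "(\<lambda>x. chain j x * \<phi> (x j)) \<in> borel_measurable (half_space (Suc j))"
      by (rule borel_measurable_times[OF chain_measurable measurable_component_fun[OF meas]]) simp
    show "AE x in half_space (Suc j). norm (chain j x * \<phi> (x j)) \<le> norm (?w x)"
    proof (rule AE_I2)
      fix x assume x: "x \<in> space (half_space (Suc j))"
      have "norm (chain j x * \<phi> (x j)) \<le> (B * (1 / cmod \<kappa>) ^ j * (\<Prod>i<Suc j. \<bar>V (x i)\<bar>)) * b"
        unfolding norm_mult
        by (intro mult_mono chain_bound b mult_nonneg_nonneg B_nonneg zero_le_power prod_nonneg)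
          (use half_space_component[OF x] in \<open>auto intro: less_imp_le\<close>)
      also have "\<dots> = ?w x" by (simp only: mult_ac)
      also have "\<dots> \<le> norm (?w x)" by simp
      finally show "norm (chain j x * \<phi> (x j)) \<le> norm (?w x)" .
    qed
  qed
qed

lemma volterra_bdd_meas:
  assumes \<phi>: "bdd_meas \<phi>"
  shows "bdd_meas (volterra V \<kappa> \<phi>)"
proof -
  obtain b where b: "\<And>x. x > 0 \<Longrightarrow> cmod (\<phi> x) \<le> b" and meas: "\<phi> \<in> borel_measurable half_line"
    using \<phi> unfolding bdd_meas_def by blast
  have b0: "b \<ge> 0" using b[of 1] norm_ge_zero[of "\<phi> 1"] by linarith
  show ?thesis
  proof (rule bdd_measI[of _ "b * (Q 0 / cmod \<kappa>)"])
    show "volterra V \<kappa> \<phi> \<in> borel_measurable half_line"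
      by (rule continuous_measurable[OF volterra_continuous[OF \<phi>]])
    fix x :: real assume x: "x > 0"
    have "cmod (volterra V \<kappa> \<phi> x) \<le> b * (Q x / cmod \<kappa>)"
      using volterra_bound[OF meas b0, of 0 x] b x by simp
    also have "\<dots> \<le> b * (Q 0 / cmod \<kappa>)"
      using b0 Q_le[of x] x by (intro mult_left_mono divide_right_mono) auto
    finally show "cmod (volterra V \<kappa> \<phi> x) \<le> b * (Q 0 / cmod \<kappa>)" .
  qed
qed

lemma green_diagonal_eq: "G x x = green_diagonal c x"
proof -
  have "exp (\<kappa> * of_real x) * exp (\<kappa> * of_real x) * exp (- (2 * \<kappa>) * of_real x) = 1"
    by (simp flip: exp_add add: algebra_simps)
  moreover have "exp (\<kappa> * of_real x) * exp (\<kappa> * of_real x) = exp (2 * \<kappa> * of_real x)"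
    by (simp flip: exp_add add: algebra_simps)
  ultimately show ?thesis
    by (simp add: green_def green_diagonal_def volterra_kernel_def distrib_left right_diff_distrib times_divide_eq_right)
qed

text \<open>Integrating out the last variable of a chain applies one Volterra step.\<close>

lemma chain_integral:
  assumes "bdd_meas \<phi>"
  shows "(LINT x|half_space (Suc j). chain j x * \<phi> (x j)) =
    (LINT y|half_line. of_real (V y) * green_diagonal c y * ((volterra V \<kappa> ^^ j) \<phi>) y)"
  using assms
proof (induction j arbitrary: \<phi>)
  case 0
  obtain meas: "\<phi> \<in> borel_measurable half_line" using 0 unfolding bdd_meas_def by blast
  have [measurable]: "(\<lambda>y. G y y) \<in> borel_measurable half_line"
    using green_diagonal_bdd_meas[of c] unfolding green_diagonal_eq bdd_meas_def by blast
  have "(LINT x|half_space (Suc 0). chain 0 x * \<phi> (x 0)) =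
      (LINT x|Pi\<^sub>M {0::nat} (\<lambda>_. half_line). (\<lambda>y. of_real (V y) * G y y * \<phi> y) (x 0))"
    by (simp add: chain_def lessThan_Suc)
  also have "\<dots> = (LINT y|half_line. of_real (V y) * G y y * \<phi> y)"
    by (rule half_lines.product_integral_singleton) (use meas in measurable)
  finally show ?case by (simp add: green_diagonal_eq)
next
  case (Suc j)
  have set: "{..<Suc (Suc j)} = insert (Suc j) {..<Suc j}" by auto
  have int: "integrable (Pi\<^sub>M (insert (Suc j) {..<Suc j}) (\<lambda>_. half_line)) (\<lambda>x. chain (Suc j) x * \<phi> (x (Suc j)))"
    using chain_integrable[OF Suc.prems, of "Suc j"] by (simp only: set)
  have "(LINT x|half_space (Suc (Suc j)). chain (Suc j) x * \<phi> (x (Suc j))) =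
      (LINT x|half_space (Suc j). LINT y|half_line. chain (Suc j) (x(Suc j := y)) * \<phi> ((x(Suc j := y)) (Suc j)))"
    unfolding set by (rule half_lines.product_integral_insert[OF _ _ int]) auto
  also have "\<dots> = (LINT x|half_space (Suc j). chain j x * volterra V \<kappa> \<phi> (x j))"
  proof (rule Bochner_Integration.integral_cong[OF refl])
    fix x
    have "chain (Suc j) (x(Suc j := y)) * \<phi> ((x(Suc j := y)) (Suc j)) =
        chain j x * (if x j < y then volterra_kernel \<kappa> (y - x j) * of_real (V y) * \<phi> y else 0)" for y
    proof -
      have "chain j (x(Suc j := y)) = chain j x" by (rule chain_cong) auto
      then show ?thesis by (simp add: chain_Suc)
    qed
    then show "(LINT y|half_line. chain (Suc j) (x(Suc j := y)) * \<phi> ((x(Suc j := y)) (Suc j))) =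
        chain j x * volterra V \<kappa> \<phi> (x j)"
      unfolding volterra_def by (simp only: integral_mult_right_zero)
  qed
  also have "\<dots> = (LINT y|half_line. of_real (V y) * green_diagonal c y * ((volterra V \<kappa> ^^ j) (volterra V \<kappa> \<phi>)) y)"
    by (rule Suc.IH[OF volterra_bdd_meas[OF Suc.prems]])
  finally show ?case by (simp only: funpow_Suc_right o_apply)
qed

lemma increasing_minor_eq_chain:
  "(if increasing (Suc j) x then Vprod (Suc j) x * tuple_minor G (Suc j) x else 0) = chain j x"
proof (cases "increasing (Suc j) x")
  case True
  have "(\<Prod>i<j. if x i < x (Suc i) then volterra_kernel \<kappa> (x (Suc i) - x i) * complex_of_real (V (x (Suc i))) else 0) =
      (\<Prod>i<j. volterra_kernel \<kappa> (x (Suc i) - x i) * of_real (V (x (Suc i))))"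
    by (rule prod.cong) (use True in \<open>auto simp: increasing_def\<close>)
  moreover have "Vprod (Suc j) x = of_real (V (x 0)) * (\<Prod>i<j. of_real (V (x (Suc i))))"
    by (rule prod.lessThan_Suc_shift)
  ultimately show ?thesis
    unfolding chain_def if_P[OF True] green_minor_increasing[OF \<kappa>_nz True]
    by (simp only: prod.distrib mult_ac)
next
  case False
  then obtain i where "i < j" "\<not> x i < x (Suc i)" by (auto simp: increasing_def)
  then have "(\<Prod>i<j. if x i < x (Suc i) then volterra_kernel \<kappa> (x (Suc i) - x i) * complex_of_real (V (x (Suc i))) else 0) = 0"
    by (intro prod_zero) auto
  then show ?thesis using False by (simp add: chain_def)
qed

lemma exterior_trace_Suc:
  assumes e: "orthonormal_basis e"
  shows "exterior_trace e K (Suc j) = (LINT y|half_line. of_real (V y) * green_diagonal c y * m j y)"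
proof -
  let ?F = "\<lambda>x. Vprod (Suc j) x * tuple_minor G (Suc j) x"
  have "(LINT x|half_space (Suc j). ?F x) = fact (Suc j) * (LINT x|half_space (Suc j). (if increasing (Suc j) x then ?F x else 0))"
  proof (rule integral_symmetrize[OF exterior_trace_integral(1)[OF e]])
    fix \<sigma> and x :: "nat \<Rightarrow> real" assume \<sigma>: "\<sigma> permutes {..<Suc j}"
    have "Vprod (Suc j) (x \<circ> \<sigma>) = Vprod (Suc j) x"
      using prod.permute[OF \<sigma>, of "\<lambda>i. complex_of_real (V (x i))"] by (simp add: o_def)
    then show "?F (x \<circ> \<sigma>) = ?F x" by (simp only: tuple_minor_permute[OF \<sigma>])
  qed (simp add: tuple_minor_not_inj)
  also have "\<dots> = fact (Suc j) * (LINT x|half_space (Suc j). chain j x * (\<lambda>_. 1) (x j))"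
    by (simp only: increasing_minor_eq_chain mult_1_right)
  also have "(LINT x|half_space (Suc j). chain j x * (\<lambda>_. 1) (x j)) =
      (LINT y|half_line. of_real (V y) * green_diagonal c y * m j y)"
    unfolding jost_iterate_def by (rule chain_integral) (rule bdd_measI[of _ 1], auto)
  finally show ?thesis unfolding exterior_trace_integral(2)[OF e] by (simp only: nonzero_mult_div_cancel_left[OF fact_nonzero])
qed

lemma exterior_trace_0:
  assumes e: "orthonormal_basis e"
  shows "exterior_trace e K 0 = 1"
proof -
  have "tuple_minor G 0 x = 1" for x by (simp add: tuple_minor_def)
  \<comment> \<open>Writing the constant 1 as an empty product lets the product formula evaluate the
    integral over the space without coordinates.\<close>
  then have "exterior_trace e K 0 = (LINT x|half_space 0. (\<Prod>i<0. (\<lambda>_ _. 1 :: complex) i (x i)))"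
    unfolding exterior_trace_integral(2)[OF e] by simp
  also have "\<dots> = 1"
    by (subst half_lines.product_integral_prod) auto
  finally show ?thesis .
qed

lemma exterior_trace_sums:
  assumes e: "orthonormal_basis e" and \<zeta>: "\<kappa> = \<i> * \<zeta>"
  shows "exterior_trace e K sums (jost_function \<gamma> V \<zeta> / (of_real \<gamma> - \<kappa>))"
proof -
  have "(\<lambda>j. exterior_trace e K (Suc j)) sums (jost_function \<gamma> V \<zeta> / (of_real \<gamma> - \<kappa>) - 1)"
    unfolding exterior_trace_Suc[OF e] c_def by (rule jost_function_series[OF \<zeta> w_nz])
  from sums_Suc[OF this] show ?thesis by (simp add: exterior_trace_0[OF e])
qed

lemma perturbation_det_eq:
  assumes \<zeta>: "\<kappa> = \<i> * \<zeta>"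
  shows "perturbation_det \<gamma> V z = jost_function \<gamma> V \<zeta> / (of_real \<gamma> - \<kappa>)"
  unfolding perturbation_det_def fredholm_det_def
proof (rule the_equality)
  show "trace_class K \<and> (\<forall>e. orthonormal_basis e \<longrightarrow>
      (\<lambda>k. exterior_trace e K k) sums (jost_function \<gamma> V \<zeta> / (of_real \<gamma> - \<kappa>)))"
    using K_trace_class exterior_trace_sums[OF _ \<zeta>] by blast
  fix d assume "trace_class K \<and> (\<forall>e. orthonormal_basis e \<longrightarrow> (\<lambda>k. exterior_trace e K k) sums d)"
  \<comment> \<open>Here the existence of at least one orthonormal basis makes the description
    determine d.\<close>
  then have "exterior_trace h K sums d" using h by blast
  then show "d = jost_function \<gamma> V \<zeta> / (of_real \<gamma> - \<kappa>)"
    using exterior_trace_sums[OF h \<zeta>] by (rule sums_unique2)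
qed

end

theorem mainTheorem5:
  fixes \<gamma> :: real and V :: "real \<Rightarrow> real" and z :: complex
  assumes "V \<in> borel_measurable (lebesgue_on {0..})"
    and "integrable (lebesgue_on {0..}) (\<lambda>x. \<bar>V x\<bar>)"
    and "z \<in> resolvent_set (H0 \<gamma>)"
  shows "perturbation_det \<gamma> V z =
    jost_function \<gamma> V (upper_sqrt z) / (of_real \<gamma> - \<i> * upper_sqrt z)"
proof -
  have "integrable (lebesgue_on {0..}) V"
    using assms(1,2) by (simp add: integrable_abs_iff)
  \<comment> \<open>The assumptions concern [0,\<infinity>) including the endpoint;
    \<open>half_line\<close> omits it.\<close>
  then have V: "integrable half_line V"
    by (rule integrable_lebesgue_on_subset) auto
  note u = resolvent_set_upper_sqrt[OF assms(3)]
  interpret birman_schwinger_setting V "\<i> * upper_sqrt z" \<gamma> z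
    by unfold_locales (use V u assms(3) in auto)
  show ?thesis by (rule perturbation_det_eq) simp
qed

end
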